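(* Let $k$ be a field, $R=k[x_1,\dots,x_n]$, $1\le d\le n$, and let $I_1,\dots,I_r\subseteq\{1,\dots,n\}$ be subsets of size $d$ with $|I_i\cap I_j|\le d-2$ for all $i\ne j$. Let $K'$ be the squarefree equigenerated monomial ideal with squarefree complementary ideal $\overline{K'}=(x^{I_1},\dots,x^{I_r})$, i.e. $K'$ is generated by all squarefree monomials of degree $d$ other than $x^{I_1},\dots,x^{I_r}$. Then $R/K'$ has Betti table $$\begin{array}{c|cccccc} & 0 & 1 & \cdots & \ell & \cdots & n-d+1\\ \hline 0 & 1 & \cdot & \cdots & \cdot & \cdots & \cdot\\ \vdots & \cdot & \cdot & \cdots & \cdot & \cdots & \cdot\\ d-1 & \cdot & \binom{n}{d}-r & \cdots & \binom{d+\ell-2}{\ell-1}\binom{n}{d+\ell-1}-r\binom{n-d}{\ell-1} & \cdots & \binom{n-1}{n-d}-r \end{array}$$ In particular, $R/K'$ has projective dimension $n-d+1$ with linear resolution and defines a ring of type $\binom{n-1}{n-d}-r$.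
   Context: For $I\subseteq\{1,\dots,n\}$, $x^I=\prod_{i\in I}x_i$. Betti table convention: the entry in row $j$ and column $i$ is $\dim_k\operatorname{Tor}_i^R(R/K',k)_{i+j}$; dots and rows not shown are zero. The type of $R/K'$ is $\dim_k\operatorname{Tor}_p^R(R/K',k)$ with $p$ the projective dimension of $R/K'$.
   Formalization: The projective dimension and type claims are stated except when r = 1 and d = 1 or d = n, where they are false (e.g. d = n, r = 1 gives K' = 0, projective dimension 0, type 1); the Betti table and linear resolution are stated in all cases. *)

theory Defs
  imports
    Complex_Main
    "HOL-Library.Poly_Mapping"
    "HOL-Library.Extended_Nat"
    "HOL-Library.Cardinality"
begin

section \<open>The polynomial ring and squarefree monomial ideals\<close>

text \<open>
  The polynomial ring over \<open>'k\<close> whose variables are indexed by the finite type \<open>'n\<close>, so that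
  the number of variables is \<open>CARD('n)\<close>. Monomials are exponent vectors, and multiplication is
  the convolution product of \<^theory>\<open>HOL-Library.Poly_Mapping\<close>.
\<close>

type_synonym ('n, 'k) mpoly = "('n \<Rightarrow>\<^sub>0 nat) \<Rightarrow>\<^sub>0 'k"

definition Var :: "'n \<Rightarrow> ('n, 'k::comm_ring_1) mpoly" where
  "Var i = Poly_Mapping.single (Poly_Mapping.single i 1) 1"

definition sqfree_monom :: "'n set \<Rightarrow> ('n, 'k::comm_ring_1) mpoly" where
  "sqfree_monom I = (\<Prod>i\<in>I. Var i)"

definition mdeg :: "('n::finite \<Rightarrow>\<^sub>0 nat) \<Rightarrow> nat" where
  "mdeg m = (\<Sum>i\<in>UNIV. Poly_Mapping.lookup m i)"

definition const_coeff :: "('n, 'k::zero) mpoly \<Rightarrow> 'k" where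
  "const_coeff a = Poly_Mapping.lookup a 0"

definition ideal_gen :: "'a::comm_ring_1 set \<Rightarrow> 'a set" where
  "ideal_gen S = module.span (*) S"

text \<open>
  The ideal whose squarefree complementary ideal in degree \<open>d\<close> is generated by the monomials
  \<open>x\<^sup>I\<close> with \<open>I \<in> \<I>\<close>.
\<close>

definition sqfree_complement_ideal :: "nat \<Rightarrow> 'n::finite set set \<Rightarrow> ('n, 'k::field) mpoly set" where
  "sqfree_complement_ideal d \<I> = ideal_gen {sqfree_monom J |J. card J = d \<and> J \<notin> \<I>}"


section \<open>Resolutions\<close>

text \<open>
  All modules of a resolution live in the free module \<open>nat \<Rightarrow>\<^sub>0 'a\<close> of countable rank: a
  projective module is a direct summand of it, and a free module of finite rank is the
  submodule of the vectors supported on a finite set of basis indices. A linear map on a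
  direct summand extends to the whole module, so differentials are taken to be total.
\<close>

definition fscale :: "'a::comm_ring_1 \<Rightarrow> (nat \<Rightarrow>\<^sub>0 'a) \<Rightarrow> (nat \<Rightarrow>\<^sub>0 'a)" where
  "fscale a v = Poly_Mapping.map ((*) a) v"

lemma lookup_fscale: "Poly_Mapping.lookup (fscale a v) p = a * Poly_Mapping.lookup v p"
  by (simp add: fscale_def Poly_Mapping.map.rep_eq when_def)

lemma module_fscale: "module (fscale :: 'a::comm_ring_1 \<Rightarrow> _)"
  by unfold_locales (auto intro!: poly_mapping_eqI simp: lookup_fscale lookup_add algebra_simps)

lemma vector_space_fscale: "vector_space (fscale :: 'k::field \<Rightarrow> _)"
  by unfold_locales (auto intro!: poly_mapping_eqI simp: lookup_fscale lookup_add algebra_simps)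

lemma module_mult: "module ((*) :: 'a::comm_ring_1 \<Rightarrow> _)"
  by unfold_locales (auto simp: algebra_simps)

definition free_on :: "nat set \<Rightarrow> (nat \<Rightarrow>\<^sub>0 'a::zero) set" where
  "free_on B = {v. Poly_Mapping.keys v \<subseteq> B}"

definition projective :: "(nat \<Rightarrow>\<^sub>0 'a::comm_ring_1) set \<Rightarrow> bool" where
  "projective P \<longleftrightarrow> module.subspace fscale P \<and>
     (\<exists>Q. module.subspace fscale Q \<and> P \<inter> Q = {0} \<and> {p + q |p q. p \<in> P \<and> q \<in> Q} = UNIV)"

text \<open>
  Exactness of \<open>\<cdots> \<rightarrow> P 1 \<rightarrow> P 0 \<rightarrow> R/K \<rightarrow> 0\<close>, where \<open>D i\<close> maps \<open>P (i + 1)\<close> to \<open>P i\<close>. The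
  augmentation \<open>P 0 \<rightarrow> R/K\<close> is represented by a lift \<open>\<epsilon>\<close> to \<open>R\<close>, which exists whenever
  \<open>P 0\<close> is projective.
\<close>

definition resolution ::
  "'a::comm_ring_1 set \<Rightarrow> (nat \<Rightarrow> (nat \<Rightarrow>\<^sub>0 'a) set) \<Rightarrow>
   (nat \<Rightarrow> (nat \<Rightarrow>\<^sub>0 'a) \<Rightarrow> (nat \<Rightarrow>\<^sub>0 'a)) \<Rightarrow> ((nat \<Rightarrow>\<^sub>0 'a) \<Rightarrow> 'a) \<Rightarrow> bool" where
  "resolution K P D \<epsilon> \<longleftrightarrow>
     (\<forall>i. module.subspace fscale (P i)) \<and>
     (\<forall>i. module_hom fscale fscale (D i)) \<and>
     module_hom fscale (*) \<epsilon> \<and>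
     (\<forall>a. \<exists>v\<in>P 0. a - \<epsilon> v \<in> K) \<and>
     D 0 ` P 1 = {v \<in> P 0. \<epsilon> v \<in> K} \<and>
     (\<forall>i. D (Suc i) ` P (Suc (Suc i)) = {v \<in> P (Suc i). D i v = 0})"

text \<open>
  The projective dimension of \<open>R/K\<close>; it is \<open>\<infinity>\<close> if there is no finite projective resolution.
  For finitely generated modules over a Noetherian ring it suffices to consider countably
  generated projective modules.
\<close>

definition proj_dim :: "'a::comm_ring_1 set \<Rightarrow> enat" where
  "proj_dim K = Inf {enat p |p. \<exists>P D \<epsilon>. resolution K P D \<epsilon> \<and> (\<forall>i. projective (P i)) \<and>
                                     (\<forall>i>p. P i = {0})}"

text \<open>
  A complex of graded free modules of finite rank: the basis elements of the \<open>i\<close>-th module are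
  indexed by \<open>gens F i\<close>, and the one with index \<open>p\<close> has degree \<open>shift F i p\<close>.
\<close>

record (overloaded) ('n, 'k) graded_free =
  gens :: "nat \<Rightarrow> nat set"
  shift :: "nat \<Rightarrow> nat \<Rightarrow> int"
  diff :: "nat \<Rightarrow> (nat \<Rightarrow>\<^sub>0 (('n \<Rightarrow>\<^sub>0 nat) \<Rightarrow>\<^sub>0 'k::comm_ring_1)) \<Rightarrow> (nat \<Rightarrow>\<^sub>0 (('n \<Rightarrow>\<^sub>0 nat) \<Rightarrow>\<^sub>0 'k))"
  aug :: "(nat \<Rightarrow>\<^sub>0 (('n \<Rightarrow>\<^sub>0 nat) \<Rightarrow>\<^sub>0 'k)) \<Rightarrow> (('n \<Rightarrow>\<^sub>0 nat) \<Rightarrow>\<^sub>0 'k)"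

text \<open>The last two conditions say that all maps preserve degrees.\<close>

definition graded_free_resolution ::
  "('n::finite, 'k::field) mpoly set \<Rightarrow> ('n, 'k) graded_free \<Rightarrow> bool" where
  "graded_free_resolution K F \<longleftrightarrow>
     (\<forall>i. finite (gens F i)) \<and>
     resolution K (\<lambda>i. free_on (gens F i)) (diff F) (aug F) \<and>
     (\<forall>i. \<forall>q\<in>gens F (Suc i). \<forall>p.
        \<forall>m\<in>Poly_Mapping.keys (Poly_Mapping.lookup (diff F i (Poly_Mapping.single q 1)) p).
          int (mdeg m) + shift F i p = shift F (Suc i) q) \<and>
     (\<forall>p\<in>gens F 0. \<forall>m\<in>Poly_Mapping.keys (aug F (Poly_Mapping.single p 1)).
          int (mdeg m) = shift F 0 p)"

text \<open>Minimality: the image of each differential lies in \<open>(x\<^sub>1, \<dots>, x\<^sub>n)\<close> times its target.\<close>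

definition minimal_graded_free_resolution ::
  "('n::finite, 'k::field) mpoly set \<Rightarrow> ('n, 'k) graded_free \<Rightarrow> bool" where
  "minimal_graded_free_resolution K F \<longleftrightarrow> graded_free_resolution K F \<and>
     (\<forall>i. \<forall>q\<in>gens F (Suc i). \<forall>p.
        const_coeff (Poly_Mapping.lookup (diff F i (Poly_Mapping.single q 1)) p) = 0)"

text \<open>
  The minimal resolution of \<open>R/K\<close> is \<open>d\<close>-linear: it has the form
  \<open>\<cdots> \<rightarrow> R(-d-1)\<^sup>b \<rightarrow> R(-d)\<^sup>a \<rightarrow> R\<close>.
\<close>

definition has_linear_resolution :: "nat \<Rightarrow> ('n::finite, 'k::field) mpoly set \<Rightarrow> bool" where
  "has_linear_resolution d K \<longleftrightarrow> (\<exists>F. minimal_graded_free_resolution K F \<and>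
     card (gens F 0) = 1 \<and> (\<forall>p\<in>gens F 0. shift F 0 p = 0) \<and>
     (\<forall>i\<ge>1. \<forall>p\<in>gens F i. shift F i p = int d + int i - 1))"


section \<open>Tor, Betti numbers and type\<close>

text \<open>
  The homology dimension of a complex \<open>\<cdots> \<rightarrow> C 1 \<rightarrow> C 0 \<rightarrow> 0\<close> of finite-dimensional vector
  spaces, where \<open>\<delta> i\<close> maps \<open>C (i + 1)\<close> to \<open>C i\<close>.
\<close>

definition homology_dim ::
  "(nat \<Rightarrow> (nat \<Rightarrow>\<^sub>0 'k::field) set) \<Rightarrow> (nat \<Rightarrow> (nat \<Rightarrow>\<^sub>0 'k) \<Rightarrow> (nat \<Rightarrow>\<^sub>0 'k)) \<Rightarrow> nat \<Rightarrow> nat" where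
  "homology_dim C \<delta> i =
     vector_space.dim fscale (case i of 0 \<Rightarrow> C 0 | Suc j \<Rightarrow> {w \<in> C (Suc j). \<delta> j w = 0})
     - vector_space.dim fscale (\<delta> i ` C (Suc i))"

text \<open>
  For \<open>k = R/(x\<^sub>1, \<dots>, x\<^sub>n)\<close> and a free module \<open>free_on B\<close>, the tensor product
  with \<open>k\<close> over \<open>R\<close> is the space \<open>free_on B\<close> over \<open>k\<close>. The differential induced on it is
  computed by lifting a vector of scalars to constant polynomials and passing to constant
  coefficients in the result. As \<open>k\<close> is concentrated in degree 0, the degree \<open>s\<close> part is
  spanned by the basis elements of degree \<open>s\<close>.
\<close>

definition residue_diff ::
  "('n, 'k::field) graded_free \<Rightarrow> nat \<Rightarrow> (nat \<Rightarrow>\<^sub>0 'k) \<Rightarrow> (nat \<Rightarrow>\<^sub>0 'k)" where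
  "residue_diff F i w =
     Poly_Mapping.map const_coeff (diff F i (Poly_Mapping.map (Poly_Mapping.single 0) w))"

text \<open>Tor is computed from an arbitrarily chosen graded free resolution.\<close>

definition chosen_resolution :: "('n::finite, 'k::field) mpoly set \<Rightarrow> ('n, 'k) graded_free" where
  "chosen_resolution K = (SOME F. graded_free_resolution K F)"

text \<open>The dimension of \<open>Tor\<^sub>i(R/K, k)\<close>.\<close>

definition tor_dim :: "('n::finite, 'k::field) mpoly set \<Rightarrow> nat \<Rightarrow> nat" where
  "tor_dim K i = (let F = chosen_resolution K in
     homology_dim (\<lambda>l. free_on (gens F l)) (residue_diff F) i)"

text \<open>The dimension of the degree \<open>s\<close> part of \<open>Tor\<^sub>i(R/K, k)\<close>.\<close>

definition graded_tor_dim :: "('n::finite, 'k::field) mpoly set \<Rightarrow> nat \<Rightarrow> int \<Rightarrow> nat" where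
  "graded_tor_dim K i s = (let F = chosen_resolution K in
     homology_dim (\<lambda>l. free_on {p \<in> gens F l. shift F l p = s}) (residue_diff F) i)"

text \<open>The entry in column \<open>i\<close> and row \<open>j\<close> of the Betti table of \<open>R/K\<close>.\<close>

definition betti_table :: "('n::finite, 'k::field) mpoly set \<Rightarrow> nat \<Rightarrow> int \<Rightarrow> nat" where
  "betti_table K i j = graded_tor_dim K i (int i + j)"

text \<open>The type of \<open>R/K\<close>, for \<open>R/K\<close> of finite projective dimension.\<close>

definition ring_type :: "('n::finite, 'k::field) mpoly set \<Rightarrow> nat" where
  "ring_type K = tor_dim K (the_enat (proj_dim K))"

end

theory Submission
  imports Defs "HOL-Library.Nat_Bijection"
begin

text \<open>
  For a set \<open>W\<close> of variables let \<open>V W\<close> be the space of simplicial cocycles on the \<open>d\<close>-subsets of \<open>W\<close>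
  that vanish on the sets \<open>I\<^sub>j\<close>. The modules \<open>\<Oplus> V W \<otimes> R(-W)\<close>, summed over \<open>card W = d + i - 1\<close>, with
  the signed sums of \<open>x\<^sub>j\<close> times the restriction maps \<open>V W \<rightarrow> V (W - {j})\<close>, form a \<open>d\<close>-linear
  resolution of \<open>R/K'\<close>. In a fixed multidegree it becomes a complex of vector spaces that depends
  only on the support \<open>A\<close> of the multidegree; that complex is exact by induction on \<open>A\<close>: if \<open>v\<close> is the
  largest element of \<open>A\<close>, cocycles extend from \<open>W\<close> to \<open>W \<union> {v}\<close>, and the cocycles on \<open>W \<union> {v}\<close> that
  vanish on \<open>W\<close> are the cocycles of the same kind for \<open>d - 1\<close> and the link of \<open>v\<close>. The extension is
  possible because the \<open>(d - 1)\<close>-subsets of the different \<open>I\<^sub>j\<close> are distinct, so that cochains can be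
  corrected independently on each of them. The same induction gives
  \<open>dim (V W) = (card W - 1 choose d - 1) - card {j. I\<^sub>j \<subseteq> W}\<close>.

  The Betti numbers are those of this resolution because it is minimal and any two resolutions are
  homotopy equivalent. A shorter projective resolution would, after reduction modulo the variables,
  make the identity of the top module zero.
\<close>

text \<open>The squarefree monomials outside \<open>K'\<close> are those in fewer than
  \<open>d\<close> variables and the given ones of degree \<open>d\<close>: two
  \<open>d\<close>-subsets of a set with \<open>d + 1\<close> elements meet in \<open>d - 1\<close>
  elements, so nothing larger survives. By Hochster's formula, Tor in multidegree \<open>W\<close>
  comes from the reduced cohomology in dimension \<open>d - 2\<close> of this simplicial complex
  restricted to \<open>W\<close>; as the full simplex on \<open>W\<close> is acyclic, the coboundary
  map identifies that cohomology with \<open>V W\<close>. Each given set inside \<open>W\<close>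
  imposes one independent linear condition, whence the subtraction in the Betti numbers.

  Passing to the link lowers \<open>d\<close>, so the induction meets two degenerate cases in which
  cocycles may fail to extend: \<open>d = 0\<close>, and \<open>d = 1\<close> with
  \<open>{v}\<close> in the family. There the cocycles on nonempty sets, respectively on sets
  containing \<open>v\<close>, vanish altogether. Vertices are added in increasing order because a
  new largest vertex leaves the signs of the others unchanged. The cochain arguments never divide,
  which is why the Betti numbers do not depend on the characteristic.\<close>

abbreviation "lookup \<equiv> Poly_Mapping.lookup"
abbreviation "single \<equiv> Poly_Mapping.single"
abbreviation "keys \<equiv> Poly_Mapping.keys"
type_synonym ('m, 'k) vec = "nat \<Rightarrow>\<^sub>0 ('m \<Rightarrow>\<^sub>0 'k)"

section \<open>Cochains on a simplex\<close>

text \<open>Only elements below \<open>j\<close> are counted, so the value is the same whether or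
  not \<open>j\<close> belongs to \<open>W\<close>: one sign serves for removing a vertex in
  \<open>cob\<close> and for adding one in \<open>bd\<close>.\<close>

definition sg :: "nat \<Rightarrow> nat set \<Rightarrow> 'k::comm_ring_1" where
  "sg j W = (-1) ^ card {w \<in> W. w < j}"

definition cob :: "(nat set \<Rightarrow> 'k::comm_ring_1) \<Rightarrow> nat set \<Rightarrow> 'k" where
  "cob b U = (\<Sum>i\<in>U. sg i U * b (U - {i}))"

text \<open>A cochain is a function on all sets that is zero off the admissible
  \<open>d\<close>-subsets. Equality of cochains is then equality of functions, and unique existence
  can be stated without restricting domains.\<close>

definition cocyc :: "nat \<Rightarrow> nat set set \<Rightarrow> nat set \<Rightarrow> (nat set \<Rightarrow> 'k::comm_ring_1) set" where
  "cocyc d \<I> W = {c. (\<forall>J. c J \<noteq> 0 \<longrightarrow> J \<subseteq> W \<and> card J = d \<and> J \<notin> \<I>) \<and>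
                     (\<forall>U\<subseteq>W. card U = Suc d \<longrightarrow> cob c U = 0)}"

text \<open>Addition replaces \<open>d - 2\<close>, since truncated subtraction would admit two
  distinct singletons for \<open>d = 1\<close>.\<close>

definition far :: "nat \<Rightarrow> 'a set set \<Rightarrow> bool" where
  "far d \<I> \<longleftrightarrow> (\<forall>I\<in>\<I>. finite I \<and> card I = d) \<and>
                (\<forall>I\<in>\<I>. \<forall>J\<in>\<I>. I \<noteq> J \<longrightarrow> card (I \<inter> J) + 2 \<le> d)"

definition link :: "'a \<Rightarrow> 'a set set \<Rightarrow> 'a set set" where
  "link v \<I> = (\<lambda>I. I - {v}) ` {I \<in> \<I>. v \<in> I}"

lemma sg_sg [simp]: "sg j W * sg j W = 1"
  by (simp add: sg_def flip: power_add mult_2)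

lemma sg_sg_mult [simp]: "sg j W * (sg j W * x) = x"
  by (simp flip: mult.assoc)

lemma sg_insert_self: "sg j (insert j W) = sg j W"
  unfolding sg_def by (rule arg_cong[where f="\<lambda>A. (-1) ^ card A"]) auto

lemma sg_remove_self: "sg j (W - {j}) = sg j W"
  unfolding sg_def by (rule arg_cong[where f="\<lambda>A. (-1) ^ card A"]) auto

lemma sg_insert_ge: "i \<le> v \<Longrightarrow> sg i (insert v W) = sg i W"
  unfolding sg_def by (rule arg_cong[where f="\<lambda>A. (-1) ^ card A"]) auto

lemma sg_insert_less:
  assumes "finite W" "v \<notin> W" "v < i" shows "sg i (insert v W) = - sg i W"
proof -
  have "{w \<in> insert v W. w < i} = insert v {w \<in> W. w < i}" using assms by auto
  then show ?thesis using assms by (simp add: sg_def)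
qed

lemma sg_max: "(\<And>w. w \<in> W \<Longrightarrow> w < v) \<Longrightarrow> sg v W = (-1) ^ card W"
  unfolding sg_def by (rule arg_cong[where f="\<lambda>A. (-1) ^ card A"]) auto

text \<open>Only the smaller of \<open>j\<close> and \<open>k\<close> is counted in the sign of the
  other one, so exactly one of the two signs flips. Both \<open>cob_cob\<close> and
  \<open>bd_bd\<close> rest on this.\<close>

lemma sg_swap:
  assumes "finite W" "j \<notin> W" "k \<notin> W" "j \<noteq> k"
  shows "sg j W * sg k (insert j W) = - (sg k W * sg j (insert k W))"
proof (cases "j < k")
  case True
  then show ?thesis using assms by (simp add: sg_insert_less sg_insert_ge)
next
  case False
  then have "k < j" using assms by auto
  then show ?thesis using assms by (simp add: sg_insert_less sg_insert_ge)
qed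

text \<open>The terms below the diagonal are matched with those above it. Showing merely that the
  sum equals its own negative would fail in characteristic 2.\<close>

lemma sum_antisym:
  fixes g :: "nat \<Rightarrow> nat \<Rightarrow> 'b::ab_group_add"
  assumes "finite A" "\<And>i k. i \<in> A \<Longrightarrow> k \<in> A \<Longrightarrow> i \<noteq> k \<Longrightarrow> g i k = - g k i"
  shows "(\<Sum>i\<in>A. \<Sum>k\<in>A - {i}. g i k) = 0"
proof -
  have split: "(\<Sum>k\<in>A - {i}. g i k) = (\<Sum>k\<in>{k\<in>A. k < i}. g i k) + (\<Sum>k\<in>{k\<in>A. i < k}. g i k)"
    for i
  proof -
    have "A - {i} = {k\<in>A. k < i} \<union> {k\<in>A. i < k}" by auto
    then have "(\<Sum>k\<in>A - {i}. g i k) = (\<Sum>k\<in>{k\<in>A. k < i} \<union> {k\<in>A. i < k}. g i k)"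
      by (rule arg_cong)
    also have "\<dots> = (\<Sum>k\<in>{k\<in>A. k < i}. g i k) + (\<Sum>k\<in>{k\<in>A. i < k}. g i k)"
      using assms(1) by (intro sum.union_disjoint) auto
    finally show ?thesis .
  qed
  have "(\<Sum>i\<in>A. \<Sum>k\<in>{k\<in>A. i < k}. g i k) = (\<Sum>k\<in>A. \<Sum>i\<in>{i\<in>A. i < k}. g i k)"
    using assms(1) by (rule sum.swap_restrict) (use assms(1) in auto)
  also have "\<dots> = (\<Sum>k\<in>A. \<Sum>i\<in>{i\<in>A. i < k}. - g k i)"
    by (intro sum.cong refl assms(2)) auto
  finally show ?thesis by (simp add: split sum.distrib sum_negf)
qed

lemma cob_cob:
  fixes a :: "nat set \<Rightarrow> 'k::comm_ring_1"
  assumes "finite U" shows "cob (cob a) U = 0"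
proof -
  have "cob (cob a) U = (\<Sum>i\<in>U. \<Sum>k\<in>U-{i}. sg i U * sg k (U-{i}) * a (U-{i}-{k}))"
    by (simp add: cob_def sum_distrib_left mult.assoc)
  also have "\<dots> = 0"
  proof (rule sum_antisym[OF assms])
    fix i k assume ik: "i \<in> U" "k \<in> U" "i \<noteq> k"
    define W where "W = U - {i,k}"
    have U: "U - {i} = insert k W" "U - {k} = insert i W" "U = insert i (insert k W)"
      "U - {i} - {k} = W" "U - {k} - {i} = W"
      using ik by (auto simp: W_def)
    have f: "finite W" "i \<notin> W" "k \<notin> W" using assms by (auto simp: W_def)
    have s: "sg i U = sg i (insert k W)" "sg k U = sg k (insert i W)"
      using sg_remove_self[of i U] sg_remove_self[of k U] unfolding U(1,2) by metis+
    have t: "sg k (U-{i}) = sg k W" "sg i (U-{k}) = sg i W"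
      by (simp_all add: U(1,2) sg_insert_self)
    show "sg i U * sg k (U-{i}) * a (U-{i}-{k}) = - (sg k U * sg i (U-{k}) * a (U-{k}-{i}))"
      unfolding s t U(4,5)
      using arg_cong[OF sg_swap[OF f(1,2,3) ik(3), where 'a='k], of "\<lambda>x. x * a W"]
      by (simp add: algebra_simps minus_equation_iff eq_neg_iff_add_eq_0)
  qed
  finally show ?thesis .
qed

text \<open>The differential of the strand with support \<open>A\<close>: a signed sum of
  restrictions to \<open>W\<close> of the cochains on the sets \<open>insert j W\<close>. The
  restriction itself is left out, so it is the values at \<open>J \<subseteq> W\<close> that have
  this meaning.\<close>

definition bd :: "nat set \<Rightarrow> (nat set \<Rightarrow> nat set \<Rightarrow> 'k::comm_ring_1) \<Rightarrow> nat set \<Rightarrow> nat set \<Rightarrow> 'k" where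
  "bd A \<Phi> W J = (\<Sum>j\<in>A - W. sg j W * \<Phi> (insert j W) J)"

lemma bd_bd:
  fixes \<Psi> :: "nat set \<Rightarrow> nat set \<Rightarrow> 'k::comm_ring_1"
  assumes "finite A" "finite W" shows "bd A (bd A \<Psi>) W J = 0"
proof -
  have "bd A (bd A \<Psi>) W J =
     (\<Sum>j\<in>A - W. \<Sum>k\<in>A - W - {j}. sg j W * sg k (insert j W) * \<Psi> (insert k (insert j W)) J)"
    by (simp add: bd_def sum_distrib_left mult.assoc) (intro sum.cong refl, auto)
  also have "\<dots> = 0"
  proof (rule sum_antisym)
    fix i k assume ik: "i \<in> A - W" "k \<in> A - W" "i \<noteq> k"
    show "sg i W * sg k (insert i W) * \<Psi> (insert k (insert i W)) J =
      - (sg k W * sg i (insert k W) * \<Psi> (insert i (insert k W)) J)"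
      using sg_swap[of W i k, where 'a='k] ik assms by (simp add: insert_commute)
  qed (use assms in auto)
  finally show ?thesis .
qed

text \<open>Two members through \<open>v\<close> lose it from their intersection as well, so both
  sides of the inequality drop by one.\<close>

lemma far_link: 
  assumes "far (Suc d) \<I>" shows "far d (link v \<I>)"
proof -
  have 1: "card ((I - {v}) \<inter> (J - {v})) + 2 \<le> d"
    if "I \<in> \<I>" "J \<in> \<I>" "v \<in> I" "v \<in> J" "I - {v} \<noteq> J - {v}" for I J
  proof -
    have "(I - {v}) \<inter> (J - {v}) = I \<inter> J - {v}" by auto
    moreover have "finite (I \<inter> J)" using assms that by (auto simp: far_def)
    moreover have "card (I \<inter> J) + 2 \<le> Suc d" using assms that by (auto simp: far_def)
    moreover have "card (I \<inter> J) > 0"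
      using that \<open>finite (I \<inter> J)\<close> by (auto simp: card_gt_0_iff)
    ultimately show ?thesis using that by simp
  qed
  show ?thesis unfolding far_def
  proof (rule conjI; intro ballI impI)
    fix I assume "I \<in> link v \<I>"
    then obtain I' where "I' \<in> \<I>" "v \<in> I'" "I = I' - {v}" by (auto simp: link_def)
    then show "finite I \<and> card I = d" using assms by (auto simp: far_def)
  next
    fix I J assume "I \<in> link v \<I>" "J \<in> link v \<I>" "I \<noteq> J"
    then show "card (I \<inter> J) + 2 \<le> d" unfolding link_def using 1 by blast
  qed
qed

lemma in_link: "v \<notin> S \<Longrightarrow> S \<in> link v \<I> \<longleftrightarrow> insert v S \<in> \<I>"
  unfolding link_def
  by (auto simp: image_iff insert_absorb intro!: bexI[of _ "insert v S"])

text \<open>A largest vertex \<open>v\<close> does not affect the signs of the vertices in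
  \<open>U\<close>, and its own sign depends only on \<open>card U\<close>. This is why every
  induction adds the largest vertex.\<close>

lemma cob_insert_max:
  assumes "finite U" "\<And>u. u \<in> U \<Longrightarrow> u < v"
  shows "cob c (insert v U) = (-1) ^ card U * c U + cob (\<lambda>S. c (insert v S)) U"
proof -
  have v: "v \<notin> U" using assms by auto
  have "(\<Sum>i\<in>U. sg i (insert v U) * c (insert v U - {i})) = (\<Sum>i\<in>U. sg i U * c (insert v (U - {i})))"
    using assms v by (intro sum.cong refl) (auto simp: sg_insert_ge insert_Diff_if less_imp_le)
  then show ?thesis using assms v by (simp add: cob_def sg_insert_self sg_max)
qed

section \<open>Spaces of cocycles: restriction, links and extension by a vertex\<close>

lemma cocycD:
  assumes "c \<in> cocyc d \<I> W"
  shows "c J \<noteq> 0 \<Longrightarrow> J \<subseteq> W" "c J \<noteq> 0 \<Longrightarrow> card J = d" "J \<in> \<I> \<Longrightarrow> c J = 0"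
    "U \<subseteq> W \<Longrightarrow> card U = Suc d \<Longrightarrow> cob c U = 0"
  using assms by (auto simp: cocyc_def)

lemma cob_cong: "(\<And>i. i \<in> U \<Longrightarrow> b (U - {i}) = b' (U - {i})) \<Longrightarrow> cob b U = cob b' U"
  by (simp add: cob_def)

lemma cob_add: "cob (\<lambda>J. a J + b J) U = cob a U + cob b U"
  by (simp add: cob_def algebra_simps sum.distrib)

lemma cob_diff: "cob (\<lambda>J. a J - b J) U = cob a U - cob b U"
  by (simp add: cob_def algebra_simps sum_subtractf)

lemma cob_scale: "cob (\<lambda>J. x * b J) U = x * cob b U"
  by (simp add: cob_def algebra_simps sum_distrib_left)

lemma cocyc_zero: "(\<lambda>_. 0) \<in> cocyc d \<I> W"
  by (simp add: cocyc_def cob_def)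

lemma cocyc_scale: "c \<in> cocyc d \<I> W \<Longrightarrow> (\<lambda>J. x * c J) \<in> cocyc d \<I> W"
  unfolding cocyc_def by (simp add: cob_scale) (metis mult_zero_right)

lemma cocyc_add: "a \<in> cocyc d \<I> W \<Longrightarrow> b \<in> cocyc d \<I> W \<Longrightarrow> (\<lambda>J. a J + b J) \<in> cocyc d \<I> W"
  unfolding cocyc_def by (simp add: cob_add) (metis add_0_right)

lemma cocyc_diff: "a \<in> cocyc d \<I> W \<Longrightarrow> b \<in> cocyc d \<I> W \<Longrightarrow> (\<lambda>J. a J - b J) \<in> cocyc d \<I> W"
  unfolding cocyc_def by (simp add: cob_diff) (metis diff_self)

lemma cocyc_sum:
  "(\<And>q. q \<in> Q \<Longrightarrow> c q \<in> cocyc d \<I> W) \<Longrightarrow> (\<lambda>J. \<Sum>q\<in>Q. x q * c q J) \<in> cocyc d \<I> W"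
  by (induction Q rule: infinite_finite_induct)
     (auto intro!: cocyc_zero cocyc_add cocyc_scale)

lemma cocyc_restrict:
  assumes "c \<in> cocyc d \<I> W'" "W \<subseteq> W'"
  shows "(\<lambda>J. if J \<subseteq> W then c J else 0) \<in> cocyc d \<I> W"
proof -
  have "cob (\<lambda>J. if J \<subseteq> W then c J else 0) U = cob c U" if "U \<subseteq> W" for U
    using that by (intro cob_cong) auto
  then show ?thesis using assms by (auto simp: cocyc_def)
qed

text \<open>If \<open>c\<close> vanishes on \<open>W\<close>, the coboundary formula at
  \<open>insert v U\<close> keeps only its link term. Together with \<open>cocyc_from_link\<close>
  this identifies the kernel of the restriction from \<open>insert v W\<close> to \<open>W\<close>
  with the cocycles of the link, for \<open>d\<close> lowered by one.\<close>

lemma cocyc_to_link: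
  assumes c: "c \<in> cocyc (Suc d) \<I> (insert v W)" and W: "finite W" "\<And>w. w \<in> W \<Longrightarrow> w < v"
    and 0: "\<And>J. J \<subseteq> W \<Longrightarrow> c J = 0"
  shows "(\<lambda>S. if S \<subseteq> W then c (insert v S) else 0) \<in> cocyc d (link v \<I>) W"
  unfolding cocyc_def
proof (intro CollectI conjI allI impI)
  fix S assume nz: "(if S \<subseteq> W then c (insert v S) else 0) \<noteq> 0"
  then have S: "S \<subseteq> W" "c (insert v S) \<noteq> 0" by (auto split: if_splits)
  have v: "v \<notin> S" "finite S" using S W finite_subset by auto
  show "S \<subseteq> W" "card S = d" "S \<notin> link v \<I>"
    using S(1) v cocycD(2,3)[OF c, of "insert v S"] S(2) by (auto simp: in_link)
next
  fix U assume U: "U \<subseteq> W" "card U = Suc d"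
  have "finite U" using U W finite_subset by auto
  have "cob c (insert v U) = 0"
    using U W \<open>finite U\<close> by (intro cocycD(4)[OF c]) (auto, subst card_insert_disjoint, auto)
  then have "cob (\<lambda>S. c (insert v S)) U = 0"
    using U W \<open>finite U\<close> 0[of U] by (subst (asm) cob_insert_max) auto
  moreover have "cob (\<lambda>S. if S \<subseteq> W then c (insert v S) else 0) U = cob (\<lambda>S. c (insert v S)) U"
    using U by (intro cob_cong) auto
  ultimately show "cob (\<lambda>S. if S \<subseteq> W then c (insert v S) else 0) U = 0" by simp
qed

lemma cocyc_from_link:
  assumes l: "l \<in> cocyc d (link v \<I>) W" and W: "finite W" "\<And>w. w \<in> W \<Longrightarrow> w < v"
  shows "(\<lambda>J. if v \<in> J then l (J - {v}) else 0) \<in> cocyc (Suc d) \<I> (insert v W)"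
    (is "?c \<in> _")
  unfolding cocyc_def
proof (intro CollectI conjI allI impI)
  fix J assume "?c J \<noteq> 0"
  then have J: "v \<in> J" "l (J - {v}) \<noteq> 0" by (auto split: if_splits)
  have fin: "finite J" using cocycD(1)[OF l J(2)] W(1) by (metis finite_Diff2 finite.emptyI finite_insert finite_subset)
  show "J \<subseteq> insert v W" using cocycD(1)[OF l J(2)] by auto
  show "card J = Suc d" using cocycD(2)[OF l J(2)] J fin by (metis card_Suc_Diff1)
  show "J \<notin> \<I>" using cocycD(3)[OF l, of "J - {v}"] J in_link[of v "J - {v}" \<I>]
    by (auto simp: insert_absorb)
next
  fix U assume U: "U \<subseteq> insert v W" "card U = Suc (Suc d)"
  have finU: "finite U" using U W finite_subset by auto
  show "cob ?c U = 0"
  proof (cases "v \<in> U")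
    case False
    then show ?thesis by (auto simp: cob_def)
  next
    case True
    then obtain U' where U': "U = insert v U'" "v \<notin> U'" by (meson mk_disjoint_insert)
    have "cob ?c U = cob (\<lambda>S. ?c (insert v S)) U'"
      using U' U finU W unfolding U'(1) by (subst cob_insert_max) auto
    also have "\<dots> = cob l U'" using U' by (intro cob_cong) auto
    also have "\<dots> = 0" using U U' finU by (intro cocycD(4)[OF l]) auto
    finally show ?thesis .
  qed
qed

text \<open>The simplex on \<open>W\<close> is a cone over its largest vertex, and contracting a
  cocycle with the apex gives a primitive.\<close>

lemma cone_primitive:
  fixes c :: "nat set \<Rightarrow> 'k::comm_ring_1"
  assumes W: "finite W" and c: "\<And>U. U \<subseteq> W \<Longrightarrow> card U = Suc (Suc e) \<Longrightarrow> cob c U = 0"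
  shows "\<exists>b. \<forall>J\<subseteq>W. card J = Suc e \<longrightarrow> cob b J = c J"
proof (cases "W = {}")
  case True
  then show ?thesis by auto
next
  case False
  define w where "w = Max W"
  have w: "w \<in> W" "\<And>x. x \<in> W \<Longrightarrow> x \<noteq> w \<Longrightarrow> x < w"
    using False W by (auto simp: w_def less_le)
  \<comment> \<open>The apex has sign \<open>(-1) ^ e\<close> next to \<open>e\<close> smaller
    vertices, and the factor cancels it. Zero on sets through the apex leaves a single term in the
    coboundary of such sets.\<close>
  define b where "b S = (if w \<in> S then 0 else (-1) ^ e * c (insert w S))" for S
  have "cob b J = c J" if J: "J \<subseteq> W" "card J = Suc e" for J
  proof (cases "w \<in> J")
    case True
    then obtain J' where J': "J = insert w J'" "w \<notin> J'" by (meson mk_disjoint_insert)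
    have fin: "finite J'" "card J' = e" and lt: "\<And>x. x \<in> J' \<Longrightarrow> x < w"
      using J J' W w finite_subset[of J W] by auto
    have "cob (\<lambda>S. b (insert w S)) J' = 0" by (simp add: cob_def b_def)
    then show ?thesis unfolding J'(1) using fin J' lt
      by (subst cob_insert_max) (auto simp: b_def simp flip: mult.assoc power_add mult_2)
  next
    case False
    have fin: "finite J" using J W finite_subset by auto
    have lt: "\<And>x. x \<in> J \<Longrightarrow> x < w" using J w False by blast
    have "cob b J = cob (\<lambda>S. (-1) ^ e * c (insert w S)) J"
      using False by (intro cob_cong) (auto simp: b_def)
    also have "\<dots> = (-1) ^ e * cob (\<lambda>S. c (insert w S)) J" by (rule cob_scale)
    also have "\<dots> = c J"
    proof -
      have "cob c (insert w J) = 0" using J w False fin by (intro c) auto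
      then have "cob (\<lambda>S. c (insert w S)) J = (-1) ^ e * c J"
        using fin lt J by (subst (asm) cob_insert_max) (auto simp: add_eq_0_iff)
      then show ?thesis by (simp flip: mult.assoc power_add mult_2)
    qed
    finally show ?thesis .
  qed
  then show ?thesis by blast
qed

text \<open>Members with at most \<open>e - 2\<close> common elements share no subset with
  \<open>e - 1\<close> elements. Each member \<open>L\<close> therefore owns the facet
  \<open>T L\<close>, on which \<open>a\<close> can be chosen to give the wanted coboundary, while
  \<open>a\<close> is zero on all its other facets. The empty set has no facet, hence the condition
  on \<open>e\<close>.\<close>

lemma far_interpolate:
  fixes b :: "nat set \<Rightarrow> 'k::comm_ring_1"
  assumes far: "far e \<L>" and e: "e \<ge> 1 \<or> \<L> = {}"
  shows "\<exists>a. \<forall>L\<in>\<L>. cob a L = b L"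
proof -
  define T where "T L = L - {Max L}" for L :: "nat set"
  define a where "a S = (if \<exists>L\<in>\<L>. S = T L then (let L = (THE L. L \<in> \<L> \<and> S = T L) in sg (Max L) L * b L) else 0)" for S
  have L: "finite L" "card L = e" "L \<noteq> {}" "Max L \<in> L" if "L \<in> \<L>" for L
  proof -
    show 1: "finite L" "card L = e" "L \<noteq> {}" using that far e by (auto simp: far_def)
    show "Max L \<in> L" using 1 by simp
  qed
  have uni: "L = L' \<and> i = Max L" if "L \<in> \<L>" "L' \<in> \<L>" "i \<in> L" "L - {i} = T L'" for L L' i
  proof -
    have "L = L'"
    proof (rule ccontr)
      assume "L \<noteq> L'"
      then have "card (L \<inter> L') + 2 \<le> e" using far that by (auto simp: far_def)
      moreover have "L - {i} \<subseteq> L \<inter> L'" using that by (auto simp: T_def)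
      then have "card (L - {i}) \<le> card (L \<inter> L')" using L that by (intro card_mono) auto
      moreover have "card (L - {i}) = e - 1" using L[OF that(1)] that(3) by simp
      ultimately show False by simp
    qed
    then show ?thesis using that L[of L] unfolding T_def by blast
  qed
  have aT: "a (T L) = sg (Max L) L * b L" if "L \<in> \<L>" for L
  proof -
    have "(THE L'. L' \<in> \<L> \<and> T L = T L') = L"
    proof (rule the_equality)
      fix L' assume "L' \<in> \<L> \<and> T L = T L'"
      then show "L' = L" using uni[OF that, of L' "Max L"] L(4)[OF that] by (simp add: T_def)
    qed (use that in simp)
    moreover have "\<exists>L'\<in>\<L>. T L = T L'" using that by blast
    ultimately show ?thesis by (simp add: a_def)
  qed
  have "cob a L = b L" if "L \<in> \<L>" for L
  proof -
    have "a (L - {i}) = 0" if i: "i \<in> L" "i \<noteq> Max L" for i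
    proof -
      have "\<not> (\<exists>L'\<in>\<L>. L - {i} = T L')" using uni[OF \<open>L \<in> \<L>\<close> _ i(1)] i(2) by blast
      then show ?thesis unfolding a_def by (rule if_not_P)
    qed
    then have "cob a L = (\<Sum>i\<in>{Max L}. sg i L * a (L - {i}))"
      unfolding cob_def using L[OF that] by (intro sum.mono_neutral_right) auto
    then show ?thesis using aT[OF that] by (simp add: T_def)
  qed
  then show ?thesis by blast
qed

text \<open>Putting a primitive \<open>b\<close> of \<open>(-1) ^ e * c\<close> on the sets
  \<open>insert v S\<close> makes all coboundaries vanish. The values on family members through
  \<open>v\<close> must be zero too, that is, \<open>b\<close> must vanish on the link; subtracting
  a coboundary \<open>cob a\<close> that agrees with \<open>b\<close> there achieves this and, by
  \<open>cob_cob\<close>, changes nothing else. The excluded case is the one in which the link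
  contains the empty set.\<close>

lemma cocyc_extend:
  fixes c :: "nat set \<Rightarrow> 'k::comm_ring_1"
  assumes c: "c \<in> cocyc d \<I> W" and far: "far d \<I>" and d: "d \<ge> 1" "\<not> (d = 1 \<and> {v} \<in> \<I>)"
    and W: "finite W" "\<And>w. w \<in> W \<Longrightarrow> w < v"
  shows "\<exists>c'\<in>cocyc d \<I> (insert v W). \<forall>J\<subseteq>W. c' J = c J"
proof -
  obtain e where e: "d = Suc e" using d by (cases d) auto
  obtain b where b: "\<And>J. J \<subseteq> W \<Longrightarrow> card J = Suc e \<Longrightarrow> cob b J = (-1) ^ e * c J"
  proof -
    have "\<exists>b. \<forall>J\<subseteq>W. card J = Suc e \<longrightarrow> cob b J = (-1) ^ e * c J"
      using cocycD(4)[OF c] e by (intro cone_primitive W) (simp add: cob_scale)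
    then show ?thesis using that by blast
  qed
  have "e \<ge> 1 \<or> link v \<I> = {}"
  proof (cases e)
    case 0
    have "I = {v}" if "I \<in> \<I>" "v \<in> I" for I
    proof -
      have "card I = 1" using far that 0 e by (simp add: far_def)
      then show ?thesis using that by (auto simp: card_1_singleton_iff)
    qed
    then show ?thesis using d 0 e by (auto simp: link_def)
  qed simp
  then obtain a where a: "\<And>L. L \<in> link v \<I> \<Longrightarrow> cob a L = b L"
    using far_interpolate[OF far_link[OF far[unfolded e]], of v b] by blast
  \<comment> \<open>The zero is forced by definition where \<open>insert v S\<close> lies in the
    family; by the choice of \<open>a\<close> it agrees with \<open>b S - cob a S\<close>, so the
    formula holds on all \<open>e\<close>-subsets of \<open>W\<close>.\<close>
  define b' where "b' S = (if S \<subseteq> W \<and> card S = e \<and> insert v S \<notin> \<I> then b S - cob a S else 0)" for S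
  have b': "b' S = b S - cob a S" if "S \<subseteq> W" "card S = e" for S
  proof -
    have "v \<notin> S" using that W(2) by auto
    then show ?thesis using that a[of S] by (simp add: b'_def in_link)
  qed
  define c' where "c' J = (if v \<in> J then b' (J - {v}) else c J)" for J
  have eq: "c' J = c J" if "J \<subseteq> W" for J using that W by (auto simp: c'_def)
  have "c' \<in> cocyc d \<I> (insert v W)"
    unfolding cocyc_def
  proof (intro CollectI conjI allI impI)
    fix J assume nz: "c' J \<noteq> 0"
    show "J \<subseteq> insert v W" using nz cocycD(1)[OF c, of J]
      by (auto simp: c'_def b'_def split: if_splits)
    then have fin: "finite J" using W finite_subset by auto
    show "card J = d" using nz cocycD(2)[OF c, of J] e fin card_Suc_Diff1[OF fin, of v]
      by (auto simp: c'_def b'_def split: if_splits)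
    show "J \<notin> \<I>" using nz cocycD(3)[OF c, of J]
      by (auto simp: c'_def b'_def insert_absorb split: if_splits)
  next
    fix U assume U: "U \<subseteq> insert v W" "card U = Suc d"
    have finU: "finite U" using U W finite_subset by auto
    show "cob c' U = 0"
    proof (cases "v \<in> U")
      case False
      then have "cob c' U = cob c U" using U by (intro cob_cong) (auto simp: c'_def)
      also have "\<dots> = 0" using U False by (intro cocycD(4)[OF c]) auto
      finally show ?thesis .
    next
      case True
      then obtain J where J: "U = insert v J" "v \<notin> J" by (meson mk_disjoint_insert)
      have J': "J \<subseteq> W" "finite J" "card J = Suc e" using J U finU e by auto
      have "cob c' U = (-1) ^ Suc e * c' J + cob (\<lambda>S. c' (insert v S)) J"
        using J J' W unfolding J(1) by (subst cob_insert_max) auto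
      also have "cob (\<lambda>S. c' (insert v S)) J = cob (\<lambda>S. b S - cob a S) J"
      proof (rule cob_cong)
        fix i assume "i \<in> J"
        then have "J - {i} \<subseteq> W" "card (J - {i}) = e" using J' by auto
        then show "c' (insert v (J - {i})) = b (J - {i}) - cob a (J - {i})"
          using J by (simp add: c'_def b')
      qed
      also have "\<dots> = (-1) ^ e * c J"
        using J' by (simp add: cob_diff cob_cob b)
      finally show ?thesis using J J' eq by simp
    qed
  qed
  then show ?thesis using eq by blast
qed

section \<open>Exactness of the strands\<close>

lemma sg_mult_eq_0_iff [simp]: "sg j W * x = 0 \<longleftrightarrow> x = 0"
  by (metis mult_zero_right sg_sg_mult)


text \<open>For \<open>d = 1\<close> the cocycle condition on pairs makes \<open>c\<close> constant
  on the vertices of \<open>W\<close>, and the constant is zero as soon as one vertex belongs to the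
  family.\<close>

lemma cocyc_top_vertex:
  fixes c :: "nat set \<Rightarrow> 'k::comm_ring_1"
  assumes v: "{v} \<in> \<I>" "v \<in> W" and c: "c \<in> cocyc (Suc 0) \<I> W"
  shows "c J = 0"
proof (rule ccontr)
  assume nz: "c J \<noteq> 0"
  obtain w where w: "J = {w}" "w \<in> W"
    using cocycD(1,2)[OF c nz] by (auto simp: card_1_singleton_iff)
  have "w \<noteq> v" using v cocycD(3)[OF c, of "{v}"] nz w by auto
  then have 2: "card {w,v} = Suc (Suc 0)" and "{w,v} - {w} = {v}" "{w,v} - {v} = {w}" by auto
  then have "sg w {w,v} * c {v} + sg v {w,v} * c {w} = 0"
    using cocycD(4)[OF c _ 2] w v \<open>w \<noteq> v\<close> by (simp add: cob_def)
  moreover have "c {v} = 0" using cocycD(3)[OF c v(1)] .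
  ultimately have "sg v {w,v} * (sg v {w,v} * c {w}) = 0" by simp
  then show False using nz w by simp
qed

text \<open>The coboundary of a singleton is the value at the empty set up to sign. This is the
  bottom of the recursion through links; on \<open>W = {}\<close> the conclusion may fail.\<close>

lemma cocyc_zero_dim:
  fixes c :: "nat set \<Rightarrow> 'k::comm_ring_1"
  assumes c: "c \<in> cocyc 0 \<I> W" and W: "W \<noteq> {}" "finite W"
  shows "c J = 0"
proof (rule ccontr)
  assume nz: "c J \<noteq> 0"
  obtain w where w: "w \<in> W" using W by auto
  then have "sg w {w} * c {} = 0" using cocycD(4)[OF c, of "{w}"] by (simp add: cob_def)
  then have "c {} = 0" by simp
  moreover have "finite J" using cocycD(1)[OF c nz] W finite_subset by auto
  then have "J = {}" using cocycD(2)[OF c nz] by simp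
  ultimately show False using nz by simp
qed

lemma sum_insert_vertex:
  assumes "finite A" "v \<notin> A"
  shows "(\<Sum>W | W \<subseteq> insert v A \<and> card W = Suc m. g W) =
    (\<Sum>W | W \<subseteq> A \<and> card W = Suc m. g W) + (\<Sum>W | W \<subseteq> A \<and> card W = m. g (insert v W))"
proof -
  have fin: "W \<subseteq> A \<Longrightarrow> finite W" for W using assms finite_subset by auto
  have "{W. W \<subseteq> insert v A \<and> card W = Suc m} =
      {W. W \<subseteq> A \<and> card W = Suc m} \<union> insert v ` {W. W \<subseteq> A \<and> card W = m}" (is "?L = ?R1 \<union> ?R2")
  proof (intro equalityI subsetI)
    fix W assume W: "W \<in> ?L"
    show "W \<in> ?R1 \<union> ?R2"
    proof (cases "v \<in> W")
      case True
      then have "W = insert v (W - {v})" "W - {v} \<subseteq> A" "card (W - {v}) = m" using W by auto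
      then show ?thesis by blast
    qed (use W in auto)
  next
    fix W assume "W \<in> ?R1 \<union> ?R2"
    then show "W \<in> ?L"
    proof
      assume "W \<in> ?R2"
      then obtain W' where W': "W' \<subseteq> A" "card W' = m" "W = insert v W'" by auto
      then have "v \<notin> W'" using assms by auto
      then show ?thesis using W' fin by auto
    qed auto
  qed
  moreover have "inj_on (insert v) {W. W \<subseteq> A \<and> card W = m}"
    using assms(2) by (intro inj_onI) (metis (mono_tags, lifting) insert_ident mem_Collect_eq subsetD)
  moreover have "finite {W. W \<subseteq> A \<and> P W}" for P using assms(1) by simp
  ultimately show ?thesis using assms
    by (simp add: sum.reindex, subst sum.union_disjoint) (auto simp: sum.reindex)
qed

text \<open>Both sides sum over a set \<open>U\<close> and a vertex \<open>j\<close> to be removed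
  from it. For \<open>m = d\<close> the left side is the augmentation of a boundary, so the cocycle
  condition is precisely what makes it vanish.\<close>

lemma sum_bd_diagonal:
  fixes \<Psi> :: "nat set \<Rightarrow> nat set \<Rightarrow> 'k::comm_ring_1"
  assumes A: "finite A"
  shows "(\<Sum>W | W \<subseteq> A \<and> card W = m. bd A \<Psi> W W) = (\<Sum>U | U \<subseteq> A \<and> card U = Suc m. cob (\<Psi> U) U)"
proof -
  have fin: "W \<subseteq> A \<Longrightarrow> finite W" for W using A finite_subset by auto
  have fins: "finite {W. W \<subseteq> A \<and> P W}" for P using A by simp
  have "(\<Sum>W | W \<subseteq> A \<and> card W = m. bd A \<Psi> W W) =
     (\<Sum>(W,j)\<in>(SIGMA W:{W. W \<subseteq> A \<and> card W = m}. A - W). sg j W * \<Psi> (insert j W) W)"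
    unfolding bd_def using A by (subst sum.Sigma) (auto simp: fins)
  also have "\<dots> = (\<Sum>(U,j)\<in>(SIGMA U:{U. U \<subseteq> A \<and> card U = Suc m}. U). sg j U * \<Psi> U (U - {j}))"
  proof (rule sum.reindex_bij_witness[where i="\<lambda>(U,j). (U - {j}, j)" and j="\<lambda>(W,j). (insert j W, j)"])
    fix a assume "a \<in> (SIGMA W:{W. W \<subseteq> A \<and> card W = m}. A - W)"
    then show "(case case a of (W,j) \<Rightarrow> (insert j W, j) of (U,j) \<Rightarrow> (U - {j}, j)) = a"
      "(case a of (W,j) \<Rightarrow> (insert j W, j)) \<in> (SIGMA U:{U. U \<subseteq> A \<and> card U = Suc m}. U)"
      "(case (case a of (W,j) \<Rightarrow> (insert j W, j)) of (U,j) \<Rightarrow> sg j U * \<Psi> U (U - {j})) =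
        (case a of (W,j) \<Rightarrow> sg j W * \<Psi> (insert j W) W)"
      using fin by (auto simp: sg_insert_self)
  next
    fix a assume "a \<in> (SIGMA U:{U. U \<subseteq> A \<and> card U = Suc m}. U)"
    then show "(case case a of (U,j) \<Rightarrow> (U - {j}, j) of (W,j) \<Rightarrow> (insert j W, j)) = a"
       "(case a of (U,j) \<Rightarrow> (U - {j}, j)) \<in> (SIGMA W:{W. W \<subseteq> A \<and> card W = m}. A - W)"
      using fin by auto
  qed
  also have "\<dots> = (\<Sum>U | U \<subseteq> A \<and> card U = Suc m. cob (\<Psi> U) U)"
    unfolding cob_def using fin by (subst sum.Sigma) (auto simp: fins)
  finally show ?thesis .
qed

text \<open>At \<open>m = d\<close> the next map is the one into \<open>R\<close>, where the summand
  of a \<open>d\<close>-set \<open>W\<close> is given by the value at \<open>W\<close> and goes to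
  the monomial of \<open>W\<close>; within a strand all these targets coincide, so the values are
  added.\<close>

definition strand_cycle :: "nat \<Rightarrow> nat \<Rightarrow> nat set \<Rightarrow> (nat set \<Rightarrow> nat set \<Rightarrow> 'k::comm_ring_1) \<Rightarrow> bool" where
  "strand_cycle d m A \<Phi> \<longleftrightarrow>
     (if m = d then (\<Sum>W | W \<subseteq> A \<and> card W = d. \<Phi> W W) = 0
      else \<forall>W\<subseteq>A. Suc (card W) = m \<longrightarrow> (\<forall>J\<subseteq>W. bd A \<Phi> W J = 0))"

lemma cocyc_bd:
  assumes "\<And>j. j \<in> A - W \<Longrightarrow> \<Psi> (insert j W) \<in> cocyc d \<I> (insert j W)"
  shows "(\<lambda>J. if J \<subseteq> W then bd A \<Psi> W J else 0) \<in> cocyc d \<I> W"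
proof -
  have "(\<lambda>J. if J \<subseteq> W then \<Psi> (insert j W) J else 0) \<in> cocyc d \<I> W" if "j \<in> A - W" for j
    by (rule cocyc_restrict[OF assms[OF that]]) auto
  then have "(\<lambda>J. \<Sum>j\<in>A - W. sg j W * (if J \<subseteq> W then \<Psi> (insert j W) J else 0)) \<in> cocyc d \<I> W"
    by (intro cocyc_sum) auto
  moreover have "(\<lambda>J. \<Sum>j\<in>A - W. sg j W * (if J \<subseteq> W then \<Psi> (insert j W) J else 0)) =
     (\<lambda>J. if J \<subseteq> W then bd A \<Psi> W J else 0)"
    by (auto simp: bd_def)
  ultimately show ?thesis by simp
qed

text \<open>The parameters \<open>d\<close>, \<open>m\<close> and the family vary in the induction,
  since the step passes to the link with \<open>d - 1\<close> and \<open>m - 1\<close>. There a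
  cycle is removed in two stages: \<open>\<Psi>1\<close> clears the sets without \<open>v\<close>,
  and \<open>\<Psi>2\<close> treats the remainder, which is a cycle for the link.\<close>

lemma strand_exact:
  fixes \<Phi> :: "nat set \<Rightarrow> nat set \<Rightarrow> 'k::comm_ring_1"
  assumes "finite A" "far d \<I>" "d \<le> m"
    and "\<And>W. W \<subseteq> A \<Longrightarrow> card W = m \<Longrightarrow> \<Phi> W \<in> cocyc d \<I> W"
    and "strand_cycle d m A \<Phi>"
  shows "\<exists>\<Psi>. (\<forall>U\<subseteq>A. card U = Suc m \<longrightarrow> \<Psi> U \<in> cocyc d \<I> U) \<and>
             (\<forall>W\<subseteq>A. card W = m \<longrightarrow> (\<forall>J\<subseteq>W. bd A \<Psi> W J = \<Phi> W J))"
  using assms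
proof (induction A arbitrary: d m \<I> \<Phi> rule: finite_linorder_max_induct)
  case empty
  show ?case
  \<comment> \<open>Only the empty set is available; if \<open>m = 0\<close>, then
    \<open>d = 0\<close> and the cycle condition reads \<open>\<Phi> {} {} = 0\<close>.\<close>
  proof (cases "m = 0")
    case True
    then have "\<Phi> {} {} = 0" using empty by (auto simp: strand_cycle_def if_distrib cong: conj_cong)
    then show ?thesis using True by (intro exI[of _ "\<lambda>_ _. 0"]) (auto simp: bd_def)
  qed auto
next
  case (insert v A)
  have fin: "finite W" if "W \<subseteq> insert v A" for W using that insert.hyps(1) finite_subset by auto
  have vA: "v \<notin> A" using insert.hyps(2) by auto
  note co = insert.prems(3) and far = insert.prems(1)
  consider (zero) "d = 0" | (top) "d = 1" "{v} \<in> \<I>" | (step) "d \<ge> 1" "\<not> (d = 1 \<and> {v} \<in> \<I>)"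
    by linarith
  then show ?case
  proof cases
    case zero
    \<comment> \<open>For \<open>m > 0\<close> every \<open>W\<close> is nonempty and carries no
      cocycles; for \<open>m = 0\<close> the cycle condition is the vanishing of the only
      value.\<close>
    have "\<Phi> W J = 0" if "W \<subseteq> insert v A" "card W = m" "J \<subseteq> W" for W J
    proof (cases "m = 0")
      case True
      then have "W = {}" "J = {}" using that fin[of W] by auto
      moreover have "{W. W \<subseteq> insert v A \<and> card W = 0} = {{}}" using fin by auto
      ultimately show ?thesis using insert.prems(4) True zero by (simp add: strand_cycle_def)
    next
      case False
      then have "W \<noteq> {}" using that by auto
      then show ?thesis using cocyc_zero_dim[of "\<Phi> W" \<I> W] co[of W] that zero fin by auto
    qed
    then show ?thesis by (intro exI[of _ "\<lambda>_ _. 0"]) (auto simp: bd_def cocyc_zero)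
  next
    case top
    \<comment> \<open>No nonzero cocycles live on sets through \<open>v\<close>, so the strand of
      \<open>insert v A\<close> is that of \<open>A\<close>, extended by zero.\<close>
    have z: "\<Phi> W J = 0" if "v \<in> W" "W \<subseteq> insert v A" "card W = m" for W J
      using cocyc_top_vertex[of v \<I> W "\<Phi> W" J] co[of W] that top by auto
    have bd_eq: "bd (insert v A) X W J = bd A X W J" if "W \<subseteq> A" "X (insert v W) J = 0" for X :: "nat set \<Rightarrow> nat set \<Rightarrow> 'k" and W J
    proof -
      have "insert v A - W = insert v (A - W)" using that vA by auto
      then show ?thesis using that vA insert.hyps(1) by (simp add: bd_def)
    qed
    have "strand_cycle d m A \<Phi>"
    proof (cases "m = d")
      case True
      have "(\<Sum>W | W \<subseteq> A \<and> card W = 0. \<Phi> (insert v W) (insert v W)) = 0"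
        using top True vA by (intro sum.neutral ballI z) (auto simp: fin subset_insertI2)
      then show ?thesis using insert.prems(4) True top insert.hyps(1) vA
        by (simp add: strand_cycle_def sum_insert_vertex)
    next
      case False
      have "bd A \<Phi> W J = 0" if W: "W \<subseteq> A" "Suc (card W) = m" "J \<subseteq> W" for W J
      proof -
        have "v \<notin> W" "finite W" using W vA fin[of W] by auto
        then have "\<Phi> (insert v W) J = 0" using W by (intro z) auto
        then show ?thesis
          using bd_eq[of W \<Phi> J] W insert.prems(4) False by (auto simp: strand_cycle_def subset_insertI2)
      qed
      then show ?thesis using False by (simp add: strand_cycle_def)
    qed
    then obtain \<Psi> where \<Psi>: "\<forall>U\<subseteq>A. card U = Suc m \<longrightarrow> \<Psi> U \<in> cocyc d \<I> U"
        "\<forall>W\<subseteq>A. card W = m \<longrightarrow> (\<forall>J\<subseteq>W. bd A \<Psi> W J = \<Phi> W J)"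
      using insert.IH[OF far insert.prems(2), of \<Phi>] co by (auto simp: subset_insertI2)
    define \<Psi>' where "\<Psi>' U J = (if v \<in> U then 0 else \<Psi> U J)" for U J
    show ?thesis
    proof (intro exI[of _ \<Psi>'] conjI allI impI)
      fix U assume U: "U \<subseteq> insert v A" "card U = Suc m"
      show "\<Psi>' U \<in> cocyc d \<I> U"
      proof (cases "v \<in> U")
        case True
        then have "\<Psi>' U = (\<lambda>_. 0)" by (auto simp: \<Psi>'_def)
        then show ?thesis by (simp add: cocyc_zero)
      next
        case False
        then have "\<Psi>' U = \<Psi> U" "U \<subseteq> A" using U by (auto simp: \<Psi>'_def)
        then show ?thesis using \<Psi>(1) U by simp
      qed
    next
      fix W J assume W: "W \<subseteq> insert v A" "card W = m" "J \<subseteq> W"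
      show "bd (insert v A) \<Psi>' W J = \<Phi> W J"
      proof (cases "v \<in> W")
        case True
        then show ?thesis using z W by (simp add: bd_def \<Psi>'_def)
      next
        case False
        then have WA: "W \<subseteq> A" using W by auto
        then have "bd (insert v A) \<Psi>' W J = bd A \<Psi>' W J" by (intro bd_eq) (auto simp: \<Psi>'_def)
        also have "\<dots> = bd A \<Psi> W J" unfolding bd_def using False vA
          by (intro sum.cong refl) (auto simp: \<Psi>'_def)
        finally show ?thesis using \<Psi>(2) WA W by simp
      qed
    qed
  next
    case step
    then obtain d' where d': "d = Suc d'" by (cases d) auto
    then obtain m' where m': "m = Suc m'" using insert.prems(2) by (cases m) auto
    have sgv: "sg v W = ((-1) ^ m :: 'k)" if "W \<subseteq> A" "card W = m" for W m
      using that insert.hyps(2) by (subst sg_max) auto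
    have "\<forall>W. \<exists>c'. W \<subseteq> A \<and> card W = m \<longrightarrow> c' \<in> cocyc d \<I> (insert v W) \<and> (\<forall>J\<subseteq>W. c' J = \<Phi> W J)"
    proof
      fix W
      show "\<exists>c'. W \<subseteq> A \<and> card W = m \<longrightarrow> c' \<in> cocyc d \<I> (insert v W) \<and> (\<forall>J\<subseteq>W. c' J = \<Phi> W J)"
      proof (cases "W \<subseteq> A \<and> card W = m")
        case True
        then have "\<exists>c'\<in>cocyc d \<I> (insert v W). \<forall>J\<subseteq>W. c' J = \<Phi> W J"
          using insert.hyps(2) fin[of W] by (intro cocyc_extend co far step) auto
        then show ?thesis by blast
      qed auto
    qed
    then obtain E where E: "\<And>W. W \<subseteq> A \<Longrightarrow> card W = m \<Longrightarrow> E W \<in> cocyc d \<I> (insert v W)"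
        "\<And>W J. W \<subseteq> A \<Longrightarrow> card W = m \<Longrightarrow> J \<subseteq> W \<Longrightarrow> E W J = \<Phi> W J"
      by (metis (no_types, lifting))
    \<comment> \<open>The factor equals the sign of \<open>v\<close> in \<open>bd\<close>, as
      \<open>v\<close> exceeds all elements of the \<open>m\<close>-set \<open>U - {v}\<close>. The
      two cancel, and \<open>bd\<close> of \<open>\<Psi>1\<close> agrees with \<open>\<Phi>\<close>
      on the sets without \<open>v\<close>.\<close>
    define \<Psi>1 where "\<Psi>1 U J = (if v \<in> U then (-1) ^ m * E (U - {v}) J else 0)" for U J
    have \<Psi>1: "\<Psi>1 U \<in> cocyc d \<I> U" if "U \<subseteq> insert v A" "card U = Suc m" for U
    proof (cases "v \<in> U")
      case True
      then have "U - {v} \<subseteq> A" "card (U - {v}) = m" "insert v (U - {v}) = U"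
        using that by auto
      then have "E (U - {v}) \<in> cocyc d \<I> U" using E(1)[of "U - {v}"] by simp
      then show ?thesis unfolding \<Psi>1_def using True by (simp add: cocyc_scale)
    next
      case False
      then have "\<Psi>1 U = (\<lambda>_. 0)" by (auto simp: \<Psi>1_def)
      then show ?thesis by (simp add: cocyc_zero)
    qed
    \<comment> \<open>This remainder vanishes on all \<open>W \<subseteq> A\<close>; its values on
      sets through \<open>v\<close> form a problem for the link.\<close>
    define \<Phi>' where "\<Phi>' W J = \<Phi> W J - (if J \<subseteq> W then bd (insert v A) \<Psi>1 W J else 0)" for W J
    have \<Phi>'co: "\<Phi>' W \<in> cocyc d \<I> W" if W: "W \<subseteq> insert v A" "card W = m" for W
    proof -
      have "(\<lambda>J. if J \<subseteq> W then bd (insert v A) \<Psi>1 W J else 0) \<in> cocyc d \<I> W"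
        using W fin[of W] by (intro cocyc_bd \<Psi>1) auto
      then show ?thesis using co[OF W] unfolding \<Phi>'_def by (intro cocyc_diff) simp_all
    qed
    have \<Phi>'0: "\<Phi>' W J = 0" if W: "W \<subseteq> A" "card W = m" "J \<subseteq> W" for W J
    proof -
      have "v \<notin> W" using W vA by auto
      have "bd (insert v A) \<Psi>1 W J = (\<Sum>j\<in>{v}. sg j W * \<Psi>1 (insert j W) J)"
        unfolding bd_def using \<open>v \<notin> W\<close> insert.hyps(1) by (intro sum.mono_neutral_right) (auto simp: \<Psi>1_def)
      also have "\<dots> = \<Phi> W J"
        using \<open>v \<notin> W\<close> W E(2) by (simp add: \<Psi>1_def sgv flip: mult.assoc power_add mult_2)
      finally show ?thesis using W by (simp add: \<Phi>'_def)
    qed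
    have \<Phi>'cyc: "bd (insert v A) \<Phi>' W J = 0" if W: "W \<subseteq> insert v A" "Suc (card W) = m" "J \<subseteq> W" "m \<noteq> d" for W J
    proof -
      have "bd (insert v A) \<Phi>' W J = bd (insert v A) \<Phi> W J - bd (insert v A) (bd (insert v A) \<Psi>1) W J"
        unfolding bd_def[of _ \<Phi>'] bd_def[of _ \<Phi>] bd_def[of _ "bd (insert v A) \<Psi>1"]
        unfolding sum_subtractf[symmetric] \<Phi>'_def using W
        by (intro sum.cong refl) (auto simp: algebra_simps)
      then show ?thesis using bd_bd[of "insert v A" W \<Psi>1 J] W insert.prems(4) insert.hyps(1) fin
        by (auto simp: strand_cycle_def)
    qed
    \<comment> \<open>The value on \<open>insert v W\<close> restricts to zero on \<open>W\<close>
      and so comes from the link. For \<open>m = d\<close> the sets \<open>J\<close> are too small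
      to carry values; otherwise the cycle condition at \<open>W\<close> has only its term for
      \<open>v\<close> left.\<close>
    have \<Phi>'ins0: "\<Phi>' (insert v W) J = 0" if W: "W \<subseteq> A" "card W = m'" "J \<subseteq> W" for W J
    proof (cases "m = d")
      case True
      have "finite W" "v \<notin> W" using W vA fin[of W] by auto
      moreover have "card J \<le> m'" using W \<open>finite W\<close> card_mono by blast
      ultimately show ?thesis using cocycD(2)[OF \<Phi>'co[of "insert v W"], of J] W True m' by auto
    next
      case False
      have vW: "finite W" "v \<notin> W" using W vA fin[of W] by auto
      have "\<Phi>' (insert j W) J = 0" if "j \<in> A - W" for j
        using that W m' vW by (intro \<Phi>'0) auto
      then have "bd (insert v A) \<Phi>' W J = (\<Sum>j\<in>{v}. sg j W * \<Phi>' (insert j W) J)"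
        unfolding bd_def using vW insert.hyps(1)
        by (intro sum.mono_neutral_right) auto
      moreover have "W \<subseteq> insert v A" using W by auto
      ultimately show ?thesis using \<Phi>'cyc[of W J] W m' False by simp
    qed
    define \<Theta> where "\<Theta> W S = (if S \<subseteq> W then \<Phi>' (insert v W) (insert v S) else 0)" for W S
    have ins: "card (insert v W) = Suc (card W)" if "W \<subseteq> A" for W
      using that vA fin[of W] by (subst card_insert_disjoint) auto
    have "\<exists>\<Psi>. (\<forall>U\<subseteq>A. card U = Suc m' \<longrightarrow> \<Psi> U \<in> cocyc d' (link v \<I>) U) \<and>
             (\<forall>W\<subseteq>A. card W = m' \<longrightarrow> (\<forall>J\<subseteq>W. bd A \<Psi> W J = \<Theta> W J))"
    proof (rule insert.IH)
      show "far d' (link v \<I>)" using far d' far_link by auto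
      show "d' \<le> m'" using insert.prems(2) d' m' by auto
      show "\<Theta> W \<in> cocyc d' (link v \<I>) W" if "W \<subseteq> A" "card W = m'" for W
        unfolding \<Theta>_def using that insert.hyps(2) fin[of W] d' m' ins
        by (intro cocyc_to_link) (auto intro!: \<Phi>'co[unfolded d'] \<Phi>'ins0)
      show "strand_cycle d' m' A \<Theta>"
      proof (cases "m = d")
        case True
        \<comment> \<open>Boundaries of cocycles have augmentation zero, so \<open>\<Phi>'\<close>
          inherits the cycle condition from \<open>\<Phi>\<close>.\<close>
        have "(\<Sum>W | W \<subseteq> insert v A \<and> card W = m. bd (insert v A) \<Psi>1 W W) = 0"
          using insert.hyps(1) cocycD(4)[OF \<Psi>1] True by (subst sum_bd_diagonal) (auto intro!: sum.neutral)
        then have "(\<Sum>W | W \<subseteq> insert v A \<and> card W = m. \<Phi>' W W) = 0"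
          using insert.prems(4) True by (simp add: \<Phi>'_def sum_subtractf strand_cycle_def)
        moreover have "(\<Sum>W | W \<subseteq> A \<and> card W = m. \<Phi>' W W) = 0" by (auto intro!: sum.neutral \<Phi>'0)
        ultimately show ?thesis using True d' m' insert.hyps(1) vA
          by (simp add: strand_cycle_def \<Theta>_def sum_insert_vertex)
      next
        case False
        have "bd A \<Theta> W S = 0" if W: "W \<subseteq> A" "Suc (card W) = m'" "S \<subseteq> W" for W S
        proof -
          have "bd (insert v A) \<Phi>' (insert v W) (insert v S) = bd A \<Theta> W S"
            unfolding bd_def
          proof (rule sum.cong)
            show "insert v A - insert v W = A - W" using vA W by auto
            fix j assume "j \<in> A - W"
            then show "sg j (insert v W) * \<Phi>' (insert j (insert v W)) (insert v S) = sg j W * \<Theta> (insert j W) S"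
              using W insert.hyps(2) by (auto simp: \<Theta>_def sg_insert_ge less_imp_le insert_commute)
          qed
          then show ?thesis using \<Phi>'cyc[of "insert v W" "insert v S"] W m' False ins by auto
        qed
        then show ?thesis using False d' m' by (simp add: strand_cycle_def)
      qed
    qed
    then obtain \<Psi> where \<Psi>0: "(\<forall>U\<subseteq>A. card U = Suc m' \<longrightarrow> \<Psi> U \<in> cocyc d' (link v \<I>) U) \<and>
             (\<forall>W\<subseteq>A. card W = m' \<longrightarrow> (\<forall>J\<subseteq>W. bd A \<Psi> W J = \<Theta> W J))" by (rule exE)
    have \<Psi>: "\<And>U. U \<subseteq> A \<Longrightarrow> card U = Suc m' \<Longrightarrow> \<Psi> U \<in> cocyc d' (link v \<I>) U"
       "\<And>W J. W \<subseteq> A \<Longrightarrow> card W = m' \<Longrightarrow> J \<subseteq> W \<Longrightarrow> bd A \<Psi> W J = \<Theta> W J"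
      using \<Psi>0 by simp_all
    define \<Psi>2 where "\<Psi>2 U J = (if v \<in> U then if v \<in> J then \<Psi> (U - {v}) (J - {v}) else 0 else 0)" for U J
    have \<Psi>2: "\<Psi>2 U \<in> cocyc d \<I> U" if U: "U \<subseteq> insert v A" "card U = Suc m" for U
    proof (cases "v \<in> U")
      case True
      then have U': "U - {v} \<subseteq> A" "card (U - {v}) = Suc m'" "insert v (U - {v}) = U"
        using U m' by auto
      show ?thesis unfolding \<Psi>2_def
        using cocyc_from_link[OF \<Psi>(1)[OF U'(1,2)]] U' True fin[of U] U insert.hyps(2) d' by auto
    next
      case False
      then have "\<Psi>2 U = (\<lambda>_. 0)" by (auto simp: \<Psi>2_def)
      then show ?thesis by (simp add: cocyc_zero)
    qed
    have \<Psi>2bd: "bd (insert v A) \<Psi>2 W J = \<Phi>' W J" if W: "W \<subseteq> insert v A" "card W = m" "J \<subseteq> W" for W J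
    proof (cases "v \<in> W")
      case False
      then have "W \<subseteq> A" using W by auto
      then show ?thesis using False W \<Phi>'0[of W J] 
        by (auto simp: bd_def \<Psi>2_def intro!: sum.neutral)
    next
      case True
      then obtain W' where W': "W = insert v W'" "v \<notin> W'" by (meson mk_disjoint_insert)
      then have WA: "W' \<subseteq> A" "card W' = m'" using W m' fin[of W] by auto
      show ?thesis
      proof (cases "v \<in> J")
        case False
        then show ?thesis using \<Phi>'ins0[of W' J] WA W W' by (auto simp: bd_def \<Psi>2_def)
      next
        case True
        then have J: "J - {v} \<subseteq> W'" "insert v (J - {v}) = J" using W W' by auto
        have "bd (insert v A) \<Psi>2 W J = bd A \<Psi> W' (J - {v})" unfolding bd_def
        proof (rule sum.cong)
          show "insert v A - W = A - W'" using vA W' WA by auto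
          fix j assume j: "j \<in> A - W'"
          then have "insert j W - {v} = insert j W'" using W' vA by auto
          then show "sg j W * \<Psi>2 (insert j W) J = sg j W' * \<Psi> (insert j W') (J - {v})"
            using True W' j insert.hyps(2) by (auto simp: \<Psi>2_def sg_insert_ge less_imp_le)
        qed
        then show ?thesis using \<Psi>(2)[OF WA J(1)] J by (simp add: \<Theta>_def W')
      qed
    qed
    show ?thesis
    proof (intro exI[of _ "\<lambda>U J. \<Psi>1 U J + \<Psi>2 U J"] conjI allI impI)
      fix U assume "U \<subseteq> insert v A" "card U = Suc m"
      then show "(\<lambda>J. \<Psi>1 U J + \<Psi>2 U J) \<in> cocyc d \<I> U" by (intro cocyc_add \<Psi>1 \<Psi>2)
    next
      fix W J assume W: "W \<subseteq> insert v A" "card W = m" "J \<subseteq> W"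
      have "bd (insert v A) (\<lambda>U J. \<Psi>1 U J + \<Psi>2 U J) W J = bd (insert v A) \<Psi>1 W J + bd (insert v A) \<Psi>2 W J"
        by (simp add: bd_def algebra_simps sum.distrib)
      then show "bd (insert v A) (\<lambda>U J. \<Psi>1 U J + \<Psi>2 U J) W J = \<Phi> W J"
        using \<Psi>2bd[OF W] W by (simp add: \<Phi>'_def)
    qed
  qed
qed

section \<open>Coordinates on the spaces of cocycles and their number\<close>

lemma ex1_implies_unique: "\<exists>!x. P x \<Longrightarrow> P x \<Longrightarrow> P y \<Longrightarrow> x = y"
  by auto

text \<open>Producing coordinates \<open>Fr\<close> instead of a dimension supplies a dual basis and
  its size at once, over any commutative ring. The coordinates on \<open>insert v W\<close> are
  those on \<open>W\<close> together with \<open>insert v\<close> of those for the link; members of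
  the family split in the same way into those inside \<open>W\<close> and those through
  \<open>v\<close>, so the count follows Pascal's rule.\<close>

lemma cocyc_free:
  assumes "finite W" "far d \<I>" "d \<ge> 1" "W \<noteq> {}"
  shows "\<exists>Fr. Fr \<subseteq> {J. J \<subseteq> W \<and> card J = d} \<and>
           card Fr + card {I \<in> \<I>. I \<subseteq> W} = (card W - 1) choose (d - 1) \<and>
           (\<forall>x. \<exists>!c. c \<in> cocyc d \<I> W \<and> (\<forall>J\<in>Fr. c J = (x J :: 'k::comm_ring_1)))"
  using assms
proof (induction W arbitrary: d \<I> rule: finite_linorder_max_induct)
  case empty
  then show ?case by simp
next
  case (insert v W)
  have fin: "finite W'" if "W' \<subseteq> insert v W" for W' using that insert.hyps(1) finite_subset by auto
  have vW: "v \<notin> W" using insert.hyps(2) by auto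
  note far = insert.prems(1)
  have one: "I = {i}" if "I \<in> \<I>" "i \<in> I" "d = 1" for I i
  proof -
    have "card I = 1" using far that by (simp add: far_def)
    then show ?thesis using that by (auto simp: card_1_singleton_iff)
  qed
  have single: "\<I> = {{v}}" if "d = 1" and top: "{v} \<in> \<I>"
  proof -
    have "I = {v}" if "I \<in> \<I>" for I
    proof (rule ccontr)
      assume "I \<noteq> {v}"
      then have "card (I \<inter> {v}) + 2 \<le> d"
        using far[unfolded far_def, THEN conjunct2, rule_format, OF that(1) top] by simp
      then show False using \<open>d = 1\<close> by simp
    qed
    then show ?thesis using top by blast
  qed
  consider (top) "d = 1" "{v} \<in> \<I>" | (base) "W = {}" "\<not> (d = 1 \<and> {v} \<in> \<I>)"
    | (step) "W \<noteq> {}" "\<not> (d = 1 \<and> {v} \<in> \<I>)" by blast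
  then show ?case
  proof cases
    case top
    \<comment> \<open>Both sides of the count are 1: there are no coordinates, and
      \<open>{v}\<close> is the only member of the family.\<close>
    have z: "c \<in> cocyc (Suc 0) \<I> (insert v W) \<longleftrightarrow> c = (\<lambda>_. 0)" for c :: "nat set \<Rightarrow> 'k"
      using cocyc_top_vertex[of v \<I> "insert v W" c] top cocyc_zero by auto
    have "{I \<in> \<I>. I \<subseteq> insert v W} = {{v}}" using single top by auto
    then show ?thesis using top by (intro exI[of _ "{}"]) (auto simp: z)
  next
    case base
    show ?thesis
    proof (cases "d = 1")
      case True
      have no: "{I \<in> \<I>. I \<subseteq> {v}} = {}"
      proof -
        have "I = {v}" if "I \<in> \<I>" "I \<subseteq> {v}" for I
        proof -
          have "card I = 1" using that far True by (simp add: far_def)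
          then show ?thesis using that by (auto simp: card_1_singleton_iff)
        qed
        then show ?thesis using base True by auto
      qed
      have "\<exists>!c. c \<in> cocyc 1 \<I> {v} \<and> c {v} = x {v}" for x :: "nat set \<Rightarrow> 'k"
      proof (intro ex1I[of _ "\<lambda>J. if J = {v} then x {v} else 0"] conjI ext)
        show "(\<lambda>J. if J = {v} then x {v} else 0) \<in> cocyc 1 \<I> {v}"
        proof -
          have "card U \<noteq> Suc 1" if "U \<subseteq> {v}" for U using card_mono[OF _ that] by auto
          moreover have "{v} \<notin> \<I>" using base True by simp
          ultimately show ?thesis by (simp add: cocyc_def)
        qed
        fix c J assume c: "c \<in> cocyc 1 \<I> {v} \<and> c {v} = x {v}"
        show "c J = (if J = {v} then x {v} else 0)"
          using c cocycD(1,2)[of c 1 \<I> "{v}" J] by (auto simp: subset_singleton_iff)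
      qed simp
      then show ?thesis using base True no by (intro exI[of _ "{{v}}"]) auto
    next
      case False
      have none: "card J \<noteq> d" if "J \<subseteq> {v}" for J
        using card_mono[OF _ that] False insert.prems(2) by auto
      have no: "{I \<in> \<I>. I \<subseteq> {v}} = {}" using none far by (auto simp: far_def)
      have z: "c \<in> cocyc d \<I> {v} \<longleftrightarrow> c = (\<lambda>_. 0)" for c :: "nat set \<Rightarrow> 'k"
        using cocycD(1,2)[of c d \<I> "{v}"] none cocyc_zero by blast
      obtain e where "d = Suc (Suc e)" using False insert.prems(2) by (cases d; cases "d - 1") auto
      then have cnt: "card {I \<in> \<I>. I \<subseteq> {v}} = 0 choose (d - 1)" unfolding no by simp
      have "\<exists>!c :: nat set \<Rightarrow> 'k. c \<in> cocyc d \<I> {v}" by (simp add: z)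
      then show ?thesis unfolding base(1) by (intro exI[of _ "{}"]) (simp add: cnt)
    qed
  next
    case step
    obtain e where e: "d = Suc e" using insert.prems(2) by (cases d) auto
    obtain F1 where F1: "F1 \<subseteq> {J. J \<subseteq> W \<and> card J = d}"
        "card F1 + card {I \<in> \<I>. I \<subseteq> W} = (card W - 1) choose (d - 1)"
        "\<And>x :: nat set \<Rightarrow> 'k. \<exists>!c. c \<in> cocyc d \<I> W \<and> (\<forall>J\<in>F1. c J = x J)"
      using insert.IH[OF far insert.prems(2) step(1)] by blast
    \<comment> \<open>For \<open>e = 0\<close> the space of the link is zero, whereas the binomial
      with the truncated \<open>e - 1\<close> would be 1; hence the separate value.\<close>
    obtain F2 where F2: "F2 \<subseteq> {J. J \<subseteq> W \<and> card J = e}"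
        "card F2 + card {I \<in> link v \<I>. I \<subseteq> W} = (if e = 0 then 0 else (card W - 1) choose (e - 1))"
        "\<And>x :: nat set \<Rightarrow> 'k. \<exists>!c. c \<in> cocyc e (link v \<I>) W \<and> (\<forall>J\<in>F2. c J = x J)"
    proof (cases "e = 0")
      case True
      have z: "c \<in> cocyc 0 (link v \<I>) W \<longleftrightarrow> c = (\<lambda>_. 0)" for c :: "nat set \<Rightarrow> 'k"
        using cocyc_zero_dim[of c "link v \<I>" W] step insert.hyps(1) cocyc_zero by auto
      have "link v \<I> = {}" using one step True e by (auto simp: link_def)
      moreover have "\<exists>!c :: nat set \<Rightarrow> 'k. c \<in> cocyc e (link v \<I>) W" using True by (simp add: z)
      ultimately show ?thesis using that[of "{}"] True by simp
    next
      case False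
      then show ?thesis
        using that insert.IH[of e "link v \<I>", OF far_link[OF far[unfolded e]] _ step(1)] by auto
    qed
    have injv: "inj_on (insert v) {S. S \<subseteq> W}"
      using vW by (intro inj_onI) (metis insert_ident mem_Collect_eq subsetD)
    have finW: "finite {J. J \<subseteq> W \<and> P J}" for P using insert.hyps(1) by simp
    have finF: "finite F1" "finite F2" using F1(1) F2(1) finite_subset[OF _ finW] by auto
    let ?F = "F1 \<union> insert v ` F2"
    show ?thesis
    proof (intro exI[of _ ?F] conjI allI)
      show "?F \<subseteq> {J. J \<subseteq> insert v W \<and> card J = d}"
      proof
        fix J assume "J \<in> ?F"
        then show "J \<in> {J. J \<subseteq> insert v W \<and> card J = d}"
        proof
          assume "J \<in> insert v ` F2"
          then obtain S where S: "S \<subseteq> W" "card S = e" "J = insert v S" using F2(1) by auto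
          then have "v \<notin> S" "finite S" using vW fin[of S] by auto
          then show ?thesis using S e by auto
        qed (use F1(1) in auto)
      qed
      have "card ?F = card F1 + card F2"
      proof -
        have "card (insert v ` F2) = card F2"
          using F2(1) by (intro card_image inj_on_subset[OF injv]) auto
        moreover have "F1 \<inter> insert v ` F2 = {}" using F1(1) vW by auto
        ultimately show ?thesis using finF by (simp add: card_Un_disjoint)
      qed
      moreover have "card {I \<in> \<I>. I \<subseteq> insert v W} = card {I \<in> \<I>. I \<subseteq> W} + card {I \<in> link v \<I>. I \<subseteq> W}"
      proof -
        have eq: "{I \<in> \<I>. I \<subseteq> insert v W} = {I \<in> \<I>. I \<subseteq> W} \<union> insert v ` {I \<in> link v \<I>. I \<subseteq> W}" (is "?L = ?R")
        proof (intro equalityI subsetI)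
          fix I assume I: "I \<in> ?L"
          show "I \<in> ?R"
          proof (cases "v \<in> I")
            case True
            then have "I = insert v (I - {v})" "I - {v} \<in> {I \<in> link v \<I>. I \<subseteq> W}"
              using I by (auto simp: link_def)
            then show ?thesis by blast
          qed (use I in auto)
        next
          fix I assume "I \<in> ?R"
          then show "I \<in> ?L"
          proof
            assume "I \<in> insert v ` {I \<in> link v \<I>. I \<subseteq> W}"
            then obtain S where S: "S \<in> link v \<I>" "S \<subseteq> W" "I = insert v S" by auto
            then show ?thesis using vW in_link[of v S \<I>] by auto
          qed auto
        qed
        have "finite {I \<in> \<I>. I \<subseteq> W}" "finite {I \<in> link v \<I>. I \<subseteq> W}"
          using insert.hyps(1) by (auto intro: finite_subset[of _ "Pow W"])
        moreover have "card (insert v ` {I \<in> link v \<I>. I \<subseteq> W}) = card {I \<in> link v \<I>. I \<subseteq> W}"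
          by (intro card_image inj_on_subset[OF injv]) auto
        moreover have "{I \<in> \<I>. I \<subseteq> W} \<inter> insert v ` {I \<in> link v \<I>. I \<subseteq> W} = {}" using vW by auto
        ultimately show ?thesis unfolding eq by (simp add: card_Un_disjoint)
      qed
      moreover have "(card (insert v W) - 1) choose (d - 1) =
          ((card W - 1) choose (d - 1)) + (if e = 0 then 0 else (card W - 1) choose (e - 1))"
      proof -
        have "card W > 0" using step insert.hyps(1) by (simp add: card_gt_0_iff)
        then obtain n where "card W = Suc n" by (cases "card W") auto
        then show ?thesis using vW insert.hyps(1) e by (cases e) auto
      qed
      ultimately show "card ?F + card {I \<in> \<I>. I \<subseteq> insert v W} = (card (insert v W) - 1) choose (d - 1)"
        using F1(2) F2(2) by linarith
    next
      fix x :: "nat set \<Rightarrow> 'k"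
      obtain c0 where c0: "c0 \<in> cocyc d \<I> W" "\<forall>J\<in>F1. c0 J = x J" using F1(3)[of x] by blast
      obtain c1 where c1: "c1 \<in> cocyc d \<I> (insert v W)" "\<forall>J\<subseteq>W. c1 J = c0 J"
        using cocyc_extend[OF c0(1) far insert.prems(2) step(2) insert.hyps(1)] insert.hyps(2) by blast
      \<comment> \<open>A cocycle coming from the link adjusts the values at the sets
        \<open>insert v S\<close> without changing any value inside \<open>W\<close>.\<close>
      obtain l where l: "l \<in> cocyc e (link v \<I>) W" "\<forall>S\<in>F2. l S = x (insert v S) - c1 (insert v S)"
        using F2(3)[of "\<lambda>S. x (insert v S) - c1 (insert v S)"] by blast
      define c where "c J = c1 J + (if v \<in> J then l (J - {v}) else 0)" for J
      have l': "(\<lambda>J. if v \<in> J then l (J - {v}) else 0) \<in> cocyc d \<I> (insert v W)"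
        using cocyc_from_link[OF l(1) insert.hyps(1)] insert.hyps(2) e by simp
      have c: "c \<in> cocyc d \<I> (insert v W)"
        unfolding c_def[abs_def] using cocyc_add[OF c1(1) l'] .
      have cx: "\<forall>J\<in>?F. c J = x J"
      proof
        fix J assume "J \<in> ?F"
        then show "c J = x J"
        proof
          assume J: "J \<in> F1"
          then have "J \<subseteq> W" "v \<notin> J" using F1(1) vW by auto
          then show ?thesis using J c0 c1 by (simp add: c_def)
        next
          assume "J \<in> insert v ` F2"
          then obtain S where S: "S \<in> F2" "J = insert v S" by auto
          then have "v \<notin> S" using F2(1) vW by auto
          then show ?thesis using S l(2) by (simp add: c_def)
        qed
      qed
      have uniq: "c' = c''" if c': "c' \<in> cocyc d \<I> (insert v W)" "\<forall>J\<in>?F. c' J = x J"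
        and c'': "c'' \<in> cocyc d \<I> (insert v W)" "\<forall>J\<in>?F. c'' J = x J" for c' c''
      proof -
        \<comment> \<open>The difference of two solutions is zero inside \<open>W\<close> by
          \<open>F1\<close>, hence comes from the link, where \<open>F2\<close> forces it to
          vanish.\<close>
        define g where "g J = c' J - c'' J" for J
        have g: "g \<in> cocyc d \<I> (insert v W)" unfolding g_def[abs_def] by (intro cocyc_diff c' c'')
        have gF: "\<forall>J\<in>?F. g J = 0" using c' c'' by (simp add: g_def)
        have "(\<lambda>J. if J \<subseteq> W then g J else 0) \<in> cocyc d \<I> W" using g by (rule cocyc_restrict) auto
        moreover have "\<forall>J\<in>F1. (if J \<subseteq> W then g J else 0) = 0" using gF by auto
        ultimately have "(\<lambda>J. if J \<subseteq> W then g J else 0) = (\<lambda>_. 0)"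
          using cocyc_zero[of d \<I> W] by - (rule ex1_implies_unique[OF F1(3)[of "\<lambda>_. 0"]], simp_all)
        then have g0: "g J = 0" if "J \<subseteq> W" for J using that fun_cong[of _ _ J] by fastforce
        have "(\<lambda>S. if S \<subseteq> W then g (insert v S) else 0) \<in> cocyc e (link v \<I>) W"
          using g g0 insert.hyps(1,2) e by (intro cocyc_to_link) auto
        moreover have "\<forall>S\<in>F2. (if S \<subseteq> W then g (insert v S) else 0) = 0" using gF by auto
        ultimately have l0: "(\<lambda>S. if S \<subseteq> W then g (insert v S) else 0) = (\<lambda>_. 0)"
          using cocyc_zero[of e "link v \<I>" W]
          by - (rule ex1_implies_unique[OF F2(3)[of "\<lambda>_. 0"]], simp_all)
        have "g J = 0" for J
        proof (cases "v \<in> J \<and> J \<subseteq> insert v W")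
          case True
          then have "J - {v} \<subseteq> W" "insert v (J - {v}) = J" by auto
          then show ?thesis using fun_cong[OF l0, of "J - {v}"] by simp
        next
          case False
          then show ?thesis using g0[of J] cocycD(1)[OF g, of J] by auto
        qed
        then show ?thesis by (auto simp: g_def)
      qed
      show "\<exists>!c. c \<in> cocyc d \<I> (insert v W) \<and> (\<forall>J\<in>?F. c J = x J)"
        using c cx uniq by (intro ex1I[of _ c]) simp_all
    qed
  qed
qed

section \<open>Linear maps between free modules\<close>

definition lin_ext :: "(nat \<Rightarrow> (nat \<Rightarrow>\<^sub>0 'a::comm_ring_1)) \<Rightarrow> (nat \<Rightarrow>\<^sub>0 'a) \<Rightarrow> (nat \<Rightarrow>\<^sub>0 'a)" where
  "lin_ext c v = (\<Sum>q\<in>keys v. fscale (lookup v q) (c q))"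

lemmas fscale_scale = module.scale_scale[OF module_fscale]
lemmas fscale_add_left = module.scale_left_distrib[OF module_fscale]
lemmas fscale_sum = module.scale_sum_right[OF module_fscale]
lemmas fscale_zero_left [simp] = module.scale_zero_left[OF module_fscale]
lemmas fscale_zero_right [simp] = module.scale_zero_right[OF module_fscale]
lemmas fscale_one [simp] = module.scale_one[OF module_fscale]

lemma lin_ext_superset:
  assumes "finite S" "keys v \<subseteq> S"
  shows "lin_ext c v = (\<Sum>q\<in>S. fscale (lookup v q) (c q))"
  unfolding lin_ext_def using assms by (intro sum.mono_neutral_left) (auto simp: in_keys_iff)

lemma lin_ext_hom: "module_hom fscale fscale (lin_ext c)"
  unfolding module_hom_iff
proof (intro conjI allI module_fscale)
  fix u v :: "nat \<Rightarrow>\<^sub>0 'a" and a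
  let ?S = "keys u \<union> keys v"
  have "lin_ext c (u + v) = (\<Sum>q\<in>?S. fscale (lookup (u + v) q) (c q))"
    by (rule lin_ext_superset) (auto simp: Poly_Mapping.keys_add)
  also have "\<dots> = lin_ext c u + lin_ext c v"
    by (simp add: lin_ext_superset[of ?S u] lin_ext_superset[of ?S v] lookup_add fscale_add_left sum.distrib)
  finally show "lin_ext c (u + v) = lin_ext c u + lin_ext c v" .
  have "keys (fscale a u) \<subseteq> keys u"
    by (auto simp: in_keys_iff lookup_fscale)
  then have "lin_ext c (fscale a u) = (\<Sum>q\<in>keys u. fscale (lookup (fscale a u) q) (c q))"
    by (intro lin_ext_superset) auto
  then show "lin_ext c (fscale a u) = fscale a (lin_ext c u)"
    by (simp add: lin_ext_def lookup_fscale fscale_sum fscale_scale)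
qed

lemma lin_ext_basis [simp]: "lin_ext c (single q 1) = c q"
  by (subst lin_ext_superset[of "{q}"]) auto

lemma basis_expansion:
  "v = (\<Sum>q\<in>keys v. fscale (lookup v q) (single q (1::'a::comm_ring_1)))"
  (is "v = ?s")
proof (rule poly_mapping_eqI)
  fix k
  have "lookup ?s k = (\<Sum>q\<in>keys v. if q = k then lookup v k else 0)"
    unfolding lookup_sum by (intro sum.cong) (auto simp: lookup_fscale lookup_single when_def)
  then show "lookup v k = lookup ?s k" by (simp add: in_keys_iff)
qed

lemma hom_expand:
  assumes "module_hom fscale s f"
  shows "f v = (\<Sum>q\<in>keys v. s (lookup v q) (f (single q 1)))"
proof -
  interpret module_hom fscale s f by fact
  have "f v = f (\<Sum>q\<in>keys v. fscale (lookup v q) (single q 1))"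
    by (rule arg_cong[OF basis_expansion])
  then show ?thesis by (simp add: sum scale)
qed

lemma hom_eq_on_free:
  assumes f: "module_hom fscale s f" and g: "module_hom fscale s g"
    and eq: "\<And>q. q \<in> B \<Longrightarrow> f (single q 1) = g (single q 1)"
    and v: "v \<in> free_on B"
  shows "f v = g v"
  unfolding hom_expand[OF f, of v] hom_expand[OF g, of v]
  using eq v by (intro sum.cong) (auto simp: free_on_def)

lemma fscale_subspaceI:
  assumes "0 \<in> S" "\<And>u v. u \<in> S \<Longrightarrow> v \<in> S \<Longrightarrow> u + v \<in> S" "\<And>a v. v \<in> S \<Longrightarrow> fscale a v \<in> S"
  shows "module.subspace fscale S"
  using assms by (simp add: module.subspace_def[OF module_fscale])

lemma subspace_free_on: "module.subspace fscale (free_on B :: (nat \<Rightarrow>\<^sub>0 'a::comm_ring_1) set)"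
  by (rule fscale_subspaceI)
     (auto simp: free_on_def in_keys_iff lookup_add lookup_fscale subset_iff; metis add_0 mult_zero_right)+

lemma free_on_basis: "q \<in> B \<Longrightarrow> single q a \<in> free_on B"
  by (auto simp: free_on_def)

lemma lookup_free_on: "v \<in> free_on B \<Longrightarrow> p \<notin> B \<Longrightarrow> lookup v p = 0"
  by (auto simp: free_on_def in_keys_iff)

lemma free_onI: "(\<And>p. p \<notin> B \<Longrightarrow> lookup v p = 0) \<Longrightarrow> v \<in> free_on B"
  by (auto simp: free_on_def in_keys_iff)

lemma hom_free_into_subspace:
  assumes f: "module_hom fscale s f" and N: "module.subspace s N"
    and b: "\<And>q. q \<in> B \<Longrightarrow> f (single q 1) \<in> N" and v: "v \<in> free_on B"
  shows "f v \<in> N"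
proof -
  interpret module_hom fscale s f by fact
  show ?thesis
    unfolding hom_expand[OF f, of v]
    using b v by (intro m2.subspace_sum[OF N] m2.subspace_scale[OF N]) (auto simp: free_on_def)
qed

section \<open>Squarefree monomials\<close>

definition umon :: "'n::finite set \<Rightarrow> ('n \<Rightarrow>\<^sub>0 nat)" where
  "umon S = (\<Sum>i\<in>S. single i 1)"

lemma lookup_umon: "lookup (umon S) i = (if i \<in> S then 1 else 0)"
  unfolding umon_def lookup_sum lookup_single when_def by (simp add: sum.delta)

lemma mdeg_umon: "mdeg (umon S) = card S"
  by (simp add: mdeg_def lookup_umon flip: sum.inter_filter)

lemma umon_eq_0_iff: "umon S = 0 \<longleftrightarrow> S = {}"
proof
  assume "umon S = 0"
  then have "lookup (umon S) i = 0" for i by simp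
  then show "S = {}" unfolding lookup_umon by (metis equals0I zero_neq_one)
qed (simp add: umon_def)

lemma sqfree_monom_eq: "sqfree_monom S = single (umon S) (1::'k::comm_ring_1)"
proof -
  have "finite S" by simp
  then show ?thesis unfolding sqfree_monom_def umon_def Var_def
    by (induction S) (auto simp: mult_single)
qed

lemma sum_single_keys: "(\<Sum>k\<in>keys f. single k (lookup f k)) = f"
proof (rule poly_mapping_eqI)
  fix k
  have "lookup (\<Sum>k\<in>keys f. single k (lookup f k)) k =
    (\<Sum>q\<in>keys f. if q = k then lookup f k else 0)"
    unfolding lookup_sum by (intro sum.cong) (auto simp: lookup_single when_def)
  then show "lookup (\<Sum>k\<in>keys f. single k (lookup f k)) k = lookup f k"
    by (simp add: in_keys_iff)
qed

lemma umon_le: "S \<subseteq> keys t \<Longrightarrow> t - umon S + umon S = t"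
  by (rule poly_mapping_eqI) (auto simp: lookup_add lookup_minus lookup_umon in_keys_iff subset_iff)

lemma keys_add_umon: "S \<subseteq> keys (t + umon S)"
  by (auto simp: in_keys_iff lookup_add lookup_umon)

lemma lookup_mult_single_umon:
  fixes f :: "('n::finite, 'k::comm_ring_1) mpoly"
  shows "lookup (f * single (umon S) a) m =
    (if S \<subseteq> keys m then lookup f (m - umon S) * a else 0)"
proof -
  have iff: "m' + umon S = m \<longleftrightarrow> S \<subseteq> keys m \<and> m' = m - umon S" for m'
    using umon_le[of S m] keys_add_umon[of S m'] by auto
  have "f * single (umon S) a = (\<Sum>k\<in>keys f. single k (lookup f k)) * single (umon S) a"
    by (subst sum_single_keys) simp
  also have "\<dots> =
      (\<Sum>k\<in>keys f. single (k + umon S) (lookup f k * a))"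
    by (simp add: mult_single sum_distrib_right)
  finally have eq: "f * single (umon S) a =
      (\<Sum>k\<in>keys f. single (k + umon S) (lookup f k * a))" .
  have "lookup (f * single (umon S) a) m =
     (\<Sum>k\<in>keys f. if k = m - umon S then (if S \<subseteq> keys m then lookup f (m - umon S) * a else 0) else 0)"
    unfolding eq lookup_sum lookup_single when_def iff by (intro sum.cong refl) auto
  then show ?thesis by (simp add: in_keys_iff)
qed

lemma keys_minus_umon: "R \<inter> S = {} \<Longrightarrow> R \<subseteq> keys (t - umon S) \<longleftrightarrow> R \<subseteq> keys t"
  unfolding subset_iff in_keys_iff lookup_minus lookup_umon by (auto split: if_splits)

lemma minus_umon_union: "R \<inter> S = {} \<Longrightarrow> t - umon S - umon R = t - umon (R \<union> S)"
  by (rule poly_mapping_eqI) (auto simp: lookup_minus lookup_umon)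

lemma subspace_squarefree_ideal:
  "module.subspace (*) {f :: ('n::finite, 'k::comm_ring_1) mpoly. \<forall>m\<in>keys f. \<exists>S\<in>\<S>. S \<subseteq> keys m}"
  unfolding module.subspace_def[OF module_mult]
proof (intro conjI ballI allI)
  fix f g :: "('n, 'k) mpoly"
  assume *: "f \<in> {f. \<forall>m\<in>keys f. \<exists>S\<in>\<S>. S \<subseteq> keys m}"
    "g \<in> {f. \<forall>m\<in>keys f. \<exists>S\<in>\<S>. S \<subseteq> keys m}"
  then show "f + g \<in> {f. \<forall>m\<in>keys f. \<exists>S\<in>\<S>. S \<subseteq> keys m}"
    using Poly_Mapping.keys_add[of f g] by blast
next
  fix f g :: "('n, 'k) mpoly"
  assume *: "g \<in> {f. \<forall>m\<in>keys f. \<exists>S\<in>\<S>. S \<subseteq> keys m}"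
  show "f * g \<in> {f. \<forall>m\<in>keys f. \<exists>S\<in>\<S>. S \<subseteq> keys m}"
  proof (intro CollectI ballI)
    fix m assume "m \<in> keys (f * g)"
    then obtain a b where ab: "m = a + b" "b \<in> keys g"
      using Poly_Mapping.keys_mult[of f g] by blast
    then obtain S where "S \<in> \<S>" "S \<subseteq> keys b" using * by blast
    moreover have "keys b \<subseteq> keys m"
      unfolding ab by (auto simp: in_keys_iff lookup_add)
    ultimately show "\<exists>S\<in>\<S>. S \<subseteq> keys m" by blast
  qed
qed simp

text \<open>Divisibility by a squarefree monomial is a condition on supports, and an ideal generated
  by monomials contains every monomial of each of its elements.\<close>

lemma squarefree_ideal_gen:
  "ideal_gen {sqfree_monom S |S. S \<in> \<S>} =
    {f :: ('n::finite, 'k::comm_ring_1) mpoly. \<forall>m\<in>keys f. \<exists>S\<in>\<S>. S \<subseteq> keys m}"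
  (is "_ = ?K")
proof
  have sub: "sqfree_monom S \<in> ?K" if "S \<in> \<S>" for S
    using that keys_add_umon[of S 0] by (auto simp: sqfree_monom_eq)
  show "ideal_gen {sqfree_monom S |S. S \<in> \<S>} \<subseteq> ?K"
    unfolding ideal_gen_def
    by (rule module.span_minimal[OF module_mult _ subspace_squarefree_ideal]) (use sub in auto)
  show "?K \<subseteq> ideal_gen {sqfree_monom S |S. S \<in> \<S>}"
  proof
    fix f assume f: "f \<in> ?K"
    let ?I = "ideal_gen {sqfree_monom S |S. S \<in> \<S>} :: ('n, 'k) mpoly set"
    have "single k a \<in> ?I" if k: "k \<in> keys f" for k a
    proof -
      obtain S where S: "S \<in> \<S>" "S \<subseteq> keys k" using f k by blast
      have "single k a = single (k - umon S) a * sqfree_monom S"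
        using umon_le[OF S(2)] by (simp add: sqfree_monom_eq mult_single)
      moreover have "sqfree_monom S \<in> ?I"
        unfolding ideal_gen_def using S by (intro module.span_base[OF module_mult]) auto
      ultimately show ?thesis
        unfolding ideal_gen_def by (simp add: module.span_scale[OF module_mult])
    qed
    then show "f \<in> ?I"
      by (subst sum_single_keys[symmetric]) (unfold ideal_gen_def, intro module.span_sum[OF module_mult], auto)
  qed
qed

section \<open>Squarefree multigraded complexes\<close>

text \<open>
  The generator \<open>q\<close> has multidegree \<open>\<Prod>i\<in>w q. x\<^sub>i\<close>, and \<open>\<alpha> p q\<close> is the scalar in the entry of the
  differential from \<open>q\<close> to \<open>p\<close>. The last assumption says that the part in every multidegree with
  support \<open>A\<close> is exact.
\<close>

locale squarefree_complex =
  fixes \<Gamma> :: "nat \<Rightarrow> nat set" and w :: "nat \<Rightarrow> 'n::finite set"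
    and \<alpha> :: "nat \<Rightarrow> nat \<Rightarrow> 'k::field" and g0 :: nat
  assumes fin_gens: "finite (\<Gamma> i)"
    and gens_0: "\<Gamma> 0 = {g0}" "w g0 = {}"
    and coeff_psubset: "p \<in> \<Gamma> i \<Longrightarrow> q \<in> \<Gamma> (Suc i) \<Longrightarrow> \<alpha> p q \<noteq> 0 \<Longrightarrow> w p \<subset> w q"
    and coeff_aug: "q \<in> \<Gamma> (Suc 0) \<Longrightarrow> \<alpha> g0 q \<noteq> 0"
    and coeff_coeff: "p \<in> \<Gamma> i \<Longrightarrow> u \<in> \<Gamma> (Suc (Suc i)) \<Longrightarrow> (\<Sum>q\<in>\<Gamma> (Suc i). \<alpha> p q * \<alpha> q u) = 0"
    and strands_exact: "(\<And>p. p \<in> \<Gamma> i \<Longrightarrow> w p \<subseteq> A \<Longrightarrow> (\<Sum>q | q \<in> \<Gamma> (Suc i) \<and> w q \<subseteq> A. \<alpha> p q * x q) = 0) \<Longrightarrow>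
      \<exists>y. \<forall>q\<in>\<Gamma> (Suc i). w q \<subseteq> A \<longrightarrow> x q = (\<Sum>u | u \<in> \<Gamma> (Suc (Suc i)) \<and> w u \<subseteq> A. \<alpha> q u * y u)"
begin

definition entry :: "nat \<Rightarrow> nat \<Rightarrow> ('n, 'k) mpoly" where
  "entry p q = single (umon (w q - w p)) (\<alpha> p q)"

definition bmap :: "nat \<Rightarrow> (nat \<Rightarrow>\<^sub>0 ('n, 'k) mpoly) \<Rightarrow> (nat \<Rightarrow>\<^sub>0 ('n, 'k) mpoly)" where
  "bmap i = lin_ext (\<lambda>q. if q \<in> \<Gamma> (Suc i) then \<Sum>p\<in>\<Gamma> i. single p (entry p q) else 0)"

text \<open>The coordinate at \<open>q\<close> of the part of \<open>v\<close> in multidegree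
  \<open>t\<close>. The guard is needed because subtraction of exponents truncates.\<close>

definition comp :: "('n \<Rightarrow>\<^sub>0 nat) \<Rightarrow> (nat \<Rightarrow>\<^sub>0 ('n, 'k) mpoly) \<Rightarrow> nat \<Rightarrow> 'k" where
  "comp t v q = (if w q \<subseteq> keys t
     then lookup (lookup v q) (t - umon (w q)) else 0)"

text \<open>Inverse to \<open>comp t\<close>: the vector concentrated in multidegree
  \<open>t\<close> with coordinates \<open>y\<close>.\<close>

definition mono_vec :: "nat \<Rightarrow> ('n \<Rightarrow>\<^sub>0 nat) \<Rightarrow> (nat \<Rightarrow> 'k) \<Rightarrow> (nat \<Rightarrow>\<^sub>0 ('n, 'k) mpoly)" where
  "mono_vec i t y = (\<Sum>q | q \<in> \<Gamma> i \<and> w q \<subseteq> keys t.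
      single q (single (t - umon (w q)) (y q)))"

definition res :: "('n, 'k) graded_free" where
  "res = \<lparr>gens = \<Gamma>, shift = (\<lambda>_ p. int (card (w p))), diff = bmap, aug = (\<lambda>v. lookup v g0)\<rparr>"

definition aug_ideal :: "('n, 'k) mpoly set" where
  "aug_ideal = {f. \<forall>m\<in>keys f. \<exists>S\<in>w ` \<Gamma> (Suc 0). S \<subseteq> keys m}"

lemma lookup_bmap:
  assumes "v \<in> free_on (\<Gamma> (Suc i))"
  shows "lookup (bmap i v) p =
    (if p \<in> \<Gamma> i then \<Sum>q\<in>\<Gamma> (Suc i). lookup v q * entry p q else 0)"
proof -
  have "bmap i v = (\<Sum>q\<in>\<Gamma> (Suc i). fscale (lookup v q) (\<Sum>p\<in>\<Gamma> i. single p (entry p q)))"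
    unfolding bmap_def using assms fin_gens
    by (subst lin_ext_superset[of "\<Gamma> (Suc i)"]) (auto simp: free_on_def)
  then show ?thesis
    by (simp add: lookup_sum lookup_fscale lookup_single when_def fin_gens)
qed

lemma bmap_free_on: "bmap i v \<in> free_on (\<Gamma> i)"
  unfolding bmap_def
proof (rule hom_free_into_subspace[OF lin_ext_hom subspace_free_on, of UNIV])
  show "v \<in> free_on UNIV" by (simp add: free_on_def)
  show "lin_ext (\<lambda>q. if q \<in> \<Gamma> (Suc i) then \<Sum>p\<in>\<Gamma> i. single p (entry p q) else 0) (single q 1) \<in> free_on (\<Gamma> i)" for q
    by (auto intro!: free_onI sum.neutral simp: lookup_sum lookup_single when_def)
qed

text \<open>The monomial in an entry is exactly the quotient of the two multidegrees, so in a fixed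
  multidegree the differential is the scalar matrix \<open>\<alpha>\<close>. Exactness over the
  polynomial ring thereby becomes linear algebra in each multidegree.\<close>

lemma comp_bmap:
  assumes v: "v \<in> free_on (\<Gamma> (Suc i))" and p: "p \<in> \<Gamma> i" "w p \<subseteq> keys t"
  shows "comp t (bmap i v) p = (\<Sum>q\<in>\<Gamma> (Suc i). \<alpha> p q * comp t v q)"
proof -
  have "comp t (bmap i v) p =
     (\<Sum>q\<in>\<Gamma> (Suc i). lookup (lookup v q * entry p q) (t - umon (w p)))"
    using p by (simp add: comp_def lookup_bmap[OF v] lookup_sum)
  also have "\<dots> = (\<Sum>q\<in>\<Gamma> (Suc i). \<alpha> p q * comp t v q)"
  proof (rule sum.cong[OF refl])
    fix q assume q: "q \<in> \<Gamma> (Suc i)"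
    show "lookup (lookup v q * entry p q) (t - umon (w p)) = \<alpha> p q * comp t v q"
    proof (cases "\<alpha> p q = 0")
      case False
      then have sub: "w p \<subseteq> w q" using coeff_psubset[OF p(1) q] by auto
      have disj: "(w q - w p) \<inter> w p = {}" "w q - w p \<union> w p = w q" using sub by auto
      have "w q \<subseteq> keys t \<longleftrightarrow> w q - w p \<subseteq> keys t" using p by auto
      then show ?thesis unfolding entry_def comp_def lookup_mult_single_umon
        using keys_minus_umon[OF disj(1)] minus_umon_union[OF disj(1)] disj(2) by simp
    qed (simp add: entry_def)
  qed
  finally show ?thesis .
qed

lemma comp_bmap_strand:
  assumes v: "v \<in> free_on (\<Gamma> (Suc i))" and p: "p \<in> \<Gamma> i" "w p \<subseteq> keys t"
  shows "comp t (bmap i v) p = (\<Sum>q | q \<in> \<Gamma> (Suc i) \<and> w q \<subseteq> keys t. \<alpha> p q * comp t v q)"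
  unfolding comp_bmap[OF assms] using fin_gens
  by (intro sum.mono_neutral_right) (auto simp: comp_def)

lemma comp_zero [simp]: "comp t 0 q = 0"
  by (simp add: comp_def)

lemma comp_sum: "comp t (\<Sum>x\<in>X. f x) q = (\<Sum>x\<in>X. comp t (f x) q)"
  by (simp add: comp_def lookup_sum)

lemma eqI_comp:
  assumes u: "u \<in> free_on (\<Gamma> i)" and v: "v \<in> free_on (\<Gamma> i)"
    and eq: "\<And>t q. q \<in> \<Gamma> i \<Longrightarrow> w q \<subseteq> keys t \<Longrightarrow> comp t u q = comp t v q"
  shows "u = v"
proof (rule poly_mapping_eqI, rule poly_mapping_eqI)
  fix q m
  show "lookup (lookup u q) m = lookup (lookup v q) m"
  proof (cases "q \<in> \<Gamma> i")
    case True
    then show ?thesis using eq[OF True, of "m + umon (w q)"] keys_add_umon[of "w q" m]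
      by (simp add: comp_def)
  next
    case False
    then show ?thesis using u v by (simp add: lookup_free_on)
  qed
qed

lemma mono_vec_free_on: "mono_vec i t y \<in> free_on (\<Gamma> i)"
  unfolding mono_vec_def
  by (auto intro!: module.subspace_sum[OF module_fscale subspace_free_on] free_on_basis)

lemma comp_mono_vec:
  assumes "q \<in> \<Gamma> i" "w q \<subseteq> keys s"
  shows "comp s (mono_vec i t y) q = (if s = t then y q else 0)"
proof -
  have eq: "t - umon (w q) = s - umon (w q) \<longleftrightarrow> s = t" if "w q \<subseteq> keys t"
    using umon_le[OF that] umon_le[OF assms(2)] by metis
  have fin: "finite {q \<in> \<Gamma> i. w q \<subseteq> keys t}" using fin_gens by simp
  have "comp s (mono_vec i t y) q = lookup (\<Sum>r | r \<in> \<Gamma> i \<and> w r \<subseteq> keys t.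
      if r = q then single (t - umon (w q)) (y q) else 0) (s - umon (w q))"
    using assms unfolding comp_def mono_vec_def lookup_sum
    by (simp add: lookup_single when_def)
       (intro arg_cong2[where f=lookup] sum.cong refl, auto)
  also have "\<dots> = (if s = t then y q else 0)"
    using assms eq by (auto simp: fin lookup_single when_def)
  finally show ?thesis .
qed

text \<open>Preimages are found in each multidegree separately and added up. Only the finitely many
  multidegrees in \<open>T\<close> occur in \<open>v\<close>, which keeps the sum finite; elsewhere
  \<open>y = 0\<close> will do.\<close>

lemma image_bmapI:
  assumes v: "v \<in> free_on (\<Gamma> i)"
    and ex: "\<And>t. (\<exists>q\<in>\<Gamma> i. comp t v q \<noteq> 0) \<Longrightarrow> \<exists>y. \<forall>q\<in>\<Gamma> i. w q \<subseteq> keys t \<longrightarrow>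
      comp t v q = (\<Sum>u | u \<in> \<Gamma> (Suc i) \<and> w u \<subseteq> keys t. \<alpha> q u * y u)"
  shows "v \<in> bmap i ` free_on (\<Gamma> (Suc i))"
proof -
  define T where "T = (\<Union>q\<in>\<Gamma> i. (\<lambda>m. m + umon (w q)) ` keys (lookup v q))"
  have T: "finite T" using fin_gens by (simp add: T_def)
  have inT: "t \<in> T" if "q \<in> \<Gamma> i" "comp t v q \<noteq> 0" for t q
  proof -
    have "w q \<subseteq> keys t" using that(2) by (auto simp: comp_def split: if_splits)
    then have "t = (t - umon (w q)) + umon (w q)" "t - umon (w q) \<in> keys (lookup v q)"
      using that(2) umon_le[of "w q" t] by (auto simp: comp_def in_keys_iff split: if_splits)
    then show ?thesis using that(1) unfolding T_def by blast
  qed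
  have "\<forall>t. \<exists>y. \<forall>q\<in>\<Gamma> i. w q \<subseteq> keys t \<longrightarrow>
      comp t v q = (\<Sum>u | u \<in> \<Gamma> (Suc i) \<and> w u \<subseteq> keys t. \<alpha> q u * y u)"
  proof
    fix t
    show "\<exists>y. \<forall>q\<in>\<Gamma> i. w q \<subseteq> keys t \<longrightarrow>
      comp t v q = (\<Sum>u | u \<in> \<Gamma> (Suc i) \<and> w u \<subseteq> keys t. \<alpha> q u * y u)"
    proof (cases "\<exists>q\<in>\<Gamma> i. comp t v q \<noteq> 0")
      case False
      then show ?thesis by (intro exI[of _ "\<lambda>_. 0"]) simp
    qed (rule ex)
  qed
  then obtain y where y: "\<forall>t. \<forall>q\<in>\<Gamma> i. w q \<subseteq> keys t \<longrightarrow>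
      comp t v q = (\<Sum>u | u \<in> \<Gamma> (Suc i) \<and> w u \<subseteq> keys t. \<alpha> q u * y t u)"
    by (rule choice[THEN exE])
  define u where "u = (\<Sum>t\<in>T. mono_vec (Suc i) t (y t))"
  have u: "u \<in> free_on (\<Gamma> (Suc i))"
    unfolding u_def by (intro module.subspace_sum[OF module_fscale subspace_free_on] mono_vec_free_on)
  have "bmap i u = v"
  proof (rule eqI_comp[OF bmap_free_on v])
    fix t :: "'n \<Rightarrow>\<^sub>0 nat" and q assume q: "q \<in> \<Gamma> i" "w q \<subseteq> keys t"
    have "comp t u r = (if t \<in> T then y t r else 0)" if "r \<in> \<Gamma> (Suc i)" "w r \<subseteq> keys t" for r
      using that T by (simp add: u_def comp_sum comp_mono_vec)
    then have "comp t (bmap i u) q =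
       (\<Sum>r | r \<in> \<Gamma> (Suc i) \<and> w r \<subseteq> keys t. \<alpha> q r * (if t \<in> T then y t r else 0))"
      unfolding comp_bmap_strand[OF u q] by (intro sum.cong) auto
    also have "\<dots> = comp t v q"
    proof (cases "t \<in> T")
      case True
      then show ?thesis using y q by simp
    next
      case False
      then show ?thesis using inT[OF q(1), of t] by auto
    qed
    finally show "comp t (bmap i u) q = comp t v q" .
  qed
  then show ?thesis using u by blast
qed

lemma bmap_bmap:
  assumes v: "v \<in> free_on (\<Gamma> (Suc (Suc i)))"
  shows "bmap i (bmap (Suc i) v) = 0"
proof (rule eqI_comp[OF bmap_free_on])
  show "0 \<in> free_on (\<Gamma> i)" by (simp add: free_on_def)
  fix t :: "'n \<Rightarrow>\<^sub>0 nat" and p assume p: "p \<in> \<Gamma> i" "w p \<subseteq> keys t"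
  have zero: "\<alpha> q u * comp t v u = 0"
    if "q \<in> \<Gamma> (Suc i)" "\<not> w q \<subseteq> keys t" "u \<in> \<Gamma> (Suc (Suc i))" for q u
    using coeff_psubset[OF that(1,3)] that(2) by (auto simp: comp_def)
  have "comp t (bmap i (bmap (Suc i) v)) p = (\<Sum>q\<in>\<Gamma> (Suc i). \<alpha> p q * comp t (bmap (Suc i) v) q)"
    by (rule comp_bmap[OF bmap_free_on p])
  also have "\<dots> = (\<Sum>q\<in>\<Gamma> (Suc i). \<Sum>u\<in>\<Gamma> (Suc (Suc i)). \<alpha> p q * \<alpha> q u * comp t v u)"
  proof (rule sum.cong[OF refl])
    fix q assume q: "q \<in> \<Gamma> (Suc i)"
    show "\<alpha> p q * comp t (bmap (Suc i) v) q = (\<Sum>u\<in>\<Gamma> (Suc (Suc i)). \<alpha> p q * \<alpha> q u * comp t v u)"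
    proof (cases "w q \<subseteq> keys t")
      case True
      then show ?thesis using comp_bmap[OF v q True] by (simp add: sum_distrib_left mult.assoc)
    next
      case False
      then have "(\<Sum>u\<in>\<Gamma> (Suc (Suc i)). \<alpha> p q * (\<alpha> q u * comp t v u)) = 0"
        using zero[OF q False] by (intro sum.neutral) simp
      then show ?thesis using False by (simp add: comp_def[of t "bmap (Suc i) v"] mult.assoc)
    qed
  qed
  also have "\<dots> = (\<Sum>u\<in>\<Gamma> (Suc (Suc i)). (\<Sum>q\<in>\<Gamma> (Suc i). \<alpha> p q * \<alpha> q u) * comp t v u)"
    by (subst sum.swap) (simp add: sum_distrib_right)
  also have "\<dots> = comp t 0 p" using coeff_coeff[OF p(1)] by (simp add: comp_def)
  finally show "comp t (bmap i (bmap (Suc i) v)) p = comp t 0 p" .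
qed

lemma image_bmap_Suc:
  "bmap (Suc i) ` free_on (\<Gamma> (Suc (Suc i))) = {v \<in> free_on (\<Gamma> (Suc i)). bmap i v = 0}"
proof (intro equalityI subsetI)
  fix v assume "v \<in> {v \<in> free_on (\<Gamma> (Suc i)). bmap i v = 0}"
  then have v: "v \<in> free_on (\<Gamma> (Suc i))" "bmap i v = 0" by auto
  show "v \<in> bmap (Suc i) ` free_on (\<Gamma> (Suc (Suc i)))"
  proof (rule image_bmapI[OF v(1)], rule strands_exact)
    fix t :: "'n \<Rightarrow>\<^sub>0 nat" and p assume p: "p \<in> \<Gamma> i" "w p \<subseteq> keys t"
    show "(\<Sum>q | q \<in> \<Gamma> (Suc i) \<and> w q \<subseteq> keys t. \<alpha> p q * comp t v q) = 0"
      using comp_bmap_strand[OF v(1) p] v(2) by simp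
  qed
qed (auto simp: bmap_free_on bmap_bmap)

lemma image_bmap_0:
  "bmap 0 ` free_on (\<Gamma> (Suc 0)) = {v \<in> free_on (\<Gamma> 0). lookup v g0 \<in> aug_ideal}"
proof (intro equalityI subsetI)
  fix v assume "v \<in> bmap 0 ` free_on (\<Gamma> (Suc 0))"
  then obtain u where u: "v = bmap 0 u" "u \<in> free_on (\<Gamma> (Suc 0))" by auto
  have sub: "module.subspace (*) aug_ideal"
    unfolding aug_ideal_def by (rule subspace_squarefree_ideal)
  have ent: "entry g0 q \<in> aug_ideal" if "q \<in> \<Gamma> (Suc 0)" for q
    using that keys_add_umon[of "w q" 0] by (auto simp: aug_ideal_def entry_def gens_0)
  have "lookup v g0 \<in> aug_ideal"
    unfolding u(1) lookup_bmap[OF u(2)] using gens_0 ent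
    by (auto intro!: module.subspace_sum[OF module_mult sub] module.subspace_scale[OF module_mult sub])
  then show "v \<in> {v \<in> free_on (\<Gamma> 0). lookup v g0 \<in> aug_ideal}"
    using u bmap_free_on by simp
next
  fix v assume v: "v \<in> {v \<in> free_on (\<Gamma> 0). lookup v g0 \<in> aug_ideal}"
  show "v \<in> bmap 0 ` free_on (\<Gamma> (Suc 0))"
  proof (rule image_bmapI)
    show "v \<in> free_on (\<Gamma> 0)" using v by simp
    fix t assume "\<exists>q\<in>\<Gamma> 0. comp t v q \<noteq> 0"
    then have "t \<in> keys (lookup v g0)"
      by (simp add: gens_0 comp_def umon_eq_0_iff[THEN iffD2] in_keys_iff)
    then obtain u where u: "u \<in> \<Gamma> (Suc 0)" "w u \<subseteq> keys t"
      using v by (auto simp: aug_ideal_def)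
    \<comment> \<open>One generator whose monomial divides that of \<open>t\<close> suffices,
      because its coefficient under the augmentation is invertible.\<close>
    let ?y = "\<lambda>r. if r = u then comp t v g0 / \<alpha> g0 u else 0"
    have "(\<Sum>r | r \<in> \<Gamma> (Suc 0) \<and> w r \<subseteq> keys t. \<alpha> g0 r * ?y r) = comp t v g0"
      using u coeff_aug[OF u(1)] fin_gens by (simp add: if_distrib cong: if_cong)
    then show "\<exists>y. \<forall>q\<in>\<Gamma> 0. w q \<subseteq> keys t \<longrightarrow>
      comp t v q = (\<Sum>u | u \<in> \<Gamma> (Suc 0) \<and> w u \<subseteq> keys t. \<alpha> q u * y u)"
      by (intro exI[of _ ?y]) (simp add: gens_0)
  qed
qed

lemma resolution_res: "resolution aug_ideal (\<lambda>i. free_on (\<Gamma> i)) bmap (\<lambda>v. lookup v g0)"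
  unfolding resolution_def
proof (intro conjI allI)
  show "module_hom fscale fscale (bmap i)" for i unfolding bmap_def by (rule lin_ext_hom)
  show "module_hom fscale (*) (\<lambda>v. lookup v g0)"
    by (simp add: module_hom_iff module_fscale module_mult lookup_add lookup_fscale)
  show "\<exists>v\<in>free_on (\<Gamma> 0). a - lookup v g0 \<in> aug_ideal" for a
    by (rule bexI[of _ "single g0 a"]) (auto simp: aug_ideal_def free_on_def gens_0)
qed (use image_bmap_0 image_bmap_Suc in \<open>simp_all add: subspace_free_on\<close>)

lemma lookup_bmap_basis:
  assumes "q \<in> \<Gamma> (Suc i)"
  shows "lookup (bmap i (single q 1)) p = (if p \<in> \<Gamma> i then entry p q else 0)"
  using assms by (simp add: bmap_def lookup_sum lookup_single when_def fin_gens)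

text \<open>The inclusion in \<open>coeff_psubset\<close> is strict, so every nonzero entry is a
  nonconstant monomial; its degree is the difference of the two cardinalities.\<close>

lemma minimal_res: "minimal_graded_free_resolution aug_ideal res"
  unfolding minimal_graded_free_resolution_def graded_free_resolution_def
proof (intro conjI allI ballI)
  show "finite (gens res i)" for i by (simp add: res_def fin_gens)
  show "resolution aug_ideal (\<lambda>i. free_on (gens res i)) (diff res) (aug res)"
    using resolution_res by (simp add: res_def)
next
  fix i q p m assume q: "q \<in> gens res (Suc i)"
    and m: "m \<in> keys (lookup (diff res i (single q 1)) p)"
  then have p: "p \<in> \<Gamma> i" "q \<in> \<Gamma> (Suc i)" "m \<in> keys (entry p q)"
    by (auto simp: res_def lookup_bmap_basis split: if_splits)
  then have "\<alpha> p q \<noteq> 0" "m = umon (w q - w p)" by (auto simp: entry_def split: if_splits)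
  moreover have "card (w q - w p) + card (w p) = card (w q)"
    using coeff_psubset[OF p(1,2)] calculation by (metis card_Diff_subset card_mono finite le_add_diff_inverse2 psubset_imp_subset)
  ultimately show "int (mdeg m) + shift res i p = shift res (Suc i) q"
    by (simp add: res_def mdeg_umon flip: of_nat_add)
next
  fix p m assume "p \<in> gens res 0" "m \<in> keys (aug res (single p 1))"
  then show "int (mdeg m) = shift res 0 p"
    by (auto simp: res_def gens_0 mdeg_def)
next
  fix i q p assume "q \<in> gens res (Suc i)"
  then show "const_coeff (lookup (diff res i (single q 1)) p) = 0"
    using coeff_psubset[of p i q]
    by (auto simp: res_def lookup_bmap_basis const_coeff_def entry_def lookup_single when_def umon_eq_0_iff)
qed

end

section \<open>Homogeneous elements\<close>

definition hpart :: "('m \<Rightarrow> int) \<Rightarrow> int \<Rightarrow> ('m \<Rightarrow>\<^sub>0 'k::comm_ring_1) \<Rightarrow> ('m \<Rightarrow>\<^sub>0 'k)" where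
  "hpart \<gamma> t a = (\<Sum>m | m \<in> keys a \<and> \<gamma> m = t. single m (lookup a m))"

lemma lookup_hpart: "lookup (hpart \<gamma> t a) m = (if \<gamma> m = t then lookup a m else 0)"
proof -
  have "lookup (hpart \<gamma> t a) m =
    (\<Sum>x | x \<in> keys a \<and> \<gamma> x = t. if x = m then lookup a m else 0)"
    unfolding hpart_def lookup_sum lookup_single when_def by (intro sum.cong) auto
  then show ?thesis by (auto simp: in_keys_iff)
qed

lemma keys_hpart: "keys (hpart \<gamma> t a) = {m \<in> keys a. \<gamma> m = t}"
  by (auto simp: in_keys_iff lookup_hpart split: if_splits)

lemma hpart_add: "hpart \<gamma> t (a + b) = hpart \<gamma> t a + hpart \<gamma> t b"
  by (rule poly_mapping_eqI) (simp add: lookup_hpart lookup_add)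

lemma hpart_diff: "hpart \<gamma> t (a - b) = hpart \<gamma> t a - hpart \<gamma> t b"
  by (rule poly_mapping_eqI) (simp add: lookup_hpart lookup_minus)

lemma hpart_zero [simp]: "hpart \<gamma> t 0 = 0"
  by (rule poly_mapping_eqI) (simp add: lookup_hpart)

lemma hpart_sum: "hpart \<gamma> t (\<Sum>x\<in>X. f x) = (\<Sum>x\<in>X. hpart \<gamma> t (f x))"
  by (induction X rule: infinite_finite_induct) (auto simp: hpart_add)

definition additive_grading :: "('m::comm_monoid_add \<Rightarrow> int) \<Rightarrow> bool" where
  "additive_grading \<gamma> \<longleftrightarrow> (\<forall>a b. \<gamma> (a + b) = \<gamma> a + \<gamma> b)"

lemma hpart_eq_self: "(\<And>m. m \<in> keys a \<Longrightarrow> \<gamma> m = t) \<Longrightarrow> hpart \<gamma> t a = a"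
  by (rule poly_mapping_eqI) (auto simp: lookup_hpart in_keys_iff)

lemma hpart_eq_0: "(\<And>m. m \<in> keys a \<Longrightarrow> \<gamma> m \<noteq> t) \<Longrightarrow> hpart \<gamma> t a = 0"
  by (rule poly_mapping_eqI) (auto simp: lookup_hpart in_keys_iff)

lemma hpart_mult_homogeneous:
  fixes a b :: "'m::comm_monoid_add \<Rightarrow>\<^sub>0 'k::comm_ring_1"
  assumes \<gamma>: "additive_grading \<gamma>" and b: "\<And>m. m \<in> keys b \<Longrightarrow> \<gamma> m = t0"
  shows "hpart \<gamma> t (a * b) = hpart \<gamma> (t - t0) a * b"
proof -
  let ?h = "hpart \<gamma> (t - t0) a"
  have "a * b = ?h * b + (a - ?h) * b" by (simp flip: distrib_right)
  then have "hpart \<gamma> t (a * b) = hpart \<gamma> t (?h * b) + hpart \<gamma> t ((a - ?h) * b)" by (simp only: hpart_add)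
  also have "hpart \<gamma> t (?h * b) = ?h * b"
  proof (rule hpart_eq_self)
    fix m assume "m \<in> keys (?h * b)"
    then obtain x y where "m = x + y" "x \<in> keys ?h" "y \<in> keys b"
      using Poly_Mapping.keys_mult by blast
    then show "\<gamma> m = t" using \<gamma> b by (simp add: additive_grading_def keys_hpart)
  qed
  also have "hpart \<gamma> t ((a - ?h) * b) = 0"
  proof (rule hpart_eq_0)
    fix m assume "m \<in> keys ((a - ?h) * b)"
    then obtain x y where xy: "m = x + y" "x \<in> keys (a - ?h)" "y \<in> keys b"
      using Poly_Mapping.keys_mult by blast
    then have "\<gamma> x \<noteq> t - t0" by (auto simp: in_keys_iff lookup_minus lookup_hpart split: if_splits)
    then show "\<gamma> m \<noteq> t" using xy \<gamma> b[of y] by (simp add: additive_grading_def)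
  qed
  finally show ?thesis by simp
qed

definition homog :: "('m \<Rightarrow> int) \<Rightarrow> (nat \<Rightarrow> int) \<Rightarrow> int \<Rightarrow> (nat \<Rightarrow>\<^sub>0 ('m \<Rightarrow>\<^sub>0 'k::comm_ring_1)) \<Rightarrow> bool" where
  "homog \<gamma> s t v \<longleftrightarrow> (\<forall>p. \<forall>m\<in>keys (lookup v p). \<gamma> m + s p = t)"

definition vpart :: "('m \<Rightarrow> int) \<Rightarrow> (nat \<Rightarrow> int) \<Rightarrow> int \<Rightarrow> (nat \<Rightarrow>\<^sub>0 ('m \<Rightarrow>\<^sub>0 'k::comm_ring_1)) \<Rightarrow> ('m, 'k) vec" where
  "vpart \<gamma> s t v = (\<Sum>p\<in>keys v. single p (hpart \<gamma> (t - s p) (lookup v p)))"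

lemma lookup_vpart: "lookup (vpart \<gamma> s t v) p = hpart \<gamma> (t - s p) (lookup v p)"
proof -
  have "lookup (vpart \<gamma> s t v) p =
    (\<Sum>x\<in>keys v. if x = p then hpart \<gamma> (t - s p) (lookup v p) else 0)"
    unfolding vpart_def lookup_sum lookup_single when_def by (intro sum.cong) auto
  then show ?thesis by (simp add: in_keys_iff)
qed

lemma homog_vpart: "homog \<gamma> s t (vpart \<gamma> s t v)"
  by (simp add: homog_def lookup_vpart keys_hpart)

lemma vpart_eq_self: "homog \<gamma> s t v \<Longrightarrow> vpart \<gamma> s t v = v"
  by (rule poly_mapping_eqI) (simp add: lookup_vpart homog_def eq_diff_eq hpart_eq_self)

lemma vpart_free_on: "v \<in> free_on B \<Longrightarrow> vpart \<gamma> s t v \<in> free_on B"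
  by (rule free_onI) (simp add: lookup_vpart lookup_free_on)

lemma homog_zero [simp]: "homog \<gamma> s t 0"
  by (simp add: homog_def)

lemma homog_add: "homog \<gamma> s t u \<Longrightarrow> homog \<gamma> s t v \<Longrightarrow> homog \<gamma> s t (u + v)"
  unfolding homog_def
proof (intro allI ballI)
  fix p m assume *: "\<forall>p. \<forall>m\<in>keys (lookup u p). \<gamma> m + s p = t"
    "\<forall>p. \<forall>m\<in>keys (lookup v p). \<gamma> m + s p = t"
    and "m \<in> keys (lookup (u + v) p)"
  then have "m \<in> keys (lookup u p) \<or> m \<in> keys (lookup v p)"
    using Poly_Mapping.keys_add[of "lookup u p" "lookup v p"] by (auto simp: lookup_add)
  then show "\<gamma> m + s p = t" using * by blast
qed

lemma homog_diff: "homog \<gamma> s t u \<Longrightarrow> homog \<gamma> s t v \<Longrightarrow> homog \<gamma> s t (u - v)"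
proof -
  assume "homog \<gamma> s t u" "homog \<gamma> s t v"
  moreover from this have "homog \<gamma> s t (- v)" by (simp add: homog_def in_keys_iff)
  ultimately show ?thesis using homog_add[of \<gamma> s t u "- v"] by simp
qed

lemma homog_sum: "(\<And>x. x \<in> X \<Longrightarrow> homog \<gamma> s t (f x)) \<Longrightarrow> homog \<gamma> s t (\<Sum>x\<in>X. f x)"
  by (induction X rule: infinite_finite_induct) (auto intro: homog_add)

lemma homog_fscale:
  fixes v :: "nat \<Rightarrow>\<^sub>0 ('m::comm_monoid_add \<Rightarrow>\<^sub>0 'k::comm_ring_1)"
  assumes \<gamma>: "additive_grading \<gamma>" and "\<And>m. m \<in> keys a \<Longrightarrow> \<gamma> m = t - t0" "homog \<gamma> s t0 v"
  shows "homog \<gamma> s t (fscale a v)"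
  unfolding homog_def lookup_fscale
proof (intro allI ballI)
  fix p m assume "m \<in> keys (a * lookup v p)"
  then obtain x y where "m = x + y" "x \<in> keys a" "y \<in> keys (lookup v p)"
    using Poly_Mapping.keys_mult by blast
  moreover from this have "\<gamma> x = t - t0" "\<gamma> y + s p = t0" using assms by (simp_all add: homog_def)
  ultimately show "\<gamma> m + s p = t" using \<gamma> by (simp add: additive_grading_def)
qed

text \<open>
  A graded map from \<open>free_on B\<close>, whose basis element \<open>q\<close> has degree \<open>s q\<close>, to the submodule
  \<open>N\<close> of the module whose basis element \<open>p\<close> has degree \<open>s' p\<close>.
\<close>

definition gmap :: "('m::comm_monoid_add \<Rightarrow> int) \<Rightarrow> nat set \<Rightarrow> (nat \<Rightarrow> int) \<Rightarrow>
    (nat \<Rightarrow>\<^sub>0 ('m \<Rightarrow>\<^sub>0 'k::comm_ring_1)) set \<Rightarrow> (nat \<Rightarrow> int) \<Rightarrow>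
    (('m, 'k) vec \<Rightarrow> ('m, 'k) vec) \<Rightarrow> bool" where
  "gmap \<gamma> B s N s' f \<longleftrightarrow> module_hom fscale fscale f \<and>
     (\<forall>q\<in>B. f (single q 1) \<in> N \<and> homog \<gamma> s' (s q) (f (single q 1)))"

lemma gmap_into:
  assumes "gmap \<gamma> B s N s' f" "module.subspace fscale N" "v \<in> free_on B"
  shows "f v \<in> N"
  by (rule hom_free_into_subspace[OF _ assms(2) _ assms(3)]) (use assms(1) in \<open>simp_all add: gmap_def\<close>)

lemma gmap_homog:
  assumes \<gamma>: "additive_grading \<gamma>" and f: "gmap \<gamma> B s N s' f" and v: "v \<in> free_on B" "homog \<gamma> s t v"
  shows "homog \<gamma> s' t (f v)"
proof -
  have f': "module_hom fscale fscale f" using f by (simp add: gmap_def)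
  show ?thesis unfolding hom_expand[OF f', of v]
    using f v by (intro homog_sum homog_fscale[OF \<gamma>, where ?t0.0="s _"])
      (auto simp: homog_def gmap_def free_on_def algebra_simps)
qed

text \<open>The images of basis elements are homogeneous, so only one homogeneous part of each
  coefficient contributes to degree \<open>t\<close>. Hence a preimage of a homogeneous element may
  be replaced by its part of the same degree.\<close>

lemma vpart_gmap:
  fixes f :: "(nat \<Rightarrow>\<^sub>0 ('m::comm_monoid_add \<Rightarrow>\<^sub>0 'k::comm_ring_1)) \<Rightarrow> _"
  assumes \<gamma>: "additive_grading \<gamma>" and f: "gmap \<gamma> B s N s' f" and v: "v \<in> free_on B"
  shows "vpart \<gamma> s' t (f v) = f (vpart \<gamma> s t v)"
proof -
  have f': "module_hom fscale fscale f" using f by (simp add: gmap_def)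
  have eq: "f u = (\<Sum>q\<in>keys v. fscale (lookup u q) (f (single q 1)))"
    if "keys u \<subseteq> keys v" for u
    unfolding hom_expand[OF f', of u] using that by (intro sum.mono_neutral_left) (auto simp: in_keys_iff)
  have sub: "keys (vpart \<gamma> s t v) \<subseteq> keys v"
    by (auto simp: in_keys_iff lookup_vpart)
  show ?thesis
  proof (rule poly_mapping_eqI)
    fix p
    have "lookup (vpart \<gamma> s' t (f v)) p =
      (\<Sum>q\<in>keys v. hpart \<gamma> (t - s' p) (lookup v q * lookup (f (single q 1)) p))"
      unfolding lookup_vpart eq[OF order_refl] by (simp add: lookup_sum lookup_fscale hpart_sum)
    also have "\<dots> = (\<Sum>q\<in>keys v. hpart \<gamma> (t - s q) (lookup v q) * lookup (f (single q 1)) p)"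
    proof (rule sum.cong[OF refl])
      fix q assume "q \<in> keys v"
      then have "homog \<gamma> s' (s q) (f (single q 1))"
        using f v by (auto simp: gmap_def free_on_def)
      then show "hpart \<gamma> (t - s' p) (lookup v q * lookup (f (single q 1)) p) =
         hpart \<gamma> (t - s q) (lookup v q) * lookup (f (single q 1)) p"
        by (subst hpart_mult_homogeneous[OF \<gamma>, of _ "s q - s' p"]) (auto simp: homog_def algebra_simps)
    qed
    also have "\<dots> = lookup (f (vpart \<gamma> s t v)) p"
      unfolding eq[OF sub] by (simp add: lookup_sum lookup_fscale lookup_vpart)
    finally show "lookup (vpart \<gamma> s' t (f v)) p = lookup (f (vpart \<gamma> s t v)) p" .
  qed
qed

text \<open>Graded maps out of a free module are prescribed on the basis. The relation
  \<open>R\<close> stays abstract so that lifts and homotopies are built by the same choice.\<close>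

lemma gmap_from_choice:
  assumes "\<And>q. q \<in> B \<Longrightarrow> \<exists>y\<in>N. homog \<gamma> s' (s q) y \<and> R q y"
  shows "\<exists>f. gmap \<gamma> B s N s' f \<and> (\<forall>q\<in>B. R q (f (single q 1)))"
proof -
  have "\<forall>q\<in>B. \<exists>y. y \<in> N \<and> homog \<gamma> s' (s q) y \<and> R q y" using assms by blast
  then obtain c where c: "\<forall>q\<in>B. c q \<in> N \<and> homog \<gamma> s' (s q) (c q) \<and> R q (c q)" by (rule bchoice[THEN exE])
  then show ?thesis
    by (intro exI[of _ "lin_ext c"]) (simp add: gmap_def lin_ext_hom)
qed

section \<open>Comparison of resolutions\<close>

text \<open>
  The comparison theorem is stated for an arbitrary additive grading \<open>\<gamma>\<close> of the monomials. The trivial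
  grading makes every map homogeneous, which covers ungraded projective resolutions; the source is
  then the free module containing the projective one, with the differential precomposed by the
  projection.
\<close>

definition graded_source :: "('m::comm_monoid_add \<Rightarrow> int) \<Rightarrow> ('m \<Rightarrow>\<^sub>0 'k::comm_ring_1) set \<Rightarrow>
    (nat \<Rightarrow> nat set) \<Rightarrow> (nat \<Rightarrow> nat \<Rightarrow> int) \<Rightarrow> (nat \<Rightarrow> ('m, 'k) vec \<Rightarrow> ('m, 'k) vec) \<Rightarrow>
    (('m, 'k) vec \<Rightarrow> ('m \<Rightarrow>\<^sub>0 'k)) \<Rightarrow> bool" where
  "graded_source \<gamma> K B s D \<epsilon> \<longleftrightarrow>
     (\<forall>i. gmap \<gamma> (B (Suc i)) (s (Suc i)) (free_on (B i)) (s i) (D i)) \<and>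
     module_hom fscale (*) \<epsilon> \<and>
     (\<forall>q\<in>B 0. \<forall>m\<in>keys (\<epsilon> (single q 1)). \<gamma> m = s 0 q) \<and>
     (\<forall>v\<in>free_on (B 1). \<epsilon> (D 0 v) \<in> K) \<and>
     (\<forall>i. \<forall>v\<in>free_on (B (Suc (Suc i))). D i (D (Suc i) v) = 0)"

text \<open>Besides exactness, homogeneous elements are required to have homogeneous preimages,
  which is the form used in lifting. The counterpart \<open>graded_source\<close> asks for a complex
  of free modules, not for exactness.\<close>

definition graded_target :: "('m::comm_monoid_add \<Rightarrow> int) \<Rightarrow> ('m \<Rightarrow>\<^sub>0 'k::comm_ring_1) set \<Rightarrow>
    (nat \<Rightarrow> ('m, 'k) vec set) \<Rightarrow> (nat \<Rightarrow> nat \<Rightarrow> int) \<Rightarrow>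
    (nat \<Rightarrow> ('m, 'k) vec \<Rightarrow> ('m, 'k) vec) \<Rightarrow>
    (('m, 'k) vec \<Rightarrow> ('m \<Rightarrow>\<^sub>0 'k)) \<Rightarrow> bool" where
  "graded_target \<gamma> K P s D \<epsilon> \<longleftrightarrow> resolution K P D \<epsilon> \<and>
     (\<forall>t a. (\<forall>m\<in>keys a. \<gamma> m = t) \<longrightarrow> (\<exists>y\<in>P 0. homog \<gamma> (s 0) t y \<and> a - \<epsilon> y \<in> K)) \<and>
     (\<forall>t. \<forall>x\<in>P 0. homog \<gamma> (s 0) t x \<longrightarrow> \<epsilon> x \<in> K \<longrightarrow> (\<exists>y\<in>P 1. homog \<gamma> (s 1) t y \<and> D 0 y = x)) \<and>
     (\<forall>i t. \<forall>x\<in>P (Suc i). homog \<gamma> (s (Suc i)) t x \<longrightarrow> D i x = 0 \<longrightarrow>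
        (\<exists>y\<in>P (Suc (Suc i)). homog \<gamma> (s (Suc (Suc i))) t y \<and> D (Suc i) y = x))"

lemma resolution_homs:
  assumes "resolution K P D \<epsilon>"
  shows "module_hom fscale fscale (D i)" "module_hom fscale (*) \<epsilon>" "module.subspace fscale (P i)"
  using assms by (simp_all add: resolution_def)

lemma resolution_surj:
  assumes "resolution K P D \<epsilon>" shows "\<exists>v\<in>P 0. a - \<epsilon> v \<in> K"
  using assms by (simp add: resolution_def)

lemma resolution_cycles:
  assumes "resolution K P D \<epsilon>"
  shows "x \<in> P 0 \<Longrightarrow> \<epsilon> x \<in> K \<Longrightarrow> \<exists>y\<in>P 1. D 0 y = x"
    and "x \<in> P (Suc i) \<Longrightarrow> D i x = 0 \<Longrightarrow> \<exists>y\<in>P (Suc (Suc i)). D (Suc i) y = x"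
proof -
  have 0: "D 0 ` P 1 = {v \<in> P 0. \<epsilon> v \<in> K}" and S: "D (Suc i) ` P (Suc (Suc i)) = {v \<in> P (Suc i). D i v = 0}" for i
    using assms by (simp_all add: resolution_def)
  show "\<exists>y\<in>P 1. D 0 y = x" if "x \<in> P 0" "\<epsilon> x \<in> K"
  proof -
    have "x \<in> D 0 ` P 1" unfolding 0 using that by simp
    then show ?thesis by blast
  qed
  show "\<exists>y\<in>P (Suc (Suc i)). D (Suc i) y = x" if "x \<in> P (Suc i)" "D i x = 0"
  proof -
    have "x \<in> D (Suc i) ` P (Suc (Suc i))" unfolding S using that by simp
    then show ?thesis by blast
  qed
qed

lemma resolution_boundaries:
  assumes "resolution K P D \<epsilon>"
  shows "y \<in> P 1 \<Longrightarrow> \<epsilon> (D 0 y) \<in> K" "y \<in> P (Suc (Suc i)) \<Longrightarrow> D i (D (Suc i) y) = 0"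
    "y \<in> P (Suc i) \<Longrightarrow> D i y \<in> P i"
proof -
  have 0: "D 0 ` P 1 = {v \<in> P 0. \<epsilon> v \<in> K}" and S: "D (Suc i) ` P (Suc (Suc i)) = {v \<in> P (Suc i). D i v = 0}" for i
    using assms by (simp_all add: resolution_def)
  show "\<epsilon> (D 0 y) \<in> K" if "y \<in> P 1" using that 0 by auto
  show "D i (D (Suc i) y) = 0" if "y \<in> P (Suc (Suc i))" using that S by auto
  show "D i y \<in> P i" if "y \<in> P (Suc i)"
  proof (cases i)
    case 0
    then show ?thesis using that \<open>D 0 ` P 1 = _\<close> by auto
  next
    case (Suc j)
    then show ?thesis using that S[of j] by auto
  qed
qed

lemma homog_trivial: "homog (\<lambda>_. 0) (\<lambda>_. 0) t v \<longleftrightarrow> t = 0 \<or> v = 0"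
proof
  assume h: "homog (\<lambda>_. 0) (\<lambda>_. 0) t v"
  show "t = 0 \<or> v = 0"
  proof (rule ccontr)
    assume n: "\<not> (t = 0 \<or> v = 0)"
    then have "lookup v p = 0" for p
    proof (rule_tac ccontr)
      assume "lookup v p \<noteq> 0"
      then have "\<exists>m. m \<in> keys (lookup v p)"
        by (metis in_keys_iff poly_mapping_eqI lookup_zero)
      then show False using h n by (auto simp: homog_def)
    qed
    then show False using n poly_mapping_eqI[of v 0] by simp
  qed
qed (auto simp: homog_def)

lemma additive_grading_trivial: "additive_grading (\<lambda>_. 0)"
  by (simp add: additive_grading_def)

text \<open>In degree 0 every vector is homogeneous, which gives ordinary exactness. The conditions
  in degrees \<open>t \<noteq> 0\<close> concern the zero vector alone and are met by zero.\<close>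

lemma graded_target_trivial:
  assumes R: "resolution K P D \<epsilon>"
  shows "graded_target (\<lambda>_. 0) K P (\<lambda>_ _. 0) D \<epsilon>"
proof -
  have z: "0 \<in> P i" for i
    using resolution_homs(3)[OF R, of i] by (simp add: module.subspace_def[OF module_fscale])
  have D0: "D i 0 = 0" for i using resolution_homs(1)[OF R, of i] by (rule module_hom.zero)
  have "\<exists>y\<in>P 0. homog (\<lambda>_. 0) (\<lambda>_. 0) t y \<and> a - \<epsilon> y \<in> K" if a: "\<forall>m\<in>keys a. 0 = t" for t a
  proof (cases "t = 0")
    case True
    then show ?thesis using R by (simp add: resolution_def homog_trivial)
  next
    case False
    then have "keys a = {}" using a by auto
    then have "a = 0" by simp
    have "\<epsilon> 0 = 0" using resolution_homs(2)[OF R] by (rule module_hom.zero)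
    moreover have "0 \<in> K" using resolution_boundaries(1)[OF R z] D0 calculation by simp
    ultimately show ?thesis using \<open>a = 0\<close> z by (intro bexI[of _ 0]) (auto simp: homog_trivial)
  qed
  moreover have "\<exists>y\<in>P 1. homog (\<lambda>_. 0) (\<lambda>_. 0) t y \<and> D 0 y = x"
    if "x \<in> P 0" "homog (\<lambda>_. 0) (\<lambda>_. 0) t x" "\<epsilon> x \<in> K" for t x
    using resolution_cycles(1)[OF R that(1,3)] that(2) z D0 unfolding homog_trivial by metis
  moreover have "\<exists>y\<in>P (Suc (Suc i)). homog (\<lambda>_. 0) (\<lambda>_. 0) t y \<and> D (Suc i) y = x"
    if "x \<in> P (Suc i)" "homog (\<lambda>_. 0) (\<lambda>_. 0) t x" "D i x = 0" for t x i
    using resolution_cycles(2)[OF R that(1,3)] that(2) z D0 unfolding homog_trivial by metis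
  ultimately show ?thesis using R unfolding graded_target_def by simp
qed

lemma additive_mdeg: "additive_grading (\<lambda>m. int (mdeg m))"
  by (simp add: additive_grading_def mdeg_def lookup_add sum.distrib)

lemma vpart_aug:
  fixes \<epsilon> :: "(nat \<Rightarrow>\<^sub>0 ('m::comm_monoid_add \<Rightarrow>\<^sub>0 'k::comm_ring_1)) \<Rightarrow> _"
  assumes \<gamma>: "additive_grading \<gamma>" and e: "module_hom fscale (*) \<epsilon>" and v: "v \<in> free_on B"
    and h: "\<And>q m. q \<in> B \<Longrightarrow> m \<in> keys (\<epsilon> (single q 1)) \<Longrightarrow> \<gamma> m = s q"
  shows "\<epsilon> (vpart \<gamma> s t v) = hpart \<gamma> t (\<epsilon> v)"
proof -
  have sub: "keys (vpart \<gamma> s t v) \<subseteq> keys v"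
    by (auto simp: in_keys_iff lookup_vpart)
  have "\<epsilon> (vpart \<gamma> s t v) = (\<Sum>q\<in>keys v. lookup (vpart \<gamma> s t v) q * \<epsilon> (single q 1))"
    unfolding hom_expand[OF e, of "vpart \<gamma> s t v"] using sub
    by (intro sum.mono_neutral_left) (auto simp: in_keys_iff)
  also have "\<dots> = (\<Sum>q\<in>keys v. hpart \<gamma> t (lookup v q * \<epsilon> (single q 1)))"
    using v h by (intro sum.cong refl) (subst hpart_mult_homogeneous[OF \<gamma>, of _ "s _"], auto simp: lookup_vpart free_on_def)
  also have "\<dots> = hpart \<gamma> t (\<epsilon> v)"
    by (simp add: hom_expand[OF e, of v] hpart_sum)
  finally show ?thesis .
qed

text \<open>Preimages are cut down to homogeneous parts by \<open>vpart_gmap\<close> and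
  \<open>vpart_aug\<close>. For the augmentation the congruence modulo \<open>K\<close> survives
  this because \<open>K\<close> contains the homogeneous parts of its elements.\<close>

lemma graded_target_free:
  fixes F :: "('n::finite, 'k::field) graded_free"
  assumes F: "graded_free_resolution K F" and K: "\<And>t a. a \<in> K \<Longrightarrow> hpart (\<lambda>m. int (mdeg m)) t a \<in> K"
  shows "graded_target (\<lambda>m. int (mdeg m)) K (\<lambda>i. free_on (gens F i)) (shift F) (diff F) (aug F)"
    (is ?target)
    and "graded_source (\<lambda>m. int (mdeg m)) K (gens F) (shift F) (diff F) (aug F)" (is ?source)
proof -
  let ?\<gamma> = "\<lambda>m :: 'n \<Rightarrow>\<^sub>0 nat. int (mdeg m)"
  have R: "resolution K (\<lambda>i. free_on (gens F i)) (diff F) (aug F)"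
    and hD: "\<And>i q p m. q \<in> gens F (Suc i) \<Longrightarrow> m \<in> keys (lookup (diff F i (single q 1)) p)
       \<Longrightarrow> int (mdeg m) + shift F i p = shift F (Suc i) q"
    and hA: "\<And>p m. p \<in> gens F 0 \<Longrightarrow> m \<in> keys (aug F (single p 1)) \<Longrightarrow> int (mdeg m) = shift F 0 p"
    using F unfolding graded_free_resolution_def by blast+
  have D: "gmap ?\<gamma> (gens F (Suc i)) (shift F (Suc i)) (free_on (gens F i)) (shift F i) (diff F i)" for i
    unfolding gmap_def homog_def using resolution_homs(1)[OF R] hD
    by (auto intro!: resolution_boundaries(3)[OF R] free_on_basis)
  show ?source
    unfolding graded_source_def
  proof (intro conjI allI ballI D)
    show "module_hom fscale (*) (aug F)" using resolution_homs(2)[OF R] .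
    show "aug F (diff F 0 v) \<in> K" if "v \<in> free_on (gens F 1)" for v
      using resolution_boundaries(1)[OF R that] .
    show "diff F i (diff F (Suc i) v) = 0" if "v \<in> free_on (gens F (Suc (Suc i)))" for i v
      using resolution_boundaries(2)[OF R that] .
  qed (use hA in auto)
  show ?target
    unfolding graded_target_def
  proof (intro conjI allI ballI impI R)
    fix t and a :: "('n, 'k) mpoly" assume a: "\<forall>m\<in>keys a. int (mdeg m) = t"
    obtain y where y: "y \<in> free_on (gens F 0)" "a - aug F y \<in> K"
      using resolution_surj[OF R, of a] by blast
    have "hpart ?\<gamma> t (a - aug F y) = a - aug F (vpart ?\<gamma> (shift F 0) t y)"
      using a by (subst vpart_aug[OF additive_mdeg resolution_homs(2)[OF R] y(1) hA])
        (simp_all add: hpart_diff hpart_eq_self)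
    then have "a - aug F (vpart ?\<gamma> (shift F 0) t y) \<in> K" using K[OF y(2), of t] by simp
    then show "\<exists>y\<in>free_on (gens F 0). homog ?\<gamma> (shift F 0) t y \<and> a - aug F y \<in> K"
      using vpart_free_on[OF y(1)] homog_vpart by blast
  next
    have *: "\<exists>y\<in>free_on (gens F (Suc i)). homog ?\<gamma> (shift F (Suc i)) t y \<and> diff F i y = x"
      if x: "homog ?\<gamma> (shift F i) t x" and y: "y \<in> free_on (gens F (Suc i))" "diff F i y = x" for i t x y
    proof -
      have "diff F i (vpart ?\<gamma> (shift F (Suc i)) t y) = x"
        using vpart_gmap[OF additive_mdeg D y(1), of t] vpart_eq_self[OF x] y(2) by simp
      then show ?thesis using vpart_free_on[OF y(1)] homog_vpart by blast
    qed
    fix t x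
    show "\<exists>y\<in>free_on (gens F 1). homog ?\<gamma> (shift F 1) t y \<and> diff F 0 y = x"
      if x: "x \<in> free_on (gens F 0)" "homog ?\<gamma> (shift F 0) t x" "aug F x \<in> K"
    proof -
      obtain y where "y \<in> free_on (gens F 1)" "diff F 0 y = x"
        using resolution_cycles(1)[OF R x(1,3)] by blast
      then show ?thesis using *[OF x(2), of y] by simp
    qed
    show "\<exists>y\<in>free_on (gens F (Suc (Suc i))). homog ?\<gamma> (shift F (Suc (Suc i))) t y \<and> diff F (Suc i) y = x"
      if x: "x \<in> free_on (gens F (Suc i))" "homog ?\<gamma> (shift F (Suc i)) t x" "diff F i x = 0" for i
    proof -
      obtain y where "y \<in> free_on (gens F (Suc (Suc i)))" "diff F (Suc i) y = x"
        using resolution_cycles(2)[OF R x(1,3)] by blast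
      then show ?thesis using *[OF x(2), of y] by simp
    qed
  qed
qed

text \<open>The differentials land in the modules \<open>P i\<close>, on which
  \<open>\<pi> i\<close> is the identity; precomposing with the projections therefore still gives a
  complex, now of free modules.\<close>

lemma graded_source_trivial:
  fixes K :: "('m::comm_monoid_add \<Rightarrow>\<^sub>0 'k::comm_ring_1) set"
  assumes R: "resolution K P D \<epsilon>"
    and \<pi>: "\<And>i. module_hom fscale fscale (\<pi> i)" "\<And>i v. v \<in> free_on (B i) \<Longrightarrow> \<pi> i v \<in> P i"
      "\<And>i v. v \<in> P i \<Longrightarrow> v \<in> free_on (B i) \<and> \<pi> i v = v"
  shows "graded_source (\<lambda>_. 0) K B (\<lambda>_ _. 0) (\<lambda>i. D i \<circ> \<pi> (Suc i)) (\<epsilon> \<circ> \<pi> 0)"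
  unfolding graded_source_def
proof (intro conjI allI ballI)
  note Rb = resolution_boundaries[OF R]
  show "gmap (\<lambda>_. 0) (B (Suc i)) (\<lambda>_. 0) (free_on (B i)) (\<lambda>_. 0) (D i \<circ> \<pi> (Suc i))" for i
  proof -
    have "D i (\<pi> (Suc i) (single q 1)) \<in> free_on (B i)" if "q \<in> B (Suc i)" for q
      using \<pi>(3)[OF Rb(3)[OF \<pi>(2)[OF free_on_basis[OF that]]]] by simp
    then show ?thesis
      by (simp add: gmap_def homog_trivial module_hom_compose[OF \<pi>(1) resolution_homs(1)[OF R]])
  qed
  show "module_hom fscale (*) (\<epsilon> \<circ> \<pi> 0)"
    by (rule module_hom_compose[OF \<pi>(1) resolution_homs(2)[OF R]])
  show "(\<epsilon> \<circ> \<pi> 0) ((D 0 \<circ> \<pi> (Suc 0)) v) \<in> K" if v: "v \<in> free_on (B 1)" for v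
  proof -
    have P: "\<pi> (Suc 0) v \<in> P 1" using v \<pi>(2)[of v 1] by simp
    then have "D 0 (\<pi> (Suc 0) v) \<in> P 0" using Rb(3)[of _ 0] by simp
    then show ?thesis using \<pi>(3) Rb(1)[OF P] by simp
  qed
  show "(D i \<circ> \<pi> (Suc i)) ((D (Suc i) \<circ> \<pi> (Suc (Suc i))) v) = 0" if "v \<in> free_on (B (Suc (Suc i)))" for i v
    using \<pi>(2)[OF that] \<pi>(3) Rb(2,3) by simp
qed simp

lemma hom_diff_scalar:
  "module_hom fscale s f \<Longrightarrow> module_hom fscale s g \<Longrightarrow> module_hom fscale s (\<lambda>v. f v - g v)"
  by (simp add: module_hom_iff module.scale_right_diff_distrib)

theorem chain_lift:
  fixes K :: "('m::comm_monoid_add \<Rightarrow>\<^sub>0 'k::comm_ring_1) set"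
  assumes \<gamma>: "additive_grading \<gamma>" and K: "module.subspace (*) K"
    and S: "graded_source \<gamma> K B s D \<epsilon>" and T: "graded_target \<gamma> K P s' D' \<epsilon>'"
  obtains f where "\<And>i. gmap \<gamma> (B i) (s i) (P i) (s' i) (f i)"
    "\<And>v. v \<in> free_on (B 0) \<Longrightarrow> \<epsilon>' (f 0 v) - \<epsilon> v \<in> K"
    "\<And>i v. v \<in> free_on (B (Suc i)) \<Longrightarrow> D' i (f (Suc i) v) = f i (D i v)"
proof -
  have SD: "gmap \<gamma> (B (Suc i)) (s (Suc i)) (free_on (B i)) (s i) (D i)" for i
    using S by (simp add: graded_source_def)
  have SDh: "module_hom fscale fscale (D i)" for i using SD[of i] by (simp add: gmap_def)
  have SD_in: "D i v \<in> free_on (B i)" if "v \<in> free_on (B (Suc i))" for i v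
    using gmap_into[OF SD subspace_free_on that] .
  have SDD: "D i (D (Suc i) v) = 0" if "v \<in> free_on (B (Suc (Suc i)))" for i v
    using S that by (simp add: graded_source_def)
  have R: "resolution K P D' \<epsilon>'" using T by (simp add: graded_target_def)
  note homs = resolution_homs[OF R]
  \<comment> \<open>A partial lift must send boundaries to cycles, or the next component cannot be
    chosen. In position 0 this follows from compatibility with the augmentations, which is recorded
    instead.\<close>
  define Q where "Q n f \<longleftrightarrow> gmap \<gamma> (B n) (s n) (P n) (s' n) f \<and>
     (case n of 0 \<Rightarrow> \<forall>v\<in>free_on (B 0). \<epsilon>' (f v) - \<epsilon> v \<in> K
      | Suc k \<Rightarrow> \<forall>v\<in>free_on (B (Suc n)). D' k (f (D n v)) = 0)" for n f
  have "\<exists>f. \<forall>n. Q n (f n) \<and> (\<forall>v\<in>free_on (B (Suc n)). D' n (f (Suc n) v) = f n (D n v))"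
  proof (rule dependent_nat_choice)
    have eh: "module_hom fscale (*) \<epsilon>" using S by (simp add: graded_source_def)
    have "\<exists>f. gmap \<gamma> (B 0) (s 0) (P 0) (s' 0) f \<and>
       (\<forall>q\<in>B 0. \<epsilon> (single q 1) - \<epsilon>' (f (single q 1)) \<in> K)"
    proof (rule gmap_from_choice)
      fix q assume "q \<in> B 0"
      then have "\<forall>m\<in>keys (\<epsilon> (single q 1)). \<gamma> m = s 0 q"
        using S by (simp add: graded_source_def)
      then show "\<exists>y\<in>P 0. homog \<gamma> (s' 0) (s 0 q) y \<and> \<epsilon> (single q 1) - \<epsilon>' y \<in> K"
        using T by (simp add: graded_target_def)
    qed
    then obtain f where f: "gmap \<gamma> (B 0) (s 0) (P 0) (s' 0) f"
       "\<forall>q\<in>B 0. \<epsilon> (single q 1) - \<epsilon>' (f (single q 1)) \<in> K" by blast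
    have hd: "module_hom fscale (*) (\<lambda>v. \<epsilon>' (f v) - \<epsilon> v)"
      using module_hom_compose[of fscale fscale f "(*)" \<epsilon>'] homs(2) f(1)
      by (intro hom_diff_scalar eh) (simp add: gmap_def o_def)
    have "\<epsilon>' (f v) - \<epsilon> v \<in> K" if "v \<in> free_on (B 0)" for v
    proof (rule hom_free_into_subspace[OF hd K _ that])
      fix q assume "q \<in> B 0"
      then have "- (\<epsilon> (single q 1) - \<epsilon>' (f (single q 1))) \<in> K"
        using f(2) by (intro module.subspace_neg[OF module_mult K]) simp
      then show "\<epsilon>' (f (single q 1)) - \<epsilon> (single q 1) \<in> K" by simp
    qed
    then show "\<exists>f. Q 0 f" using f(1) by (auto simp: Q_def)
  next
    fix f n assume f: "Q n f"
    then have fg: "gmap \<gamma> (B n) (s n) (P n) (s' n) f" by (simp add: Q_def)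
    have "\<exists>f'. gmap \<gamma> (B (Suc n)) (s (Suc n)) (P (Suc n)) (s' (Suc n)) f' \<and>
       (\<forall>q\<in>B (Suc n). D' n (f' (single q 1)) = f (D n (single q 1)))"
    proof (rule gmap_from_choice)
      fix q assume q: "q \<in> B (Suc n)"
      let ?e = "single q 1 :: nat \<Rightarrow>\<^sub>0 ('m \<Rightarrow>\<^sub>0 'k)"
      have e: "?e \<in> free_on (B (Suc n))" using q by (rule free_on_basis)
      have x: "f (D n ?e) \<in> P n" "homog \<gamma> (s' n) (s (Suc n) q) (f (D n ?e))"
        using gmap_into[OF fg homs(3) SD_in[OF e]]
          gmap_homog[OF \<gamma> fg SD_in[OF e]] SD[of n] q by (auto simp: gmap_def)
      show "\<exists>y\<in>P (Suc n). homog \<gamma> (s' (Suc n)) (s (Suc n) q) y \<and> D' n y = f (D n ?e)"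
      proof (cases n)
        case 0
        have "\<epsilon>' (f (D 0 ?e)) - \<epsilon> (D 0 ?e) \<in> K" using f 0 SD_in[OF e] by (simp add: Q_def)
        moreover have "\<epsilon> (D 0 ?e) \<in> K" using S e 0 by (simp add: graded_source_def)
        ultimately have "\<epsilon>' (f (D 0 ?e)) \<in> K"
          using module.subspace_add[OF module_mult K] by fastforce
        then show ?thesis using T x 0 by (simp add: graded_target_def)
      next
        case (Suc k)
        then have "D' k (f (D n ?e)) = 0" using f e by (simp add: Q_def)
        then show ?thesis using T x Suc by (simp add: graded_target_def)
      qed
    qed
    then obtain f' where f': "gmap \<gamma> (B (Suc n)) (s (Suc n)) (P (Suc n)) (s' (Suc n)) f'"
       "\<forall>q\<in>B (Suc n). D' n (f' (single q 1)) = f (D n (single q 1))" by blast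
    have comm: "D' n (f' v) = f (D n v)" if "v \<in> free_on (B (Suc n))" for v
    proof (rule hom_eq_on_free[OF _ _ _ that])
      show "module_hom fscale fscale (\<lambda>v. D' n (f' v))"
        using module_hom_compose[OF _ homs(1), of fscale f' n] f'(1) by (simp add: gmap_def o_def)
      show "module_hom fscale fscale (\<lambda>v. f (D n v))"
        using module_hom_compose[OF SDh[of n], of fscale f] fg by (simp add: gmap_def o_def)
    qed (use f'(2) in simp)
    moreover have "f 0 = 0" using fg by (auto simp: gmap_def intro: module_hom.zero)
    ultimately have "Q (Suc n) f'" using f'(1) SDD SD_in by (simp add: Q_def)
    then show "\<exists>f'. Q (Suc n) f' \<and> (\<forall>v\<in>free_on (B (Suc n)). D' n (f' v) = f (D n v))"
      using comm by blast
  qed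
  then obtain f where f: "\<forall>n. Q n (f n) \<and> (\<forall>v\<in>free_on (B (Suc n)). D' n (f (Suc n) v) = f n (D n v))"
    by (rule exE)
  show ?thesis
  proof (rule that)
    show "gmap \<gamma> (B i) (s i) (P i) (s' i) (f i)" for i using f by (simp add: Q_def)
    show "\<epsilon>' (f 0 v) - \<epsilon> v \<in> K" if "v \<in> free_on (B 0)" for v
      using f[rule_format, of 0] that by (simp add: Q_def)
    show "D' i (f (Suc i) v) = f i (D i v)" if "v \<in> free_on (B (Suc i))" for i v
      using f that by simp
  qed
qed

theorem null_homotopy:
  fixes K :: "('m::comm_monoid_add \<Rightarrow>\<^sub>0 'k::comm_ring_1) set"
  assumes \<gamma>: "additive_grading \<gamma>"
    and S: "graded_source \<gamma> K B s D \<epsilon>" and T: "graded_target \<gamma> K P s' D' \<epsilon>'"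
    and u: "\<And>i. gmap \<gamma> (B i) (s i) (P i) (s' i) (u i)"
    and u0: "\<And>v. v \<in> free_on (B 0) \<Longrightarrow> \<epsilon>' (u 0 v) \<in> K"
    and uD: "\<And>i v. v \<in> free_on (B (Suc i)) \<Longrightarrow> D' i (u (Suc i) v) = u i (D i v)"
  obtains h where "\<And>i. gmap \<gamma> (B i) (s i) (P (Suc i)) (s' (Suc i)) (h i)"
    "\<And>v. v \<in> free_on (B 0) \<Longrightarrow> u 0 v = D' 0 (h 0 v)"
    "\<And>i v. v \<in> free_on (B (Suc i)) \<Longrightarrow> u (Suc i) v = D' (Suc i) (h (Suc i) v) + h i (D i v)"
proof -
  have SD: "gmap \<gamma> (B (Suc i)) (s (Suc i)) (free_on (B i)) (s i) (D i)" for i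
    using S by (simp add: graded_source_def)
  have SDh: "module_hom fscale fscale (D i)" for i using SD[of i] by (simp add: gmap_def)
  have SD_in: "D i v \<in> free_on (B i)" if "v \<in> free_on (B (Suc i))" for i v
    using gmap_into[OF SD subspace_free_on that] .
  have SDD: "D i (D (Suc i) v) = 0" if "v \<in> free_on (B (Suc (Suc i)))" for i v
    using S that by (simp add: graded_source_def)
  have R: "resolution K P D' \<epsilon>'" using T by (simp add: graded_target_def)
  note homs = resolution_homs[OF R]
  have uh: "module_hom fscale fscale (u i)" for i using u[of i] by (simp add: gmap_def)
  have D'diff: "D' i (x - y) = D' i x - D' i y" for i x y using homs(1)[of i] by (rule module_hom.diff)
  \<comment> \<open>To continue, \<open>u - h D\<close> must take values in cycles. This holds since
    \<open>D' u = u D\<close>, and \<open>D' h D = u D\<close> by the homotopy identity at an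
    element that \<open>D\<close> kills.\<close>
  define Q where "Q n h \<longleftrightarrow> gmap \<gamma> (B n) (s n) (P (Suc n)) (s' (Suc n)) h \<and>
     (n = 0 \<longrightarrow> (\<forall>v\<in>free_on (B 0). u 0 v = D' 0 (h v))) \<and>
     (\<forall>v\<in>free_on (B (Suc n)). D' n (u (Suc n) v - h (D n v)) = 0)" for n h
  have "\<exists>h. \<forall>n. Q n (h n) \<and> (\<forall>v\<in>free_on (B (Suc n)). u (Suc n) v = D' (Suc n) (h (Suc n) v) + h n (D n v))"
  proof (rule dependent_nat_choice)
    have "\<exists>h. gmap \<gamma> (B 0) (s 0) (P 1) (s' 1) h \<and>
       (\<forall>q\<in>B 0. D' 0 (h (single q 1)) = u 0 (single q 1))"
    proof (rule gmap_from_choice)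
      fix q assume q: "q \<in> B 0"
      then show "\<exists>y\<in>P 1. homog \<gamma> (s' 1) (s 0 q) y \<and> D' 0 y = u 0 (single q 1)"
        using T u[of 0] u0[OF free_on_basis[OF q]] by (simp add: graded_target_def gmap_def)
    qed
    then obtain h where h: "gmap \<gamma> (B 0) (s 0) (P 1) (s' 1) h"
       "\<forall>q\<in>B 0. D' 0 (h (single q 1)) = u 0 (single q 1)" by blast
    have eq: "u 0 v = D' 0 (h v)" if "v \<in> free_on (B 0)" for v
    proof (rule hom_eq_on_free[OF uh _ _ that])
      show "module_hom fscale fscale (\<lambda>v. D' 0 (h v))"
        using module_hom_compose[OF _ homs(1), of fscale h 0] h(1) by (simp add: gmap_def o_def)
    qed (use h(2) in simp)
    then have "D' 0 (u (Suc 0) v - h (D 0 v)) = 0" if "v \<in> free_on (B (Suc 0))" for v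
      using SD_in[OF that] uD[OF that] by (simp add: D'diff)
    then show "\<exists>h. Q 0 h" using h(1) eq by (auto simp: Q_def)
  next
    fix h n assume h: "Q n h"
    then have hg: "gmap \<gamma> (B n) (s n) (P (Suc n)) (s' (Suc n)) h" by (simp add: Q_def)
    have hh: "module_hom fscale fscale (\<lambda>v. u (Suc n) v - h (D n v))"
      using module_hom_compose[OF SDh[of n], of fscale h] hg
      by (intro hom_diff_scalar uh) (simp add: gmap_def o_def)
    have "\<exists>h'. gmap \<gamma> (B (Suc n)) (s (Suc n)) (P (Suc (Suc n))) (s' (Suc (Suc n))) h' \<and>
       (\<forall>q\<in>B (Suc n). D' (Suc n) (h' (single q 1)) =
          u (Suc n) (single q 1) - h (D n (single q 1)))"
    proof (rule gmap_from_choice)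
      fix q assume q: "q \<in> B (Suc n)"
      let ?e = "single q 1 :: nat \<Rightarrow>\<^sub>0 ('m \<Rightarrow>\<^sub>0 'k)"
      have e: "?e \<in> free_on (B (Suc n))" using q by (rule free_on_basis)
      have "h (D n ?e) \<in> P (Suc n)" "homog \<gamma> (s' (Suc n)) (s (Suc n) q) (h (D n ?e))"
        using gmap_into[OF hg homs(3) SD_in[OF e]]
          gmap_homog[OF \<gamma> hg SD_in[OF e]] SD[of n] q by (auto simp: gmap_def)
      moreover have "u (Suc n) ?e \<in> P (Suc n)" "homog \<gamma> (s' (Suc n)) (s (Suc n) q) (u (Suc n) ?e)"
        using u[of "Suc n"] q by (auto simp: gmap_def)
      ultimately have "u (Suc n) ?e - h (D n ?e) \<in> P (Suc n)"
         "homog \<gamma> (s' (Suc n)) (s (Suc n) q) (u (Suc n) ?e - h (D n ?e))"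
        using module.subspace_diff[OF module_fscale homs(3)] by (auto intro: homog_diff)
      moreover have "D' n (u (Suc n) ?e - h (D n ?e)) = 0" using h e by (simp add: Q_def)
      ultimately show "\<exists>y\<in>P (Suc (Suc n)). homog \<gamma> (s' (Suc (Suc n))) (s (Suc n) q) y \<and>
          D' (Suc n) y = u (Suc n) ?e - h (D n ?e)"
        using T by (simp add: graded_target_def)
    qed
    then obtain h' where h': "gmap \<gamma> (B (Suc n)) (s (Suc n)) (P (Suc (Suc n))) (s' (Suc (Suc n))) h'"
       "\<forall>q\<in>B (Suc n). D' (Suc n) (h' (single q 1)) =
          u (Suc n) (single q 1) - h (D n (single q 1))" by blast
    have eq: "D' (Suc n) (h' v) = u (Suc n) v - h (D n v)" if "v \<in> free_on (B (Suc n))" for v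
    proof (rule hom_eq_on_free[OF _ hh _ that])
      show "module_hom fscale fscale (\<lambda>v. D' (Suc n) (h' v))"
        using module_hom_compose[OF _ homs(1), of fscale h' "Suc n"] h'(1) by (simp add: gmap_def o_def)
    qed (use h'(2) in simp)
    have "h 0 = 0" using hg by (auto simp: gmap_def intro: module_hom.zero)
    then have "D' (Suc n) (u (Suc (Suc n)) v - h' (D (Suc n) v)) = 0" if "v \<in> free_on (B (Suc (Suc n)))" for v
      using SD_in[OF that] SDD[OF that] uD[OF that] by (simp add: D'diff eq)
    then have "Q (Suc n) h'" using h'(1) by (simp add: Q_def)
    then show "\<exists>h'. Q (Suc n) h' \<and> (\<forall>v\<in>free_on (B (Suc n)). u (Suc n) v = D' (Suc n) (h' v) + h (D n v))"
      using eq by (intro exI[of _ h']) simp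
  qed
  then obtain h where h: "\<forall>n. Q n (h n) \<and> (\<forall>v\<in>free_on (B (Suc n)). u (Suc n) v = D' (Suc n) (h (Suc n) v) + h n (D n v))"
    by (rule exE)
  show ?thesis
  proof (rule that)
    show "gmap \<gamma> (B i) (s i) (P (Suc i)) (s' (Suc i)) (h i)" for i using h by (simp add: Q_def)
    show "u 0 v = D' 0 (h 0 v)" if "v \<in> free_on (B 0)" for v
      using h[rule_format, of 0] that by (simp add: Q_def)
    show "u (Suc i) v = D' (Suc i) (h (Suc i) v) + h i (D i v)" if "v \<in> free_on (B (Suc i))" for i v
      using h that by simp
  qed
qed

section \<open>Reduction modulo the variables\<close>

text \<open>Exponents are natural numbers, so a product of monomials is constant only if both
  factors are.\<close>

lemma const_coeff_mult: "const_coeff (a * b) = const_coeff a * const_coeff b"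
  for a b :: "('n, 'k::comm_ring_1) mpoly"
proof -
  define a' where "a' = a - single 0 (const_coeff a)"
  have a: "a = single 0 (const_coeff a) + a'" by (simp add: a'_def)
  have "0 \<notin> keys (a' * b)"
  proof
    assume "0 \<in> keys (a' * b)"
    then obtain x y where xy: "0 = x + y" "x \<in> keys a'"
      using Poly_Mapping.keys_mult by blast
    have "lookup (x + y) i = 0" for i by (simp flip: xy(1))
    then have "x = 0" by (intro poly_mapping_eqI) (simp add: lookup_add)
    then show False using xy(2) by (simp add: a'_def in_keys_iff lookup_minus const_coeff_def)
  qed
  then have "const_coeff (a' * b) = 0" by (simp add: const_coeff_def in_keys_iff)
  moreover have "const_coeff (single 0 c * b) = c * const_coeff b" for c
    by (simp add: const_coeff_def flip: mult_map_scale_conv_mult) (simp add: Poly_Mapping.map.rep_eq when_def)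
  ultimately show ?thesis
    by (subst a) (simp add: distrib_right const_coeff_def lookup_add)
qed

definition red :: "(nat \<Rightarrow>\<^sub>0 ('n, 'k::comm_ring_1) mpoly) \<Rightarrow> (nat \<Rightarrow>\<^sub>0 'k)" where
  "red v = Poly_Mapping.map const_coeff v"

definition residue :: "((nat \<Rightarrow>\<^sub>0 ('n, 'k::comm_ring_1) mpoly) \<Rightarrow> (nat \<Rightarrow>\<^sub>0 ('n, 'k) mpoly)) \<Rightarrow> (nat \<Rightarrow>\<^sub>0 'k) \<Rightarrow> (nat \<Rightarrow>\<^sub>0 'k)" where
  "residue f w = red (f (Poly_Mapping.map (single 0) w))"

lemma lookup_red: "lookup (red v) p = const_coeff (lookup v p)"
  by (simp add: red_def Poly_Mapping.map.rep_eq when_def const_coeff_def)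

lemma lookup_const_vec:
  "lookup (Poly_Mapping.map (single 0) w) p = single 0 (lookup w p)"
  by (simp add: Poly_Mapping.map.rep_eq when_def)

lemma red_add: "red (u + v) = red u + red v"
  by (rule poly_mapping_eqI) (simp add: lookup_red lookup_add const_coeff_def)

lemma red_diff: "red (u - v) = red u - red v"
  by (rule poly_mapping_eqI) (simp add: lookup_red lookup_minus const_coeff_def)

lemma red_zero [simp]: "red 0 = 0"
  by (rule poly_mapping_eqI) (simp add: lookup_red const_coeff_def)

lemma red_fscale: "red (fscale a v) = fscale (const_coeff a) (red v)"
  by (rule poly_mapping_eqI) (simp add: lookup_red lookup_fscale const_coeff_mult)

lemma red_sum: "red (\<Sum>x\<in>X. f x) = (\<Sum>x\<in>X. red (f x))"
  by (induction X rule: infinite_finite_induct) (auto simp: red_add)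

lemma red_const_vec: "red (Poly_Mapping.map (single 0) w) = w"
  by (rule poly_mapping_eqI) (simp add: lookup_red lookup_const_vec const_coeff_def)

text \<open>A linear map preserves the vectors whose entries have no constant term, so it descends
  to the reductions. The descended map is \<open>residue f\<close>, and functoriality
  follows.\<close>

lemma red_hom:
  assumes f: "module_hom fscale fscale f"
  shows "red (f v) = lin_ext (\<lambda>q. red (f (single q 1))) (red v)"
proof -
  have "red (f v) = (\<Sum>q\<in>keys v. fscale (lookup (red v) q) (red (f (single q 1))))"
    by (simp add: hom_expand[OF f, of v] red_sum red_fscale lookup_red)
  also have "\<dots> = lin_ext (\<lambda>q. red (f (single q 1))) (red v)"
    by (rule lin_ext_superset[symmetric]) (auto simp: in_keys_iff lookup_red const_coeff_def)
  finally show ?thesis .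
qed

lemma residue_eq:
  assumes "module_hom fscale fscale f"
  shows "residue f = lin_ext (\<lambda>q. red (f (single q 1)))"
  unfolding residue_def by (rule ext, subst red_hom[OF assms]) (simp only: red_const_vec)

lemma residue_hom: "module_hom fscale fscale f \<Longrightarrow> module_hom fscale fscale (residue f)"
  by (simp add: residue_eq lin_ext_hom)

lemma red_eq_residue: "module_hom fscale fscale f \<Longrightarrow> red (f v) = residue f (red v)"
  by (subst red_hom) (simp_all add: residue_eq)

lemma residue_comp:
  assumes "module_hom fscale fscale f"
  shows "residue (\<lambda>v. f (g v)) w = residue f (residue g w)"
  unfolding residue_def[of "\<lambda>v. f (g v)"] red_eq_residue[OF assms] residue_def[of g] ..

lemma residue_diff_eq: "residue_diff F i = residue (diff F i)"
  by (rule ext) (simp add: residue_diff_def residue_def red_def)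

lemma const_vec_free_on: "w \<in> free_on B \<Longrightarrow> Poly_Mapping.map (single 0) w \<in> free_on B"
  by (rule free_onI) (simp add: lookup_const_vec lookup_free_on)

text \<open>A nonzero constant entry joins basis elements of equal degree, so every set of degrees
  is preserved. The predicate \<open>S\<close> treats all of Tor and a single degree of it
  alike.\<close>

lemma residue_into:
  fixes f :: "(nat \<Rightarrow>\<^sub>0 ('n::finite, 'k::comm_ring_1) mpoly) \<Rightarrow> _"
  assumes f: "gmap (\<lambda>m. int (mdeg m)) B s (free_on B') s' f" and w: "w \<in> free_on {q \<in> B. S (s q)}"
  shows "residue f w \<in> free_on {p \<in> B'. S (s' p)}"
proof -
  have fh: "module_hom fscale fscale f" using f by (simp add: gmap_def)
  show ?thesis
  proof (rule hom_free_into_subspace[OF residue_hom[OF fh] subspace_free_on _ w])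
    fix q assume q: "q \<in> {q \<in> B. S (s q)}"
    let ?v = "f (single q 1)"
    have v: "?v \<in> free_on B'" "homog (\<lambda>m. int (mdeg m)) s' (s q) ?v" using f q by (auto simp: gmap_def)
    have deg: "s' p = s q" if "lookup (red ?v) p \<noteq> 0" for p
      using v(2) that by (force simp: lookup_red const_coeff_def homog_def in_keys_iff mdeg_def)
    have "red ?v \<in> free_on {p \<in> B'. S (s' p)}"
    proof (intro free_onI, rule ccontr)
      fix p assume p: "p \<notin> {p \<in> B'. S (s' p)}" and nz: "lookup (red ?v) p \<noteq> 0"
      have "p \<in> B'" using nz lookup_free_on[OF v(1), of p] unfolding lookup_red const_coeff_def
        by (metis lookup_zero)
      then show False using p q deg[OF nz] by simp
    qed
    then show "residue f (single q 1) \<in> free_on {p \<in> B'. S (s' p)}"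
      by (simp add: residue_eq[OF fh])
  qed
qed

lemma basis_span:
  fixes v :: "nat \<Rightarrow>\<^sub>0 'k::field"
  assumes "v \<in> free_on X"
  shows "v \<in> module.span fscale ((\<lambda>q. single q 1) ` X)"
proof -
  have "module_hom fscale fscale (\<lambda>v :: nat \<Rightarrow>\<^sub>0 'k. v)" by (simp add: module_hom_iff module_fscale)
  then show ?thesis
    by (rule hom_free_into_subspace[OF _ module.subspace_span[OF module_fscale] _ assms])
       (auto intro: module.span_base[OF module_fscale])
qed

text \<open>The map \<open>f\<close> identifies the quotient of \<open>Z\<close> by
  \<open>Bd\<close> with \<open>free_on Y\<close>, and \<open>g\<close> is a section. A basis of
  \<open>Bd\<close> and the images under \<open>g\<close> of the standard basis together form a
  basis of \<open>Z\<close>; the additive form suits the subtraction of natural numbers in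
  \<open>homology_dim\<close>.\<close>

lemma dim_extension_by_section:
  fixes Z Bd :: "(nat \<Rightarrow>\<^sub>0 'k::field) set"
  assumes Bd: "module.subspace fscale Bd" "Bd \<subseteq> Z" and Z: "module.subspace fscale Z" "Z \<subseteq> free_on X" "finite X"
    and Y: "finite Y" and f: "module_hom fscale fscale f" and g: "module_hom fscale fscale g"
    and fZ: "\<And>z. z \<in> Z \<Longrightarrow> f z \<in> free_on Y" and gY: "\<And>y. y \<in> free_on Y \<Longrightarrow> g y \<in> Z"
    and f0: "\<And>z. z \<in> Bd \<Longrightarrow> f z = 0" and fg: "\<And>y. y \<in> free_on Y \<Longrightarrow> f (g y) = y"
    and gf: "\<And>z. z \<in> Z \<Longrightarrow> z - g (f z) \<in> Bd"
  shows "vector_space.dim fscale Z = vector_space.dim fscale Bd + card Y"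
proof -
  interpret vs: vector_space "fscale :: 'k \<Rightarrow> _" by (rule vector_space_fscale)
  interpret f: module_hom fscale fscale f by fact
  interpret g: module_hom fscale fscale g by fact
  let ?e = "\<lambda>q. single q (1::'k)"
  obtain b where b: "b \<subseteq> Bd" "vs.independent b" "Bd \<subseteq> vs.span b" "card b = vs.dim Bd"
    by (rule vs.basis_exists)
  have "b \<subseteq> vs.span (?e ` X)" using b(1) Bd(2) Z(2) basis_span by blast
  then have finb: "finite b" using vs.independent_span_bound[OF _ b(2)] Z(3) by blast
  let ?G = "(\<lambda>q. g (?e q)) ` Y"
  have fge: "f (g (?e q)) = ?e q" if "q \<in> Y" for q by (rule fg) (simp add: free_on_basis that)
  have inj: "inj_on (\<lambda>q. g (?e q)) Y"
  proof (rule inj_onI)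
    fix p q assume "p \<in> Y" "q \<in> Y" "g (?e p) = g (?e q)"
    then have "?e p = ?e q" using fge by metis
    then have "lookup (?e p) p = lookup (?e q) p" by simp
    then show "p = q" by (simp add: lookup_single when_def split: if_splits)
  qed
  have disj: "b \<inter> ?G = {}"
  proof (rule ccontr)
    assume "b \<inter> ?G \<noteq> {}"
    then obtain q where q: "q \<in> Y" "g (?e q) \<in> b" by auto
    then have "?e q = 0" using f0 b(1) fge by (metis subsetD)
    then have "lookup (?e q) q = 0" by simp
    then show False by simp
  qed
  have ind: "vs.independent (b \<union> ?G)"
  proof (rule ccontr)
    assume "\<not> vs.independent (b \<union> ?G)"
    then obtain u where u: "\<exists>v\<in>b \<union> ?G. u v \<noteq> 0" "(\<Sum>v\<in>b \<union> ?G. fscale (u v) v) = 0"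
      using vs.dependent_finite[of "b \<union> ?G"] finb Y by auto
    have s: "(\<Sum>v\<in>b. fscale (u v) v) + (\<Sum>q\<in>Y. fscale (u (g (?e q))) (g (?e q))) = 0"
      using u(2) finb Y disj by (simp add: sum.union_disjoint sum.reindex[OF inj])
    have "f ((\<Sum>v\<in>b. fscale (u v) v) + (\<Sum>q\<in>Y. fscale (u (g (?e q))) (g (?e q)))) = 0"
      unfolding s by (rule f.zero)
    moreover have "(\<Sum>v\<in>b. fscale (u v) (f v)) = 0" using f0 b(1) by (intro sum.neutral) auto
    ultimately have "(\<Sum>q\<in>Y. fscale (u (g (?e q))) (?e q)) = 0"
      by (simp add: f.add f.sum f.scale fge)
    then have 0: "lookup (\<Sum>q\<in>Y. fscale (u (g (?e q))) (?e q)) p = 0" for p by simp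
    have uG: "u (g (?e p)) = 0" if "p \<in> Y" for p
    proof -
      have "lookup (\<Sum>q\<in>Y. fscale (u (g (?e q))) (?e q)) p = (\<Sum>q\<in>Y. if q = p then u (g (?e p)) else 0)"
        unfolding lookup_sum lookup_fscale lookup_single when_def by (intro sum.cong) auto
      then show ?thesis using that Y 0 by simp
    qed
    then have "(\<Sum>v\<in>b. fscale (u v) v) = 0" using s by simp
    then have "u v = 0" if "v \<in> b" for v
      using vs.dependent_finite[OF finb] b(2) that by blast
    then show False using u(1) uG by auto
  qed
  have span: "Z \<subseteq> vs.span (b \<union> ?G)"
  proof
    fix z assume z: "z \<in> Z"
    have "z - g (f z) \<in> vs.span (b \<union> ?G)" using gf[OF z] b(3) vs.span_mono[of b "b \<union> ?G"] by auto
    moreover have "g (f z) \<in> vs.span (b \<union> ?G)"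
      by (rule hom_free_into_subspace[OF g vs.subspace_span _ fZ[OF z]]) (auto intro: vs.span_base)
    ultimately have "(z - g (f z)) + g (f z) \<in> vs.span (b \<union> ?G)" by (rule vs.span_add)
    then show "z \<in> vs.span (b \<union> ?G)" by simp
  qed
  have "b \<union> ?G \<subseteq> Z" using b(1) Bd(2) gY[OF free_on_basis] by (intro Un_least) auto
  then have "vs.dim Z = card (b \<union> ?G)" using span ind by (intro vs.dim_unique) auto
  also have "\<dots> = card b + card Y"
    using card_Un_disjoint[OF finb _ disj] Y card_image[OF inj] by simp
  finally show ?thesis using b(4) by simp
qed

section \<open>Tor and projective dimension from a minimal resolution\<close>

lemma residue_zero_of_minimal:
  assumes "\<And>q p. q \<in> B \<Longrightarrow> const_coeff (lookup (f (single q 1)) p) = 0"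
    and f: "module_hom fscale fscale f" and w: "w \<in> free_on B"
  shows "residue f w = 0"
proof -
  have "red (f (single q 1)) = 0" if "q \<in> B" for q
    by (rule poly_mapping_eqI) (simp add: lookup_red assms(1)[OF that])
  moreover have "keys w \<subseteq> B" using w by (simp add: free_on_def)
  ultimately show ?thesis unfolding residue_eq[OF f] lin_ext_def by (intro sum.neutral) auto
qed

lemma gmap_hom: "gmap \<gamma> B s N s' f \<Longrightarrow> module_hom fscale fscale f"
  by (simp add: gmap_def)

lemma gmap_compose:
  assumes \<gamma>: "additive_grading \<gamma>" and f: "gmap \<gamma> B s (free_on B') s' f" and g: "gmap \<gamma> B' s' N s'' g"
    and N: "module.subspace fscale N"
  shows "gmap \<gamma> B s N s'' (\<lambda>v. g (f v))"
  unfolding gmap_def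
proof (intro conjI ballI)
  show "module_hom fscale fscale (\<lambda>v. g (f v))"
    using module_hom_compose[OF gmap_hom[OF f] gmap_hom[OF g]] by (simp add: o_def)
  fix q assume "q \<in> B"
  then have "f (single q 1) \<in> free_on B'" "homog \<gamma> s' (s q) (f (single q 1))"
    using f by (auto simp: gmap_def)
  then show "g (f (single q 1)) \<in> N" "homog \<gamma> s'' (s q) (g (f (single q 1)))"
    using gmap_into[OF g N] gmap_homog[OF \<gamma> g] by auto
qed

lemma gmap_id: "\<gamma> 0 = 0 \<Longrightarrow> gmap \<gamma> B s (free_on B) s (\<lambda>v. v)"
  by (auto simp: gmap_def module_hom_iff module_fscale homog_def lookup_single when_def intro!: free_on_basis split: if_splits)

lemma gmap_diff:
  assumes "gmap \<gamma> B s N s' f" "gmap \<gamma> B s N s' g" "module.subspace fscale N"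
  shows "gmap \<gamma> B s N s' (\<lambda>v. f v - g v)"
  using assms by (auto simp: gmap_def hom_diff_scalar homog_diff module.subspace_diff[OF module_fscale])

lemma homotopic_to_id:
  fixes K :: "('m::comm_monoid_add \<Rightarrow>\<^sub>0 'k::comm_ring_1) set"
  assumes \<gamma>: "additive_grading \<gamma>" and K: "module.subspace (*) K"
    and S: "graded_source \<gamma> K B s D \<epsilon>" and T: "graded_target \<gamma> K (\<lambda>i. free_on (B i)) s D \<epsilon>"
    and u: "\<And>i. gmap \<gamma> (B i) (s i) (free_on (B i)) (s i) (u i)"
    and u0: "\<And>v. v \<in> free_on (B 0) \<Longrightarrow> \<epsilon> (u 0 v) - \<epsilon> v \<in> K"
    and uD: "\<And>i v. v \<in> free_on (B (Suc i)) \<Longrightarrow> D i (u (Suc i) v) = u i (D i v)"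
  obtains h where "\<And>i. gmap \<gamma> (B i) (s i) (free_on (B (Suc i))) (s (Suc i)) (h i)"
    "\<And>v. v \<in> free_on (B 0) \<Longrightarrow> u 0 v - v = D 0 (h 0 v)"
    "\<And>i v. v \<in> free_on (B (Suc i)) \<Longrightarrow> u (Suc i) v - v = D (Suc i) (h (Suc i) v) + h i (D i v)"
proof (rule null_homotopy[OF \<gamma> S T, of "\<lambda>i v. u i v - v"])
  have R: "resolution K (\<lambda>i. free_on (B i)) D \<epsilon>" using T by (simp add: graded_target_def)
  have \<gamma>0: "\<gamma> 0 = 0"
  proof -
    have "\<gamma> (0 + 0) = \<gamma> 0 + \<gamma> 0" using \<gamma> unfolding additive_grading_def by blast
    then show ?thesis by simp
  qed
  show "gmap \<gamma> (B i) (s i) (free_on (B i)) (s i) (\<lambda>v. u i v - v)" for i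
    by (rule gmap_diff[OF u gmap_id subspace_free_on]) (rule \<gamma>0)
  show "\<epsilon> (u 0 v - v) \<in> K" if "v \<in> free_on (B 0)" for v
    using u0[OF that] by (simp add: module_hom.diff[OF resolution_homs(2)[OF R]])
  show "D i (u (Suc i) v - v) = u i (D i v) - D i v" if "v \<in> free_on (B (Suc i))" for i v
    using uD[OF that] by (simp add: module_hom.diff[OF resolution_homs(1)[OF R]])
qed (assumption | blast)+

text \<open>Comparison maps in both directions are inverse up to homotopy. The reduced differentials
  of \<open>G\<close> vanish, so after reduction \<open>f\<close> after \<open>g\<close> is the
  identity outright, while \<open>g\<close> after \<open>f\<close> differs from the identity by a
  boundary on cycles of \<open>F\<close>. This is the situation of
  \<open>dim_extension_by_section\<close>.\<close>

lemma homology_dim_eq_card: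
  fixes K :: "('n::finite, 'k::field) mpoly set"
  assumes K: "module.subspace (*) K" "\<And>t a. a \<in> K \<Longrightarrow> hpart (\<lambda>m. int (mdeg m)) t a \<in> K"
    and F: "graded_free_resolution K F" and G: "minimal_graded_free_resolution K G"
  shows "homology_dim (\<lambda>l. free_on {p \<in> gens F l. S (shift F l p)}) (residue_diff F) i =
    card {p \<in> gens G i. S (shift G i p)}"
proof -
  let ?\<gamma> = "\<lambda>m :: 'n \<Rightarrow>\<^sub>0 nat. int (mdeg m)"
  have G': "graded_free_resolution K G" using G by (simp add: minimal_graded_free_resolution_def)
  have RF: "resolution K (\<lambda>i. free_on (gens F i)) (diff F) (aug F)"
    and RG: "resolution K (\<lambda>i. free_on (gens G i)) (diff G) (aug G)"
    and fin: "\<And>i. finite (gens F i)" "\<And>i. finite (gens G i)"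
    using F G' by (simp_all add: graded_free_resolution_def)
  note TF = graded_target_free(1)[OF F K(2)] and TG = graded_target_free(1)[OF G' K(2)]
  note SF = graded_target_free(2)[OF F K(2)] and SG = graded_target_free(2)[OF G' K(2)]
  obtain f where f: "\<And>i. gmap ?\<gamma> (gens F i) (shift F i) (free_on (gens G i)) (shift G i) (f i)"
    "\<And>v. v \<in> free_on (gens F 0) \<Longrightarrow> aug G (f 0 v) - aug F v \<in> K"
    "\<And>i v. v \<in> free_on (gens F (Suc i)) \<Longrightarrow> diff G i (f (Suc i) v) = f i (diff F i v)"
    by (rule chain_lift[OF additive_mdeg K(1) SF TG]) (assumption | blast)+
  obtain g where g: "\<And>i. gmap ?\<gamma> (gens G i) (shift G i) (free_on (gens F i)) (shift F i) (g i)"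
    "\<And>v. v \<in> free_on (gens G 0) \<Longrightarrow> aug F (g 0 v) - aug G v \<in> K"
    "\<And>i v. v \<in> free_on (gens G (Suc i)) \<Longrightarrow> diff F i (g (Suc i) v) = g i (diff G i v)"
    by (rule chain_lift[OF additive_mdeg K(1) SG TF]) (assumption | blast)+
  have f_in: "f i v \<in> free_on (gens G i)" if "v \<in> free_on (gens F i)" for i v
    using gmap_into[OF f(1) subspace_free_on that] .
  have g_in: "g i v \<in> free_on (gens F i)" if "v \<in> free_on (gens G i)" for i v
    using gmap_into[OF g(1) subspace_free_on that] .
  obtain h where h: "\<And>i. gmap ?\<gamma> (gens F i) (shift F i) (free_on (gens F (Suc i))) (shift F (Suc i)) (h i)"
    "\<And>v. v \<in> free_on (gens F 0) \<Longrightarrow> g 0 (f 0 v) - v = diff F 0 (h 0 v)"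
    "\<And>i v. v \<in> free_on (gens F (Suc i)) \<Longrightarrow> g (Suc i) (f (Suc i) v) - v = diff F (Suc i) (h (Suc i) v) + h i (diff F i v)"
  proof (rule homotopic_to_id[OF additive_mdeg K(1) SF TF, of "\<lambda>i v. g i (f i v)"])
    show "gmap ?\<gamma> (gens F i) (shift F i) (free_on (gens F i)) (shift F i) (\<lambda>v. g i (f i v))" for i
      by (rule gmap_compose[OF additive_mdeg f(1) g(1) subspace_free_on])
    show "aug F (g 0 (f 0 v)) - aug F v \<in> K" if "v \<in> free_on (gens F 0)" for v
      using module.subspace_add[OF module_mult K(1) g(2)[OF f_in[OF that]] f(2)[OF that]] by simp
    show "diff F i (g (Suc i) (f (Suc i) v)) = g i (f i (diff F i v))" if "v \<in> free_on (gens F (Suc i))" for i v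
      using g(3)[OF f_in[OF that]] f(3)[OF that] by simp
  qed (assumption | blast)+
  obtain k where k: "\<And>i. gmap ?\<gamma> (gens G i) (shift G i) (free_on (gens G (Suc i))) (shift G (Suc i)) (k i)"
    "\<And>v. v \<in> free_on (gens G 0) \<Longrightarrow> f 0 (g 0 v) - v = diff G 0 (k 0 v)"
    "\<And>i v. v \<in> free_on (gens G (Suc i)) \<Longrightarrow> f (Suc i) (g (Suc i) v) - v = diff G (Suc i) (k (Suc i) v) + k i (diff G i v)"
  proof (rule homotopic_to_id[OF additive_mdeg K(1) SG TG, of "\<lambda>i v. f i (g i v)"])
    show "gmap ?\<gamma> (gens G i) (shift G i) (free_on (gens G i)) (shift G i) (\<lambda>v. f i (g i v))" for i
      by (rule gmap_compose[OF additive_mdeg g(1) f(1) subspace_free_on])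
    show "aug G (f 0 (g 0 v)) - aug G v \<in> K" if "v \<in> free_on (gens G 0)" for v
      using module.subspace_add[OF module_mult K(1) f(2)[OF g_in[OF that]] g(2)[OF that]] by simp
    show "diff G i (f (Suc i) (g (Suc i) v)) = f i (g i (diff G i v))" if "v \<in> free_on (gens G (Suc i))" for i v
      using f(3)[OF g_in[OF that]] g(3)[OF that] by simp
  qed (assumption | blast)+
  note hF = resolution_homs(1)[OF RF] and hG = resolution_homs(1)[OF RG]
  let ?X = "\<lambda>i. {p \<in> gens F i. S (shift F i p)}" and ?Y = "\<lambda>i. {p \<in> gens G i. S (shift G i p)}"
  have subX: "free_on (?X i) \<subseteq> free_on (gens F i)" and subY: "free_on (?Y i) \<subseteq> free_on (gens G i)" for i
    by (auto simp: free_on_def)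
  have G0: "residue (diff G i) w = 0" if "w \<in> free_on (gens G (Suc i))" for i w
    using G that by (intro residue_zero_of_minimal[OF _ hG]) (auto simp: minimal_graded_free_resolution_def)
  define \<delta> where "\<delta> = residue_diff F"
  have \<delta>: "\<delta> i = residue (diff F i)" for i by (simp add: \<delta>_def residue_diff_eq)
  have DF: "gmap ?\<gamma> (gens F (Suc i)) (shift F (Suc i)) (free_on (gens F i)) (shift F i) (diff F i)" for i
    using SF by (simp add: graded_source_def)
  have \<delta>h: "module_hom fscale fscale (\<delta> i)" for i unfolding \<delta> by (rule residue_hom[OF hF])
  have \<delta>_in: "\<delta> i w \<in> free_on (?X i)" if "w \<in> free_on (?X (Suc i))" for i w
    unfolding \<delta> by (rule residue_into[OF DF that])
  have cong: "residue a w = residue b w" if "\<And>v. v \<in> free_on B \<Longrightarrow> a v = b v" "w \<in> free_on B"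
    for a b :: "(nat \<Rightarrow>\<^sub>0 ('n, 'k) mpoly) \<Rightarrow> (nat \<Rightarrow>\<^sub>0 ('n, 'k) mpoly)" and w B
    using that(1)[OF const_vec_free_on[OF that(2)]] by (simp add: residue_def)
  have \<delta>\<delta>: "\<delta> i (\<delta> (Suc i) w) = 0" if "w \<in> free_on (?X (Suc (Suc i)))" for i w
  proof -
    have w: "w \<in> free_on (gens F (Suc (Suc i)))" using that subX by blast
    have "\<delta> i (\<delta> (Suc i) w) = residue (\<lambda>v. diff F i (diff F (Suc i) v)) w"
      unfolding \<delta> by (rule residue_comp[OF hF, symmetric])
    also have "\<dots> = 0"
      using resolution_boundaries(2)[OF RF const_vec_free_on[OF w]] by (simp add: residue_def)
    finally show ?thesis .
  qed
  have f\<delta>: "residue (f i) (\<delta> i w) = 0" if "w \<in> free_on (?X (Suc i))" for i w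
  proof -
    have w: "w \<in> free_on (gens F (Suc i))" using that subX by blast
    have "residue (f i) (\<delta> i w) = residue (\<lambda>v. f i (diff F i v)) w"
      unfolding \<delta> by (rule residue_comp[OF gmap_hom[OF f(1)], symmetric])
    also have "\<dots> = residue (\<lambda>v. diff G i (f (Suc i) v)) w"
      by (rule cong[OF _ w]) (simp add: f(3))
    also have "\<dots> = residue (diff G i) (residue (f (Suc i)) w)" by (rule residue_comp[OF hG])
    also have "\<dots> = 0" using residue_into[OF f(1) that] subY by (intro G0) blast
    finally show ?thesis .
  qed
  have \<delta>g: "\<delta> i (residue (g (Suc i)) y) = 0" if "y \<in> free_on (?Y (Suc i))" for i y
  proof -
    have y: "y \<in> free_on (gens G (Suc i))" using that subY by blast
    have "\<delta> i (residue (g (Suc i)) y) = residue (\<lambda>v. diff F i (g (Suc i) v)) y"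
      unfolding \<delta> by (rule residue_comp[OF hF, symmetric])
    also have "\<dots> = residue (\<lambda>v. g i (diff G i v)) y"
      by (rule cong[OF _ y]) (simp add: g(3))
    also have "\<dots> = residue (g i) (residue (diff G i) y)" by (rule residue_comp[OF gmap_hom[OF g(1)]])
    also have "\<dots> = 0" using G0[OF y] module_hom.zero[OF residue_hom[OF gmap_hom[OF g(1)]]] by simp
    finally show ?thesis .
  qed
  have fg: "residue (f i) (residue (g i) y) = y" if "y \<in> free_on (?Y i)" for y
  proof -
    have y: "y \<in> free_on (gens G i)" using that subY by blast
    let ?c = "Poly_Mapping.map (single 0) y :: nat \<Rightarrow>\<^sub>0 ('n, 'k) mpoly"
    have c: "?c \<in> free_on (gens G i)" using y by (rule const_vec_free_on)
    have "residue (f i) (residue (g i) y) = red (f i (g i ?c))"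
      unfolding residue_comp[OF gmap_hom[OF f(1)], symmetric] by (simp add: residue_def)
    also have "\<dots> = red (f i (g i ?c) - ?c) + y" by (simp add: red_diff red_const_vec)
    \<comment> \<open>Every homotopy term passes through a reduced differential of \<open>G\<close>,
      which is zero.\<close>
    also have "red (f i (g i ?c) - ?c) = 0"
    proof (cases i)
      case 0
      have "red (diff G 0 (k 0 ?c)) = residue (\<lambda>v. diff G 0 (k 0 v)) y" by (simp add: residue_def)
      also have "\<dots> = residue (diff G 0) (residue (k 0) y)" by (rule residue_comp[OF hG])
      also have "\<dots> = 0" using residue_into[OF k(1)[of 0], where S="\<lambda>_. True"] y 0 by (intro G0) simp
      finally show ?thesis using k(2) c 0 by simp
    next
      case (Suc j)
      have "red (diff G i (k i ?c)) = residue (\<lambda>v. diff G i (k i v)) y" by (simp add: residue_def)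
      also have "\<dots> = residue (diff G i) (residue (k i) y)" by (rule residue_comp[OF hG])
      also have "\<dots> = 0" using residue_into[OF k(1)[of i], where S="\<lambda>_. True"] y by (intro G0) simp
      finally have 1: "red (diff G i (k i ?c)) = 0" .
      have "red (k j (diff G j ?c)) = residue (\<lambda>v. k j (diff G j v)) y" by (simp add: residue_def)
      also have "\<dots> = residue (k j) (residue (diff G j) y)" by (rule residue_comp[OF gmap_hom[OF k(1)]])
      also have "\<dots> = 0" using G0[of y j] y Suc module_hom.zero[OF residue_hom[OF gmap_hom[OF k(1)]]] by simp
      finally show ?thesis using k(3)[of ?c j] c Suc 1 by (simp add: red_add)
    qed
    finally show ?thesis by simp
  qed
  define Z where "Z = (case i of 0 \<Rightarrow> free_on (?X 0) | Suc j \<Rightarrow> {w \<in> free_on (?X (Suc j)). \<delta> j w = 0})"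
  have ZX: "Z \<subseteq> free_on (?X i)" by (auto simp: Z_def split: nat.splits)
  have Z\<delta>: "\<delta> j z = 0" if "z \<in> Z" "i = Suc j" for j z using that by (simp add: Z_def)
  have gf: "z - residue (g i) (residue (f i) z) \<in> \<delta> i ` free_on (?X (Suc i))" if z: "z \<in> Z" for z
  proof -
    have zX: "z \<in> free_on (?X i)" "z \<in> free_on (gens F i)" using z ZX subX by blast+
    let ?c = "Poly_Mapping.map (single 0) z :: nat \<Rightarrow>\<^sub>0 ('n, 'k) mpoly"
    have c: "?c \<in> free_on (gens F i)" using zX by (intro const_vec_free_on)
    have "residue (g i) (residue (f i) z) - z = red (g i (f i ?c) - ?c)"
      unfolding residue_comp[OF gmap_hom[OF g(1)], symmetric] by (simp add: residue_def red_diff red_const_vec)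
    \<comment> \<open>On a cycle the homotopy term that passes through the lower differential
      vanishes and the boundary remains.\<close>
    also have "\<dots> = \<delta> i (residue (h i) z)"
    proof -
      have 1: "red (diff F i (h i ?c)) = \<delta> i (residue (h i) z)"
        unfolding \<delta> residue_comp[OF hF, symmetric] by (simp add: residue_def)
      show ?thesis
      proof (cases i)
        case 0
        then show ?thesis using h(2) c 1 by simp
      next
        case (Suc j)
        have "red (h j (diff F j ?c)) = residue (h j) (\<delta> j z)"
          unfolding \<delta> residue_comp[OF gmap_hom[OF h(1)], symmetric] by (simp add: residue_def)
        also have "\<dots> = 0" using Z\<delta>[OF z Suc] module_hom.zero[OF residue_hom[OF gmap_hom[OF h(1)]]] by simp
        finally show ?thesis using h(3)[of ?c j] c Suc 1 by (simp add: red_add)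
      qed
    qed
    finally have "z - residue (g i) (residue (f i) z) = - \<delta> i (residue (h i) z)"
      by (metis minus_diff_eq)
    also have "\<dots> = \<delta> i (- residue (h i) z)" by (simp add: module_hom.neg[OF \<delta>h])
    finally have eq: "z - residue (g i) (residue (f i) z) = \<delta> i (- residue (h i) z)" .
    have "- residue (h i) z \<in> free_on (?X (Suc i))"
      using residue_into[OF h(1) zX(1)] module.subspace_neg[OF module_fscale subspace_free_on] by blast
    then show ?thesis unfolding eq by blast
  qed
  have sub: "module.subspace fscale (\<delta> i ` free_on (?X (Suc i)))"
    by (rule module_hom.subspace_image[OF \<delta>h subspace_free_on])
  have subZ: "module.subspace fscale Z"
  proof (cases i)
    case 0
    then show ?thesis by (simp add: Z_def subspace_free_on)
  next
    case (Suc j)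
    have "Z = free_on (?X (Suc j)) \<inter> {w. \<delta> j w = 0}" using Suc by (auto simp: Z_def)
    then show ?thesis
      using module.subspace_inter[OF module_fscale subspace_free_on module_hom.subspace_kernel[OF \<delta>h]] by simp
  qed
  have "vector_space.dim fscale Z = vector_space.dim fscale (\<delta> i ` free_on (?X (Suc i))) + card (?Y i)"
  proof (rule dim_extension_by_section[OF sub _ subZ ZX _ _ residue_hom[OF gmap_hom[OF f(1)]] residue_hom[OF gmap_hom[OF g(1)]]])
    show "\<delta> i ` free_on (?X (Suc i)) \<subseteq> Z"
    proof
      fix z assume "z \<in> \<delta> i ` free_on (?X (Suc i))"
      then obtain w where w: "w \<in> free_on (?X (Suc i))" "z = \<delta> i w" by blast
      show "z \<in> Z"
      proof (cases i)
        case 0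
        then show ?thesis using \<delta>_in[OF w(1)] w(2) by (simp add: Z_def)
      next
        case (Suc j)
        then show ?thesis using \<delta>_in[OF w(1)] w \<delta>\<delta>[of w j] by (simp add: Z_def)
      qed
    qed
    show "residue (f i) z \<in> free_on (?Y i)" if "z \<in> Z" for z
      using residue_into[OF f(1)] that ZX by blast
    show "residue (g i) y \<in> Z" if y: "y \<in> free_on (?Y i)" for y
    proof -
      have gy: "residue (g i) y \<in> free_on (?X i)" by (rule residue_into[OF g(1) y])
      show ?thesis
      proof (cases i)
        case 0
        then show ?thesis using gy by (simp add: Z_def)
      next
        case (Suc j)
        then show ?thesis using gy \<delta>g[of y j] y by (simp add: Z_def)
      qed
    qed
    show "residue (f i) z = 0" if "z \<in> \<delta> i ` free_on (?X (Suc i))" for z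
      using that f\<delta> by blast
  qed (use fin fg gf in auto)
  then show ?thesis
    unfolding homology_dim_def \<delta>_def[symmetric] Z_def by simp
qed

section \<open>The minimal resolution\<close>

text \<open>
  The generators of the resolution are encoded as natural numbers: \<open>enc W J\<close> is the basis element of
  the summand belonging to \<open>W\<close> that is given by the cocycle \<open>E W J\<close>. The cocycles on \<open>W\<close> are determined
  freely by their values on the sets in \<open>Fr W\<close>, and \<open>E W\<close> is the dual basis.
\<close>

definition enc :: "nat set \<Rightarrow> nat set \<Rightarrow> nat" where
  "enc W J = prod_encode (set_encode W, set_encode J)"

definition vW :: "nat \<Rightarrow> nat set" where "vW q = set_decode (fst (prod_decode q))"
definition vJ :: "nat \<Rightarrow> nat set" where "vJ q = set_decode (snd (prod_decode q))"

lemma vW_enc: "finite W \<Longrightarrow> vW (enc W J) = W" and vJ_enc: "finite J \<Longrightarrow> vJ (enc W J) = J"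
  by (simp_all add: vW_def vJ_def enc_def)

text \<open>The map \<open>\<phi>\<close> numbers the variables: the signs of cochains require a
  linear order, which the index type does not carry.\<close>

locale cocyc_bases =
  fixes \<phi> :: "'n::finite \<Rightarrow> nat" and d :: nat and \<I> :: "nat set set"
    and Fr :: "nat set \<Rightarrow> nat set set" and E :: "nat set \<Rightarrow> nat set \<Rightarrow> nat set \<Rightarrow> 'k::field"
  assumes inj: "inj \<phi>" and d_pos: "d \<ge> 1" and far: "far d \<I>"
    and Fr_sub: "W \<subseteq> range \<phi> \<Longrightarrow> W \<noteq> {} \<Longrightarrow> J \<in> Fr W \<Longrightarrow> J \<subseteq> W \<and> card J = d"
    and E_cocyc: "W \<subseteq> range \<phi> \<Longrightarrow> W \<noteq> {} \<Longrightarrow> J \<in> Fr W \<Longrightarrow> E W J \<in> cocyc d \<I> W"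
    and E_dual: "W \<subseteq> range \<phi> \<Longrightarrow> W \<noteq> {} \<Longrightarrow> J \<in> Fr W \<Longrightarrow> J' \<in> Fr W \<Longrightarrow> E W J J' = (if J = J' then 1 else 0)"
    and Fr_zero: "W \<subseteq> range \<phi> \<Longrightarrow> W \<noteq> {} \<Longrightarrow> (c :: nat set \<Rightarrow> 'k) \<in> cocyc d \<I> W \<Longrightarrow> (\<And>J. J \<in> Fr W \<Longrightarrow> c J = 0) \<Longrightarrow> c = (\<lambda>_. 0)"
begin

abbreviation N :: "nat set" where "N \<equiv> range \<phi>"

definition \<Gamma> :: "nat \<Rightarrow> nat set" where
  "\<Gamma> i = (case i of 0 \<Rightarrow> {enc {} {}} | Suc k \<Rightarrow>
     (\<lambda>(W, J). enc W J) ` (SIGMA W:{W. W \<subseteq> N \<and> card W = d + k}. Fr W))"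

definition w :: "nat \<Rightarrow> 'n set" where "w q = \<phi> -` vW q"

text \<open>Matrix of the signed restriction maps in the chosen bases, the coordinate being the
  value at \<open>vJ p\<close>. At most one \<open>j\<close> qualifies, so the sum merely avoids
  selecting it and is zero if there is none. The first case is the augmentation: for a
  \<open>d\<close>-set \<open>W\<close> the only possible coordinate is \<open>W\<close> itself,
  where the dual basis has value 1.\<close>

definition \<alpha> :: "nat \<Rightarrow> nat \<Rightarrow> 'k" where
  "\<alpha> p q = (if vW p = {} then 1
     else \<Sum>j | j \<in> vW q \<and> vW p = vW q - {j}. sg j (vW p) * E (vW q) (vJ q) (vJ p))"

text \<open>Passes from coordinates on the generators to the cochains that they describe, the form
  in which \<open>strand_exact\<close> and \<open>bd_bd\<close> apply.\<close>

definition family :: "(nat \<Rightarrow> 'k) \<Rightarrow> nat set \<Rightarrow> nat set \<Rightarrow> 'k" where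
  "family x U J' = (\<Sum>J\<in>Fr U. x (enc U J) * E U J J')"

lemma finW: "W \<subseteq> N \<Longrightarrow> finite W"
  by (rule finite_subset) auto

lemma ne: "card W = d + k \<Longrightarrow> W \<noteq> {}"
  using d_pos by auto

lemma finJ: "W \<subseteq> N \<Longrightarrow> W \<noteq> {} \<Longrightarrow> J \<in> Fr W \<Longrightarrow> finite J"
  using Fr_sub finW finite_subset by metis

lemma finFr: "W \<subseteq> N \<Longrightarrow> W \<noteq> {} \<Longrightarrow> finite (Fr W)"
proof -
  assume W: "W \<subseteq> N" "W \<noteq> {}"
  then have "Fr W \<subseteq> Pow W" using Fr_sub by blast
  then show ?thesis using finW[OF W(1)] finite_subset by auto
qed

lemma inj_enc: "inj_on (\<lambda>(W, J). enc W J) (SIGMA W:{W. W \<subseteq> N \<and> card W = d + k}. Fr W)"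
proof (rule inj_onI)
  fix a b assume ab: "a \<in> (SIGMA W:{W. W \<subseteq> N \<and> card W = d + k}. Fr W)"
    "b \<in> (SIGMA W:{W. W \<subseteq> N \<and> card W = d + k}. Fr W)"
    "(\<lambda>(W, J). enc W J) a = (\<lambda>(W, J). enc W J) b"
  obtain W J W' J' where [simp]: "a = (W, J)" "b = (W', J')" by (cases a, cases b)
  have "finite W" "finite W'" "finite J" "finite J'"
    using ab(1,2) finW finJ[OF _ ne] by auto
  then show "a = b" using ab(3) vW_enc vJ_enc by (metis \<open>a = (W, J)\<close> \<open>b = (W', J')\<close> case_prod_conv)
qed

lemma \<Gamma>_Suc_cases:
  assumes "q \<in> \<Gamma> (Suc k)"
  obtains W J where "q = enc W J" "W \<subseteq> N" "card W = d + k" "J \<in> Fr W" "vW q = W" "vJ q = J" "W \<noteq> {}" "finite W"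
proof -
  obtain W J where q: "q = enc W J" "W \<subseteq> N" "card W = d + k" "J \<in> Fr W"
    using assms by (auto simp: \<Gamma>_def)
  then show ?thesis using that finW[of W] ne[of W k] finJ[of W J] vW_enc[of W J] vJ_enc[of J W] by blast
qed

lemma \<Gamma>_SucI: "W \<subseteq> N \<Longrightarrow> card W = d + k \<Longrightarrow> J \<in> Fr W \<Longrightarrow> enc W J \<in> \<Gamma> (Suc k)"
  by (auto simp: \<Gamma>_def)

lemma fin_\<Gamma>: "finite (\<Gamma> i)"
proof (cases i)
  case (Suc k)
  have "finite (SIGMA W:{W. W \<subseteq> N \<and> card W = d + k}. Fr W)"
    using finFr ne by (intro finite_SigmaI) auto
  then show ?thesis by (simp add: Suc \<Gamma>_def)
qed (simp add: \<Gamma>_def)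

lemma sum_\<Gamma>:
  assumes A: "A \<subseteq> N"
  shows "(\<Sum>q | q \<in> \<Gamma> (Suc k) \<and> vW q \<subseteq> A. g q) = (\<Sum>U | U \<subseteq> A \<and> card U = d + k. \<Sum>J\<in>Fr U. g (enc U J))"
proof -
  have eq: "{q \<in> \<Gamma> (Suc k). vW q \<subseteq> A} = (\<lambda>(W, J). enc W J) ` (SIGMA W:{W. W \<subseteq> A \<and> card W = d + k}. Fr W)"
  proof (intro equalityI subsetI)
    fix q assume "q \<in> {q \<in> \<Gamma> (Suc k). vW q \<subseteq> A}"
    then have q: "q \<in> \<Gamma> (Suc k)" "vW q \<subseteq> A" by auto
    from q(1) show "q \<in> (\<lambda>(W, J). enc W J) ` (SIGMA W:{W. W \<subseteq> A \<and> card W = d + k}. Fr W)"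
      by (rule \<Gamma>_Suc_cases) (use q(2) in auto)
  next
    fix q assume "q \<in> (\<lambda>(W, J). enc W J) ` (SIGMA W:{W. W \<subseteq> A \<and> card W = d + k}. Fr W)"
    then obtain W J where q: "q = enc W J" "W \<subseteq> A" "card W = d + k" "J \<in> Fr W" by auto
    then show "q \<in> {q \<in> \<Gamma> (Suc k). vW q \<subseteq> A}" using A \<Gamma>_SucI[of W k J] vW_enc[OF finW, of W J] by auto
  qed
  have "inj_on (\<lambda>(W, J). enc W J) (SIGMA W:{W. W \<subseteq> A \<and> card W = d + k}. Fr W)"
    by (rule inj_on_subset[OF inj_enc[of k]]) (use A in auto)
  then have "(\<Sum>q | q \<in> \<Gamma> (Suc k) \<and> vW q \<subseteq> A. g q) =
      (\<Sum>(W, J)\<in>(SIGMA W:{W. W \<subseteq> A \<and> card W = d + k}. Fr W). g (enc W J))"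
    unfolding eq by (simp add: sum.reindex case_prod_unfold)
  also have "\<dots> = (\<Sum>U | U \<subseteq> A \<and> card U = d + k. \<Sum>J\<in>Fr U. g (enc U J))"
  proof (rule sum.Sigma[symmetric])
    show "finite {W. W \<subseteq> A \<and> card W = d + k}" using finW[OF A] by simp
    show "\<forall>W\<in>{W. W \<subseteq> A \<and> card W = d + k}. finite (Fr W)"
      by (intro ballI finFr) (use A ne[of _ k] in auto)
  qed
  finally show ?thesis .
qed

lemma card_\<Gamma>: "card (\<Gamma> (Suc k)) = (\<Sum>W | W \<subseteq> N \<and> card W = d + k. card (Fr W))"
proof -
  have "{q \<in> \<Gamma> (Suc k). vW q \<subseteq> N} = \<Gamma> (Suc k)" by (auto elim: \<Gamma>_Suc_cases)
  then show ?thesis using sum_\<Gamma>[of N "\<lambda>_. 1 :: nat" k] by simp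
qed

lemma family_cocyc: "U \<subseteq> N \<Longrightarrow> U \<noteq> {} \<Longrightarrow> family x U \<in> cocyc d \<I> U"
  unfolding family_def[abs_def] by (intro cocyc_sum E_cocyc)

lemma family_coord: "U \<subseteq> N \<Longrightarrow> U \<noteq> {} \<Longrightarrow> J \<in> Fr U \<Longrightarrow> family x U J = x (enc U J)"
  using finFr by (simp add: family_def E_dual if_distrib cong: if_cong)

lemma family_expand:
  assumes U: "U \<subseteq> N" "U \<noteq> {}" and c: "c \<in> cocyc d \<I> U" and x: "\<And>J. J \<in> Fr U \<Longrightarrow> x (enc U J) = c J"
  shows "family x U = c"
proof -
  have "(\<lambda>J. family x U J - c J) = (\<lambda>_. 0)"
    by (rule Fr_zero[OF U cocyc_diff[OF family_cocyc[OF U] c]]) (simp add: family_coord[OF U] x)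
  then show ?thesis by (metis (no_types) eq_iff_diff_eq_0 ext)
qed

text \<open>Collecting the generators that belong to the same set \<open>U\<close> turns a row of
  the matrix into \<open>bd\<close> of the associated family, read off at the coordinate
  \<open>J'\<close>.\<close>

lemma sum_\<alpha>_Suc:
  assumes A: "A \<subseteq> N" and W: "W \<subseteq> A" "card W = d + k" and J: "J' \<in> Fr W"
  shows "(\<Sum>q | q \<in> \<Gamma> (Suc (Suc k)) \<and> vW q \<subseteq> A. \<alpha> (enc W J') q * x q) = bd A (family x) W J'"
proof -
  have WN: "W \<subseteq> N" "W \<noteq> {}" "finite W" using A W ne finW by auto
  have p: "vW (enc W J') = W" "vJ (enc W J') = J'" using vW_enc vJ_enc WN finJ[OF WN(1,2) J] by auto
  have finA: "finite A" using finW[OF A] .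
  let ?g = "\<lambda>U j. sg j W * family x U J'"
  have "(\<Sum>q | q \<in> \<Gamma> (Suc (Suc k)) \<and> vW q \<subseteq> A. \<alpha> (enc W J') q * x q) =
     (\<Sum>U | U \<subseteq> A \<and> card U = d + Suc k. \<Sum>J\<in>Fr U. \<alpha> (enc W J') (enc U J) * x (enc U J))"
    by (rule sum_\<Gamma>[OF A])
  also have "\<dots> = (\<Sum>U | U \<subseteq> A \<and> card U = d + Suc k. \<Sum>j | j \<in> U \<and> W = U - {j}. ?g U j)"
  proof (rule sum.cong[OF refl])
    fix U assume "U \<in> {U. U \<subseteq> A \<and> card U = d + Suc k}"
    then have U: "U \<subseteq> N" "U \<noteq> {}" "finite U" using A ne finW by auto
    have "\<alpha> (enc W J') (enc U J) = (\<Sum>j | j \<in> U \<and> W = U - {j}. sg j W * E U J J')" if "J \<in> Fr U" for J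
      unfolding \<alpha>_def p vW_enc[OF U(3)] vJ_enc[OF finJ[OF U(1,2) that]] using WN by simp
    then have "(\<Sum>J\<in>Fr U. \<alpha> (enc W J') (enc U J) * x (enc U J)) =
       (\<Sum>J\<in>Fr U. \<Sum>j | j \<in> U \<and> W = U - {j}. sg j W * (x (enc U J) * E U J J'))"
      by (intro sum.cong refl) (simp add: sum_distrib_left mult_ac)
    also have "\<dots> = (\<Sum>j | j \<in> U \<and> W = U - {j}. ?g U j)"
      by (subst sum.swap) (simp add: family_def sum_distrib_left)
    finally show "(\<Sum>J\<in>Fr U. \<alpha> (enc W J') (enc U J) * x (enc U J)) = (\<Sum>j | j \<in> U \<and> W = U - {j}. ?g U j)" .
  qed
  also have "\<dots> = (\<Sum>(U, j)\<in>(SIGMA U:{U. U \<subseteq> A \<and> card U = d + Suc k}. {j \<in> U. W = U - {j}}). ?g U j)"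
    by (intro sum.Sigma ballI) (use finA finite_subset[OF _ finA] in \<open>auto intro: rev_finite_subset\<close>)
  also have "\<dots> = (\<Sum>j\<in>A - W. ?g (insert j W) j)"
  proof (rule sum.reindex_bij_witness[where i="\<lambda>j. (insert j W, j)" and j=snd])
    fix a assume "a \<in> (SIGMA U:{U. U \<subseteq> A \<and> card U = d + Suc k}. {j \<in> U. W = U - {j}})"
    then show "(insert (snd a) W, snd a) = a" "snd a \<in> A - W"
      "sg (snd a) W * family x (insert (snd a) W) J' = (case a of (U, j) \<Rightarrow> ?g U j)"
      by (auto simp: insert_absorb)
  next
    fix j assume "j \<in> A - W"
    then show "(insert j W, j) \<in> (SIGMA U:{U. U \<subseteq> A \<and> card U = d + Suc k}. {j \<in> U. W = U - {j}})"
      using W WN by auto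
  qed simp
  finally show ?thesis by (simp add: bd_def)
qed

text \<open>On a \<open>d\<close>-set the only possible coordinate is the set itself, so the
  coefficient of a generator is the value of its cochain there.\<close>

lemma sum_\<alpha>_0:
  assumes A: "A \<subseteq> N"
  shows "(\<Sum>q | q \<in> \<Gamma> (Suc 0) \<and> vW q \<subseteq> A. \<alpha> (enc {} {}) q * x q) = (\<Sum>W | W \<subseteq> A \<and> card W = d. family x W W)"
proof -
  have "(\<Sum>q | q \<in> \<Gamma> (Suc 0) \<and> vW q \<subseteq> A. \<alpha> (enc {} {}) q * x q) =
     (\<Sum>W | W \<subseteq> A \<and> card W = d. \<Sum>J\<in>Fr W. \<alpha> (enc {} {}) (enc W J) * x (enc W J))"
    using sum_\<Gamma>[OF A, where k=0] by simp
  also have "\<dots> = (\<Sum>W | W \<subseteq> A \<and> card W = d. family x W W)"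
  proof (rule sum.cong[OF refl])
    fix W assume "W \<in> {W. W \<subseteq> A \<and> card W = d}"
    then have W: "W \<subseteq> N" "W \<noteq> {}" "finite W" "card W = d" using A ne[of W 0] finW by auto
    have JW: "J = W" if "J \<in> Fr W" for J
      using Fr_sub[OF W(1,2) that] W(3,4) by (intro card_subset_eq) auto
    have "E W J W = 1" if "J \<in> Fr W" for J
      using E_dual[OF W(1,2) that that] unfolding JW[OF that] by simp
    then show "(\<Sum>J\<in>Fr W. \<alpha> (enc {} {}) (enc W J) * x (enc W J)) = family x W W"
      by (simp add: family_def \<alpha>_def vW_enc)
  qed
  finally show ?thesis .
qed

lemma vimage_subset_iff: "W \<subseteq> N \<Longrightarrow> \<phi> -` W \<subseteq> A \<longleftrightarrow> W \<subseteq> \<phi> ` A"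
proof
  assume W: "W \<subseteq> N" "\<phi> -` W \<subseteq> A"
  show "W \<subseteq> \<phi> ` A"
  proof
    fix x assume "x \<in> W"
    moreover from this obtain i where "x = \<phi> i" using W by auto
    ultimately show "x \<in> \<phi> ` A" using W by auto
  qed
qed (use inj in \<open>auto dest: injD\<close>)

lemma w_subset:
  assumes "q \<in> \<Gamma> (Suc k)" shows "w q \<subseteq> A \<longleftrightarrow> vW q \<subseteq> \<phi> ` A"
proof -
  from assms have "vW q \<subseteq> N" by (rule \<Gamma>_Suc_cases) simp
  then show ?thesis unfolding w_def by (rule vimage_subset_iff)
qed

lemma strand_sum: "(\<Sum>q | q \<in> \<Gamma> (Suc k) \<and> w q \<subseteq> A. g q) = (\<Sum>q | q \<in> \<Gamma> (Suc k) \<and> vW q \<subseteq> \<phi> ` A. g q)"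
proof -
  have "{q \<in> \<Gamma> (Suc k). w q \<subseteq> A} = {q \<in> \<Gamma> (Suc k). vW q \<subseteq> \<phi> ` A}" using w_subset by blast
  then show ?thesis by simp
qed

lemma total_sum: "(\<Sum>q\<in>\<Gamma> (Suc k). g q) = (\<Sum>q | q \<in> \<Gamma> (Suc k) \<and> vW q \<subseteq> N. g q)"
  by (rule sum.cong) (auto elim: \<Gamma>_Suc_cases)

lemma exact:
  assumes z: "\<And>p. p \<in> \<Gamma> i \<Longrightarrow> w p \<subseteq> A \<Longrightarrow> (\<Sum>q | q \<in> \<Gamma> (Suc i) \<and> w q \<subseteq> A. \<alpha> p q * x q) = 0"
  shows "\<exists>y. \<forall>q\<in>\<Gamma> (Suc i). w q \<subseteq> A \<longrightarrow> x q = (\<Sum>u | u \<in> \<Gamma> (Suc (Suc i)) \<and> w u \<subseteq> A. \<alpha> q u * y u)"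
proof -
  let ?A = "\<phi> ` A"
  have A: "?A \<subseteq> N" "finite ?A" by auto
  have "strand_cycle d (d + i) ?A (family x)"
  proof (cases i)
    case 0
    have "(\<Sum>q | q \<in> \<Gamma> (Suc 0) \<and> w q \<subseteq> A. \<alpha> (enc {} {}) q * x q) = 0"
      using z[of "enc {} {}"] by (simp add: 0 \<Gamma>_def w_def vW_enc)
    then show ?thesis by (simp add: strand_sum sum_\<alpha>_0[OF A(1)] strand_cycle_def 0)
  next
    case (Suc k)
    have "bd ?A (family x) W J = 0" if W: "W \<subseteq> ?A" "Suc (card W) = d + i" "J \<subseteq> W" for W J
    proof -
      have cW: "card W = d + k" "W \<noteq> {}" "W \<subseteq> N" using W Suc A ne[of W k] by auto
      \<comment> \<open>The hypothesis gives zero only at the coordinates in \<open>Fr W\<close>.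
        The restricted boundary is a cocycle on \<open>W\<close>, hence zero everywhere.\<close>
      have "(\<lambda>J. if J \<subseteq> W then bd ?A (family x) W J else 0) = (\<lambda>_. 0)"
      proof (rule Fr_zero[OF cW(3,2) cocyc_bd])
        show "family x (insert j W) \<in> cocyc d \<I> (insert j W)" if "j \<in> ?A - W" for j
          using that W A by (intro family_cocyc) auto
        fix J' assume J': "J' \<in> Fr W"
        have p: "enc W J' \<in> \<Gamma> (Suc k)" using \<Gamma>_SucI cW J' by auto
        then have "w (enc W J') \<subseteq> A" using W(1) finW[OF cW(3)] by (simp add: w_subset vW_enc)
        then have "bd ?A (family x) W J' = 0"
          using z[of "enc W J'"] p sum_\<alpha>_Suc[OF A(1) W(1) cW(1) J', of x] by (simp add: Suc strand_sum)
        then show "(if J' \<subseteq> W then bd ?A (family x) W J' else 0) = 0" by simp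
      qed
      from fun_cong[OF this, of J] show ?thesis using W(3) by simp
    qed
    then show ?thesis using Suc by (simp add: strand_cycle_def)
  qed
  then have "\<exists>\<Psi>. (\<forall>U\<subseteq>?A. card U = Suc (d + i) \<longrightarrow> \<Psi> U \<in> cocyc d \<I> U) \<and>
             (\<forall>W\<subseteq>?A. card W = d + i \<longrightarrow> (\<forall>J\<subseteq>W. bd ?A \<Psi> W J = family x W J))"
    using A ne by (intro strand_exact far family_cocyc) auto
  then obtain \<Psi> where \<Psi>: "(\<forall>U\<subseteq>?A. card U = Suc (d + i) \<longrightarrow> \<Psi> U \<in> cocyc d \<I> U) \<and>
             (\<forall>W\<subseteq>?A. card W = d + i \<longrightarrow> (\<forall>J\<subseteq>W. bd ?A \<Psi> W J = family x W J))" by (rule exE)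
  define y where "y q = \<Psi> (vW q) (vJ q)" for q
  have fam: "family y U = \<Psi> U" if U: "U \<subseteq> ?A" "card U = Suc (d + i)" for U
  proof (rule family_expand)
    show 1: "U \<subseteq> N" "U \<noteq> {}" using U A by auto
    show "\<Psi> U \<in> cocyc d \<I> U" using \<Psi> U by blast
    show "y (enc U J) = \<Psi> U J" if "J \<in> Fr U" for J
      using vW_enc[OF finW[OF 1(1)]] vJ_enc[OF finJ[OF 1 that]] by (simp add: y_def)
  qed
  have "x q = (\<Sum>u | u \<in> \<Gamma> (Suc (Suc i)) \<and> w u \<subseteq> A. \<alpha> q u * y u)" if q: "q \<in> \<Gamma> (Suc i)" "w q \<subseteq> A" for q
  proof -
    from q(1) obtain W J where W: "q = enc W J" "W \<subseteq> N" "card W = d + i" "J \<in> Fr W" "vW q = W" "W \<noteq> {}" "finite W"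
      by (rule \<Gamma>_Suc_cases)
    have WA: "W \<subseteq> ?A" using q W w_subset by auto
    have "(\<Sum>u | u \<in> \<Gamma> (Suc (Suc i)) \<and> w u \<subseteq> A. \<alpha> q u * y u) = bd ?A (family y) W J"
      unfolding strand_sum W(1) by (rule sum_\<alpha>_Suc[OF A(1) WA W(3,4)])
    also have "\<dots> = bd ?A \<Psi> W J"
      unfolding bd_def using WA W(3,7) by (intro sum.cong refl) (simp add: fam)
    also have "\<dots> = family x W J" using \<Psi> WA W Fr_sub[OF W(2,6,4)] by blast
    also have "\<dots> = x q" using family_coord[OF W(2,6,4)] W(1) by simp
    finally show ?thesis by simp
  qed
  then show ?thesis by blast
qed

lemma \<alpha>_\<alpha>:
  assumes p: "p \<in> \<Gamma> i" and u: "u \<in> \<Gamma> (Suc (Suc i))"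
  shows "(\<Sum>q\<in>\<Gamma> (Suc i). \<alpha> p q * \<alpha> q u) = 0"
proof -
  \<comment> \<open>Column \<open>u\<close> of the matrix is the boundary of the family of this
    basis vector. The product then becomes \<open>bd\<close> applied twice or, for
    \<open>i = 0\<close>, the augmentation of a boundary.\<close>
  define e where "e q = (if q = u then 1 else 0 :: 'k)" for q
  have ecoord: "\<alpha> q u = bd N (family e) W J" if "q = enc W J" "W \<subseteq> N" "card W = d + i" "J \<in> Fr W" for q W J
  proof -
    have "bd N (family e) W J = (\<Sum>r\<in>\<Gamma> (Suc (Suc i)). \<alpha> q r * e r)"
      unfolding total_sum that(1) by (rule sum_\<alpha>_Suc[symmetric]) (use that in auto)
    also have "\<dots> = \<alpha> q u" using u fin_\<Gamma> by (simp add: e_def if_distrib cong: if_cong)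
    finally show ?thesis by simp
  qed
  have eco: "family e U \<in> cocyc d \<I> U" if "U \<subseteq> N" "U \<noteq> {}" for U by (rule family_cocyc[OF that])
  have fam: "family (\<lambda>q. \<alpha> q u) W = (\<lambda>J. if J \<subseteq> W then bd N (family e) W J else 0)"
    if W: "W \<subseteq> N" "card W = d + i" for W
  proof (rule family_expand[OF W(1) ne[OF W(2)] cocyc_bd])
    show "family e (insert j W) \<in> cocyc d \<I> (insert j W)" if "j \<in> N - W" for j
      using that W by (intro eco) auto
    show "\<alpha> (enc W J) u = (if J \<subseteq> W then bd N (family e) W J else 0)" if J: "J \<in> Fr W" for J
      using ecoord[OF refl W J] Fr_sub[OF W(1) ne[OF W(2)] J] by simp
  qed
  show ?thesis
  proof (cases i)
    case 0
    have "(\<Sum>q\<in>\<Gamma> (Suc i). \<alpha> p q * \<alpha> q u) = (\<Sum>W | W \<subseteq> N \<and> card W = d. family (\<lambda>q. \<alpha> q u) W W)"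
      using p unfolding total_sum by (simp add: 0 \<Gamma>_def[of 0] sum_\<alpha>_0)
    also have "\<dots> = (\<Sum>W | W \<subseteq> N \<and> card W = d. bd N (family e) W W)"
      using fam 0 by (intro sum.cong refl) simp
    also have "\<dots> = (\<Sum>U | U \<subseteq> N \<and> card U = Suc d. cob (family e U) U)"
      by (rule sum_bd_diagonal) simp
    also have "\<dots> = 0" by (intro sum.neutral ballI cocycD(4)[OF eco]) auto
    finally show ?thesis .
  next
    case (Suc k)
    from p[unfolded Suc] obtain W J where W: "p = enc W J" "W \<subseteq> N" "card W = d + k" "J \<in> Fr W" "W \<noteq> {}" "finite W"
      by (rule \<Gamma>_Suc_cases)
    have "(\<Sum>q\<in>\<Gamma> (Suc i). \<alpha> p q * \<alpha> q u) = bd N (family (\<lambda>q. \<alpha> q u)) W J"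
      unfolding total_sum W(1) Suc by (rule sum_\<alpha>_Suc[OF order_refl W(2-4)])
    also have "\<dots> = bd N (bd N (family e)) W J"
      unfolding bd_def[of N "family (\<lambda>q. \<alpha> q u)"] bd_def[of N "bd N (family e)"]
    proof (rule sum.cong[OF refl])
      fix j assume j: "j \<in> N - W"
      have "J \<subseteq> insert j W" using Fr_sub[OF W(2,5,4)] by blast
      then show "sg j W * family (\<lambda>q. \<alpha> q u) (insert j W) J = sg j W * bd N (family e) (insert j W) J"
        using fam[of "insert j W"] W j Suc by simp
    qed
    also have "\<dots> = 0" by (rule bd_bd) (use W in auto)
    finally show ?thesis .
  qed
qed

sublocale squarefree_complex \<Gamma> w \<alpha> "enc {} {}"
proof
  show "finite (\<Gamma> i)" for i by (rule fin_\<Gamma>)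
  show "\<Gamma> 0 = {enc {} {}}" by (simp add: \<Gamma>_def)
  show "w (enc {} {}) = {}" by (simp add: w_def vW_enc)
  show "\<alpha> (enc {} {}) q \<noteq> 0" for q by (simp add: \<alpha>_def vW_enc)
  show "w p \<subset> w q" if p: "p \<in> \<Gamma> i" and q: "q \<in> \<Gamma> (Suc i)" and nz: "\<alpha> p q \<noteq> 0" for p q i
  proof -
    from q obtain U J where U: "U \<subseteq> N" "vW q = U" "U \<noteq> {}" by (rule \<Gamma>_Suc_cases)
    show ?thesis
    proof (cases "vW p = {}")
      case True
      then show ?thesis using U by (auto simp: w_def)
    next
      case False
      then obtain j where "j \<in> U" "vW p = U - {j}"
        using nz U(2) unfolding \<alpha>_def by (auto elim!: sum.not_neutral_contains_not_neutral)
      moreover obtain i where "j = \<phi> i" using calculation U(1) by auto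
      ultimately have "\<phi> -` vW p \<subseteq> \<phi> -` vW q" "i \<in> \<phi> -` vW q" "i \<notin> \<phi> -` vW p" using U(2) by auto
      then show ?thesis unfolding w_def by blast
    qed
  qed
qed (use \<alpha>_\<alpha> exact in auto)

lemma card_w: "q \<in> \<Gamma> (Suc k) \<Longrightarrow> card (w q) = d + k"
  by (erule \<Gamma>_Suc_cases) (auto simp: w_def card_vimage_inj[OF inj])

end

section \<open>Betti numbers and projective dimension read off from a minimal resolution\<close>

lemma chosen_resolution_graded:
  assumes "graded_free_resolution K G"
  shows "graded_free_resolution K (chosen_resolution K)"
  unfolding chosen_resolution_def using assms by (rule someI)

lemma minimal_graded_free: "minimal_graded_free_resolution K G \<Longrightarrow> graded_free_resolution K G"
  by (simp add: minimal_graded_free_resolution_def)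

lemma graded_tor_dim_minimal:
  assumes "module.subspace (*) K" "\<And>t a. a \<in> K \<Longrightarrow> hpart (\<lambda>m. int (mdeg m)) t a \<in> K"
    and G: "minimal_graded_free_resolution K G"
  shows "graded_tor_dim K i s = card {p \<in> gens G i. shift G i p = s}"
  unfolding graded_tor_dim_def Let_def
  by (rule homology_dim_eq_card[OF assms(1,2) chosen_resolution_graded[OF minimal_graded_free[OF G]] G])

lemma tor_dim_minimal:
  assumes "module.subspace (*) K" "\<And>t a. a \<in> K \<Longrightarrow> hpart (\<lambda>m. int (mdeg m)) t a \<in> K"
    and G: "minimal_graded_free_resolution K G"
  shows "tor_dim K i = card (gens G i)"
  unfolding tor_dim_def Let_def
  using homology_dim_eq_card[OF assms(1,2) chosen_resolution_graded[OF minimal_graded_free[OF G]] G, of "\<lambda>_. True" i]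
  by simp

lemma projective_free_on: "projective (free_on B :: (nat \<Rightarrow>\<^sub>0 'a::comm_ring_1) set)"
  unfolding projective_def
proof (intro conjI exI[of _ "free_on (- B)"] subspace_free_on)
  show "free_on B \<inter> free_on (- B) = {0 :: nat \<Rightarrow>\<^sub>0 'a}"
  proof -
    have "x = 0" if "x \<in> free_on B" "x \<in> free_on (- B)" for x :: "nat \<Rightarrow>\<^sub>0 'a"
    proof (rule poly_mapping_eqI)
      fix k show "lookup x k = lookup 0 k"
        using lookup_free_on[OF that(1), of k] lookup_free_on[OF that(2), of k] by (cases "k \<in> B") auto
    qed
    moreover have "0 \<in> free_on B \<inter> free_on (- B)" by (simp add: free_on_def)
    ultimately show ?thesis by blast
  qed
  have "v \<in> {p + q |p q. p \<in> free_on B \<and> q \<in> free_on (- B)}" for v :: "nat \<Rightarrow>\<^sub>0 'a"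
  proof -
    let ?c = "\<lambda>B q. if q \<in> B then single q (1::'a) else 0"
    have in_B: "lin_ext (?c B) v \<in> free_on B" for B
      by (rule hom_free_into_subspace[OF lin_ext_hom subspace_free_on, of UNIV])
         (auto simp: free_on_def)
    have "v = lin_ext (?c B) v + lin_ext (?c (- B)) v"
      by (subst (1) basis_expansion[of v]) (auto simp: lin_ext_def simp flip: sum.distrib intro!: sum.cong)
    then show ?thesis using in_B by blast
  qed
  then show "{p + q |p q. p \<in> free_on B \<and> q \<in> free_on (- B)} = (UNIV :: (nat \<Rightarrow>\<^sub>0 'a) set)" by blast
qed

lemma projective_projection:
  assumes "projective (P :: (nat \<Rightarrow>\<^sub>0 'a::comm_ring_1) set)"
  shows "\<exists>\<pi>. module_hom fscale fscale \<pi> \<and> (\<forall>v. \<pi> v \<in> P) \<and> (\<forall>v\<in>P. \<pi> v = v)"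
proof -
  obtain Q where P: "module.subspace fscale P" and Q: "module.subspace fscale Q" "P \<inter> Q = {0}"
      "{p + q |p q. p \<in> P \<and> q \<in> Q} = UNIV"
    using assms by (auto simp: projective_def)
  note Pa = module.subspace_add[OF module_fscale P] and Ps = module.subspace_scale[OF module_fscale P]
    and Pd = module.subspace_diff[OF module_fscale P]
  note Qa = module.subspace_add[OF module_fscale Q(1)] and Qs = module.subspace_scale[OF module_fscale Q(1)]
    and Qd = module.subspace_diff[OF module_fscale Q(1)]
  have "\<forall>v. \<exists>p. p \<in> P \<and> v - p \<in> Q"
  proof
    fix v
    have "v \<in> {p + q |p q. p \<in> P \<and> q \<in> Q}" unfolding Q(3) by simp
    then obtain p q where "v = p + q" "p \<in> P" "q \<in> Q" by blast
    then show "\<exists>p. p \<in> P \<and> v - p \<in> Q" by (intro exI[of _ p]) simp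
  qed
  then obtain \<pi> where \<pi>: "\<forall>v. \<pi> v \<in> P \<and> v - \<pi> v \<in> Q" by (rule choice[THEN exE])
  have uniq: "\<pi> v = p" if "p \<in> P" "v - p \<in> Q" for v p
  proof -
    have "\<pi> v - p \<in> P" using Pd \<pi> that by blast
    moreover have "(v - p) - (v - \<pi> v) \<in> Q" using Qd \<pi> that by blast
    ultimately have "\<pi> v - p \<in> P \<inter> Q" by simp
    then show ?thesis using Q(2) by simp
  qed
  have "module_hom fscale fscale \<pi>"
    unfolding module_hom_iff
  proof (intro conjI allI module_fscale)
    fix u v a
    show "\<pi> (u + v) = \<pi> u + \<pi> v"
    proof (rule uniq)
      have "(u - \<pi> u) + (v - \<pi> v) \<in> Q" using Qa \<pi> by blast
      then show "u + v - (\<pi> u + \<pi> v) \<in> Q" by (simp add: algebra_simps)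
    qed (use Pa \<pi> in blast)
    show "\<pi> (fscale a u) = fscale a (\<pi> u)"
    proof (rule uniq)
      have "fscale a (u - \<pi> u) \<in> Q" using Qs \<pi> by blast
      then show "fscale a u - fscale a (\<pi> u) \<in> Q"
        by (simp add: module.scale_right_diff_distrib[OF module_fscale])
    qed (use Ps \<pi> in blast)
  qed
  moreover have "\<pi> v = v" if "v \<in> P" for v
    using module.subspace_0[OF module_fscale Q(1)] by (intro uniq that) simp
  ultimately show ?thesis using \<pi> by blast
qed

text \<open>For \<open>i > p\<close> the identity of the \<open>i\<close>-th module of
  \<open>G\<close> factors, up to homotopy, through \<open>P i = {0}\<close>. Both homotopy terms
  involve a differential of \<open>G\<close> and reduce to zero by minimality, whereas a basis
  vector does not.\<close>

lemma minimal_resolution_length_le: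
  fixes K :: "('n::finite, 'k::field) mpoly set"
  assumes K: "module.subspace (*) K" and G: "minimal_graded_free_resolution K G"
    and R: "resolution K P D \<epsilon>" and P: "\<And>i. projective (P i)" "\<And>i. i > p \<Longrightarrow> P i = {0}"
    and i: "gens G i \<noteq> {}"
  shows "i \<le> p"
proof (rule ccontr)
  assume "\<not> i \<le> p"
  then obtain j where j: "i = Suc j" and P0: "P i = {0}" using P(2) by (cases i) auto
  obtain q where q: "q \<in> gens G i" using i by auto
  let ?\<gamma> = "\<lambda>m :: 'n \<Rightarrow>\<^sub>0 nat. 0 :: int"
  have RG: "resolution K (\<lambda>i. free_on (gens G i)) (diff G) (aug G)"
    using G by (simp add: minimal_graded_free_resolution_def graded_free_resolution_def)
  have "\<forall>i. \<exists>\<pi>. module_hom fscale fscale \<pi> \<and> (\<forall>v. \<pi> v \<in> P i) \<and> (\<forall>v\<in>P i. \<pi> v = v)"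
    using projective_projection[OF P(1)] by blast
  then obtain \<pi> where \<pi>: "\<forall>i. module_hom fscale fscale (\<pi> i) \<and> (\<forall>v. \<pi> i v \<in> P i) \<and> (\<forall>v\<in>P i. \<pi> i v = v)"
    by (rule choice[THEN exE])
  \<comment> \<open>Each \<open>P i\<close> is a summand of the whole module of countable rank, so
    all indices form the basis of the source; the grading is trivial because \<open>P\<close>
    carries none.\<close>
  have SP: "graded_source ?\<gamma> K (\<lambda>_. UNIV) (\<lambda>_ _. 0) (\<lambda>i. D i \<circ> \<pi> (Suc i)) (\<epsilon> \<circ> \<pi> 0)"
    by (rule graded_source_trivial[OF R]) (use \<pi> in \<open>auto simp: free_on_def\<close>)
  have "graded_source ?\<gamma> K (gens G) (\<lambda>_ _. 0) (\<lambda>i. diff G i \<circ> (\<lambda>v. v)) (aug G \<circ> (\<lambda>v. v))"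
    by (rule graded_source_trivial[OF RG]) (auto simp: module_hom_iff module_fscale)
  then have SG: "graded_source ?\<gamma> K (gens G) (\<lambda>_ _. 0) (diff G) (aug G)" by (simp add: o_def)
  note TG = graded_target_trivial[OF RG] and TP = graded_target_trivial[OF R]
  obtain a where a: "\<And>i. gmap ?\<gamma> (gens G i) (\<lambda>_. 0) (P i) (\<lambda>_. 0) (a i)"
    "\<And>v. v \<in> free_on (gens G 0) \<Longrightarrow> \<epsilon> (a 0 v) - aug G v \<in> K"
    "\<And>i v. v \<in> free_on (gens G (Suc i)) \<Longrightarrow> D i (a (Suc i) v) = a i (diff G i v)"
    by (rule chain_lift[OF additive_grading_trivial K SG TP]) (assumption | blast)+
  obtain b where b: "\<And>i. gmap ?\<gamma> UNIV (\<lambda>_. 0) (free_on (gens G i)) (\<lambda>_. 0) (b i)"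
    "\<And>v. v \<in> free_on UNIV \<Longrightarrow> aug G (b 0 v) - (\<epsilon> \<circ> \<pi> 0) v \<in> K"
    "\<And>i v. v \<in> free_on UNIV \<Longrightarrow> diff G i (b (Suc i) v) = b i ((D i \<circ> \<pi> (Suc i)) v)"
    by (rule chain_lift[OF additive_grading_trivial K SP TG]) (assumption | blast)+
  have U: "v \<in> free_on UNIV" for v :: "nat \<Rightarrow>\<^sub>0 ('n, 'k) mpoly" by (simp add: free_on_def)
  have aP: "a i v \<in> P i" if "v \<in> free_on (gens G i)" for i v
    using gmap_into[OF a(1) resolution_homs(3)[OF R] that] .
  have \<pi>a: "\<pi> i (a i v) = a i v" if "v \<in> free_on (gens G i)" for i v
    using aP[OF that] \<pi> by blast
  obtain h where h: "\<And>i. gmap ?\<gamma> (gens G i) (\<lambda>_. 0) (free_on (gens G (Suc i))) (\<lambda>_. 0) (h i)"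
    "\<And>v. v \<in> free_on (gens G 0) \<Longrightarrow> b 0 (a 0 v) - v = diff G 0 (h 0 v)"
    "\<And>i v. v \<in> free_on (gens G (Suc i)) \<Longrightarrow> b (Suc i) (a (Suc i) v) - v = diff G (Suc i) (h (Suc i) v) + h i (diff G i v)"
  proof (rule homotopic_to_id[OF additive_grading_trivial K SG TG, of "\<lambda>i v. b i (a i v)"])
    show "gmap ?\<gamma> (gens G i) (\<lambda>_. 0) (free_on (gens G i)) (\<lambda>_. 0) (\<lambda>v. b i (a i v))" for i
    proof (rule gmap_compose[OF additive_grading_trivial _ b(1) subspace_free_on])
      show "gmap ?\<gamma> (gens G i) (\<lambda>_. 0) (free_on UNIV) (\<lambda>_. 0) (a i)"
        using a(1)[of i] by (auto simp: gmap_def U)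
    qed
    show "aug G (b 0 (a 0 v)) - aug G v \<in> K" if "v \<in> free_on (gens G 0)" for v
      using module.subspace_add[OF module_mult K b(2)[OF U, of "a 0 v"] a(2)[OF that]] \<pi>a[OF that] by simp
    show "diff G i (b (Suc i) (a (Suc i) v)) = b i (a i (diff G i v))" if "v \<in> free_on (gens G (Suc i))" for i v
      using b(3)[OF U] a(3)[OF that] \<pi>a[OF that] by simp
  qed (assumption | blast)+
  let ?e = "single q 1 :: nat \<Rightarrow>\<^sub>0 ('n, 'k) mpoly"
  have e: "?e \<in> free_on (gens G (Suc j))" using q j by (simp add: free_on_basis)
  note hG = resolution_homs(1)[OF RG]
  have G0: "red (diff G i v) = 0" if "v \<in> free_on (gens G (Suc i))" for i v
    unfolding red_eq_residue[OF hG] using G that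
    by (intro residue_zero_of_minimal[OF _ hG, of "gens G (Suc i)"] free_onI)
       (auto simp: minimal_graded_free_resolution_def lookup_red lookup_free_on const_coeff_def)
  have "a (Suc j) ?e = 0" using aP[OF e] P0 j by simp
  moreover have "b (Suc j) 0 = 0" by (rule module_hom.zero[OF gmap_hom[OF b(1)]])
  ultimately have "- ?e = diff G (Suc j) (h (Suc j) ?e) + h j (diff G j ?e)"
    using h(3)[OF e] by simp
  then have "red (- ?e) = red (diff G (Suc j) (h (Suc j) ?e)) + red (h j (diff G j ?e))"
    by (simp add: red_add)
  also have "red (diff G (Suc j) (h (Suc j) ?e)) = 0"
    by (rule G0) (rule gmap_into[OF h(1) subspace_free_on e])
  also have "red (h j (diff G j ?e)) = 0"
    unfolding red_eq_residue[OF gmap_hom[OF h(1)]] G0[OF e]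
    by (rule module_hom.zero[OF residue_hom[OF gmap_hom[OF h(1)]]])
  finally have "lookup (red (- ?e)) q = 0" by simp
  then show False by (simp add: lookup_red const_coeff_def)
qed

lemma proj_dim_minimal:
  fixes K :: "('n::finite, 'k::field) mpoly set"
  assumes K: "module.subspace (*) K" and G: "minimal_graded_free_resolution K G"
    and p: "gens G p \<noteq> {}" "\<And>i. i > p \<Longrightarrow> gens G i = {}"
  shows "proj_dim K = enat p"
proof (rule antisym)
  have RG: "resolution K (\<lambda>i. free_on (gens G i)) (diff G) (aug G)"
    using G by (simp add: minimal_graded_free_resolution_def graded_free_resolution_def)
  have "free_on (gens G i) = {0}" if "i > p" for i
    using p(2)[OF that] by (auto simp: free_on_def)
  then show "proj_dim K \<le> enat p"
    unfolding proj_dim_def using RG projective_free_on by (intro Inf_lower) blast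
  show "enat p \<le> proj_dim K"
    unfolding proj_dim_def
    by (rule Inf_greatest) (use minimal_resolution_length_le[OF K G _ _ _ p(1)] in auto)
qed

section \<open>Counting\<close>

lemma card_supersets:
  assumes "finite N" "I \<subseteq> N" "card I = d"
  shows "card {W. W \<subseteq> N \<and> card W = d + k \<and> I \<subseteq> W} = (card N - d) choose k"
proof -
  have fI: "finite I" using assms finite_subset by auto
  have "bij_betw (\<lambda>T. I \<union> T) {T. T \<subseteq> N - I \<and> card T = k} {W. W \<subseteq> N \<and> card W = d + k \<and> I \<subseteq> W}"
  proof (rule bij_betw_byWitness[where f'="\<lambda>W. W - I"])
    show "(\<lambda>T. I \<union> T) ` {T. T \<subseteq> N - I \<and> card T = k} \<subseteq> {W. W \<subseteq> N \<and> card W = d + k \<and> I \<subseteq> W}"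
    proof
      fix W assume "W \<in> (\<lambda>T. I \<union> T) ` {T. T \<subseteq> N - I \<and> card T = k}"
      then obtain T where T: "W = I \<union> T" "T \<subseteq> N - I" "card T = k" by auto
      then have "finite T" "I \<inter> T = {}" using assms(1) finite_subset by auto
      then show "W \<in> {W. W \<subseteq> N \<and> card W = d + k \<and> I \<subseteq> W}"
        using T assms fI by (auto simp: card_Un_disjoint)
    qed
    show "(\<lambda>W. W - I) ` {W. W \<subseteq> N \<and> card W = d + k \<and> I \<subseteq> W} \<subseteq> {T. T \<subseteq> N - I \<and> card T = k}"
      using assms fI by (auto simp: card_Diff_subset)
  qed auto
  then have "card {W. W \<subseteq> N \<and> card W = d + k \<and> I \<subseteq> W} = card {T. T \<subseteq> N - I \<and> card T = k}"
    by (simp add: bij_betw_same_card)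
  also have "\<dots> = card (N - I) choose k" using assms(1) by (simp add: n_subsets)
  finally show ?thesis using assms fI by (simp add: card_Diff_subset)
qed

lemma sum_card_members:
  assumes "finite N" "finite \<I>" "\<And>I. I \<in> \<I> \<Longrightarrow> I \<subseteq> N \<and> card I = d"
  shows "(\<Sum>W | W \<subseteq> N \<and> card W = d + k. card {I \<in> \<I>. I \<subseteq> W}) = card \<I> * ((card N - d) choose k)"
proof -
  let ?Ws = "{W. W \<subseteq> N \<and> card W = d + k}"
  have fin: "finite ?Ws" using assms(1) by simp
  have "(\<Sum>W\<in>?Ws. card {I \<in> \<I>. I \<subseteq> W}) = (\<Sum>W\<in>?Ws. \<Sum>I | I \<in> \<I> \<and> I \<subseteq> W. 1)" by simp
  also have "\<dots> = (\<Sum>I\<in>\<I>. \<Sum>W | W \<in> ?Ws \<and> I \<subseteq> W. 1)" by (rule sum.swap_restrict[OF fin assms(2)])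
  also have "\<dots> = (\<Sum>I\<in>\<I>. (card N - d) choose k)"
    using card_supersets[OF assms(1)] assms(3) by (intro sum.cong refl) (simp add: conj_ac)
  finally show ?thesis by simp
qed

text \<open>
  The \<open>(d - 1)\<close>-subsets of the members of the family are pairwise distinct, so there are at most
  \<open>n choose (d - 1)\<close> of them.
\<close>

lemma far_card_less:
  fixes \<I> :: "'n::finite set set"
  assumes far: "far d \<I>" and d: "1 < d" "d < CARD('n)"
  shows "card \<I> \<noteq> (CARD('n) - 1) choose (d - 1)"
proof
  define n where "n = CARD('n)"
  assume eq: "card \<I> = (CARD('n) - 1) choose (d - 1)"
  let ?sub = "\<lambda>I :: 'n set. {S. S \<subseteq> I \<and> card S = d - 1}"
  have card_sub: "card (?sub I) = d" if "I \<in> \<I>" for I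
  proof -
    have "card I = d" "finite I" using far that by (auto simp: far_def)
    then show ?thesis using d n_subsets[of I "d - 1"] binomial_symmetric[of "d - 1" d] by simp
  qed
  have "?sub I \<inter> ?sub J = {}" if "I \<in> \<I>" "J \<in> \<I>" "I \<noteq> J" for I J
  proof (rule ccontr)
    assume "?sub I \<inter> ?sub J \<noteq> {}"
    then obtain S where S: "S \<subseteq> I \<inter> J" "card S = d - 1" by auto
    then have "d - 1 \<le> card (I \<inter> J)" by (metis card_mono finite)
    moreover have "card (I \<inter> J) + 2 \<le> d" using far that by (auto simp: far_def)
    ultimately show False by simp
  qed
  then have "card (\<Union> (?sub ` \<I>)) = (\<Sum>I\<in>\<I>. card (?sub I))"
    by (intro card_UN_disjoint) auto
  also have "\<dots> = (\<Sum>I\<in>\<I>. d)" by (intro sum.cong refl card_sub)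
  also have "\<dots> = card \<I> * d" by simp
  finally have "card \<I> * d = card (\<Union> (?sub ` \<I>))" by simp
  also have "\<dots> \<le> card {S :: 'n set. S \<subseteq> UNIV \<and> card S = d - 1}"
    by (intro card_mono) auto
  also have "\<dots> = n choose (d - 1)" by (subst n_subsets) (auto simp: n_def)
  finally have "card \<I> * d * (n - (d - 1)) \<le> (n - (d - 1)) * (n choose (d - 1))"
    by (simp add: mult.commute)
  \<comment> \<open>Absorption expresses \<open>n choose (d - 1)\<close> through the assumed value
    of \<open>card \<I>\<close>. Cancelling leaves \<open>d * (n - d + 1) \<le> n\<close>, but the
    difference of the two sides is \<open>(d - 1) * (n - d)\<close>, which is positive.\<close>
  also have "\<dots> = n * card \<I>" using binomial_absorb_comp[of n "d - 1"] eq by (simp add: n_def)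
  finally have "card \<I> * (d * (n - (d - 1))) \<le> card \<I> * n" by (simp add: mult_ac)
  moreover have "card \<I> > 0" using d eq by simp
  ultimately have "d * (n - (d - 1)) \<le> n" by simp
  moreover obtain a b where "d = Suc (Suc a)" "n = d + Suc b"
    using d less_imp_Suc_add[of d n] by (cases d; cases "d - 1") (auto simp: n_def)
  ultimately show False by simp
qed

text \<open>The last conjunct leaves out the cases in which the final entry of the table is zero.
  For \<open>r = 1\<close> and \<open>d = n\<close> the ideal is zero; for \<open>r = 1\<close> and
  \<open>d = 1\<close> it is generated by \<open>n - 1\<close> variables, and the projective
  dimension is \<open>n - 1\<close> instead of \<open>n\<close>.\<close>

theorem corollary5p12:
  fixes I :: "nat \<Rightarrow> 'n::finite set"
    and K' :: "('n, 'k::field) mpoly set"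
    and n d r :: nat
  assumes n: "n = CARD('n)"
    and d: "1 \<le> d" "d \<le> n"
    and card_I: "\<And>i. i \<in> {1..r} \<Longrightarrow> card (I i) = d"
    and inter_I: "\<And>i j. i \<in> {1..r} \<Longrightarrow> j \<in> {1..r} \<Longrightarrow> i \<noteq> j \<Longrightarrow>
                    int (card (I i \<inter> I j)) \<le> int d - 2"
    and K': "K' = sqfree_complement_ideal d (I ` {1..r})"
  shows "(\<forall>i j. int (betti_table K' i j) =
            (if i = 0 \<and> j = 0 then 1
             else if 1 \<le> i \<and> i \<le> n - d + 1 \<and> j = int d - 1
               then int ((d + i - 2) choose (i - 1)) * int (n choose (d + i - 1))
                    - int r * int ((n - d) choose (i - 1))
             else 0))
       \<and> has_linear_resolution d K'
       \<and> (\<not> (r = 1 \<and> (d = 1 \<or> d = n)) \<longrightarrow>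
            proj_dim K' = enat (n - d + 1) \<and>
            int (ring_type K') = int ((n - 1) choose (n - d)) - int r)"
proof -
  define \<J> where "\<J> = I ` {1..r}"
  have far_J: "far d \<J>"
    unfolding far_def
  proof (intro conjI ballI impI)
    show "finite A" "card A = d" if "A \<in> \<J>" for A using that card_I by (auto simp: \<J>_def)
    show "card (A \<inter> B) + 2 \<le> d" if AB: "A \<in> \<J>" "B \<in> \<J>" "A \<noteq> B" for A B
    proof -
      obtain i j where "i \<in> {1..r}" "j \<in> {1..r}" "A = I i" "B = I j"
        using AB(1,2) unfolding \<J>_def by blast
      then show ?thesis using inter_I[of i j] AB(3) by (cases "i = j") auto
    qed
  qed
  have card_J: "card \<J> = r"
  proof -
    have "inj_on I {1..r}"
    proof (rule inj_onI, rule ccontr)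
      fix i j assume ij: "i \<in> {1..r}" "j \<in> {1..r}" "I i = I j" "i \<noteq> j"
      then show False using inter_I[of i j] card_I[of j] by simp
    qed
    then show ?thesis by (simp add: \<J>_def card_image)
  qed
  obtain \<phi> :: "'n \<Rightarrow> nat" where inj: "inj \<phi>"
    using finite_imp_inj_to_nat_seg[of "UNIV :: 'n set"] by auto
  define \<I> where "\<I> = image \<phi> ` \<J>"
  have card_img: "card (\<phi> ` A) = card A" for A using inj by (simp add: card_image inj_on_subset)
  have inj_img: "\<phi> ` A = \<phi> ` B \<longleftrightarrow> A = B" for A B using inj by (rule inj_image_eq_iff)
  have far: "far d \<I>"
    using far_J card_img by (auto simp: far_def \<I>_def inj_img simp flip: image_Int[OF inj])
  have card_II: "card \<I> = r"
    unfolding \<I>_def card_J[symmetric] by (intro card_image inj_onI) (simp add: inj_img)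
  have fin_II: "finite \<I>" by (simp add: \<I>_def \<J>_def)
  let ?P = "\<lambda>W F. F \<subseteq> {J. J \<subseteq> W \<and> card J = d} \<and>
           card F + card {I \<in> \<I>. I \<subseteq> W} = (card W - 1) choose (d - 1) \<and>
           (\<forall>x. \<exists>!c. c \<in> cocyc d \<I> W \<and> (\<forall>J\<in>F. c J = (x J :: 'k)))"
  have "\<forall>W. \<exists>F. W \<subseteq> range \<phi> \<and> W \<noteq> {} \<longrightarrow> ?P W F"
  proof
    fix W
    show "\<exists>F. W \<subseteq> range \<phi> \<and> W \<noteq> {} \<longrightarrow> ?P W F"
    proof (cases "W \<subseteq> range \<phi> \<and> W \<noteq> {}")
      case True
      then have "finite W" by (auto intro: finite_subset)
      then have "\<exists>F. ?P W F" using True by (intro cocyc_free[OF _ far d(1)]) auto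
      then show ?thesis using True by simp
    qed blast
  qed
  then obtain Fr where "\<forall>W. W \<subseteq> range \<phi> \<and> W \<noteq> {} \<longrightarrow> ?P W (Fr W)" by (rule choice[THEN exE])
  then have Fr: "?P W (Fr W)" if "W \<subseteq> range \<phi>" "W \<noteq> {}" for W using that by simp
  have Fr_ex1: "\<exists>!c. c \<in> cocyc d \<I> W \<and> (\<forall>J\<in>Fr W. c J = (x J :: 'k))" if "W \<subseteq> range \<phi>" "W \<noteq> {}" for W x
    by (rule Fr[OF that, THEN conjunct2, THEN conjunct2, THEN spec])
  define E :: "nat set \<Rightarrow> nat set \<Rightarrow> nat set \<Rightarrow> 'k" where
    "E W J = (THE c. c \<in> cocyc d \<I> W \<and> (\<forall>J'\<in>Fr W. c J' = (if J = J' then 1 else 0)))" for W J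
  have E: "E W J \<in> cocyc d \<I> W \<and> (\<forall>J'\<in>Fr W. E W J J' = (if J = J' then 1 else 0))"
    if "W \<subseteq> range \<phi>" "W \<noteq> {}" for W J
    unfolding E_def by (rule theI'[OF Fr_ex1[OF that]])
  interpret cocyc_bases \<phi> d \<I> Fr E
  proof
    show "J \<subseteq> W \<and> card J = d" if "W \<subseteq> range \<phi>" "W \<noteq> {}" "J \<in> Fr W" for W J
      using Fr[OF that(1,2), THEN conjunct1] that(3) by blast
    show "c = (\<lambda>_. 0)" if "W \<subseteq> range \<phi>" "W \<noteq> {}" "c \<in> cocyc d \<I> W" "\<And>J. J \<in> Fr W \<Longrightarrow> c J = 0"
      for W and c :: "nat set \<Rightarrow> 'k"
      by (rule ex1_implies_unique[OF Fr_ex1[OF that(1,2), of "\<lambda>_. 0"]]) (use that(3,4) cocyc_zero in auto)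
  qed (use inj d far E in auto)
  have cardN: "card (range \<phi>) = n" using card_img[of UNIV] n by simp
  have \<I>_sub: "A \<subseteq> range \<phi> \<and> card A = d" if "A \<in> \<I>" for A
    using that far by (auto simp: far_def \<I>_def)
  have card_Fr: "card (Fr W) + card {I \<in> \<I>. I \<subseteq> W} = (card W - 1) choose (d - 1)"
    if "W \<subseteq> range \<phi>" "W \<noteq> {}" for W
    by (rule Fr[OF that, THEN conjunct2, THEN conjunct1])
  \<comment> \<open>Sums the formula for \<open>card (Fr W)\<close> over all \<open>W\<close> with
    \<open>d + k\<close> elements; each member of the family lies in \<open>(n - d) choose k\<close>
    of them. The additive form avoids subtraction of natural numbers.\<close>
  have count: "card (\<Gamma> (Suc k)) + r * ((n - d) choose k) = ((d + k - 1) choose k) * (n choose (d + k))" for k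
  proof -
    have "card (\<Gamma> (Suc k)) + r * ((n - d) choose k) =
       (\<Sum>W | W \<subseteq> range \<phi> \<and> card W = d + k. card (Fr W) + card {I \<in> \<I>. I \<subseteq> W})"
      unfolding card_\<Gamma> sum.distrib
      using sum_card_members[of "range \<phi>" \<I> d k] \<I>_sub fin_II by (simp add: cardN card_II)
    also have "\<dots> = (\<Sum>W | W \<subseteq> range \<phi> \<and> card W = d + k. (d + k - 1) choose (d - 1))"
    proof (intro sum.cong refl)
      fix W assume "W \<in> {W. W \<subseteq> range \<phi> \<and> card W = d + k}"
      then have W: "W \<subseteq> range \<phi>" "card W = d + k" by auto
      show "card (Fr W) + card {I \<in> \<I>. I \<subseteq> W} = (d + k - 1) choose (d - 1)"
        using card_Fr[OF W(1) ne[OF W(2)]] unfolding W(2) .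
    qed
    also have "\<dots> = card {W. W \<subseteq> range \<phi> \<and> card W = d + k} * ((d + k - 1) choose (d - 1))" by simp
    also have "card {W. W \<subseteq> range \<phi> \<and> card W = d + k} = n choose (d + k)"
      by (subst n_subsets) (simp_all add: cardN)
    also have "(d + k - 1) choose (d - 1) = (d + k - 1) choose k"
      using d by (subst binomial_symmetric) auto
    finally show ?thesis by (simp add: mult.commute)
  qed
  have gens_empty: "\<Gamma> i = {}" if i: "i > n - d + 1" for i
  proof -
    obtain k where k: "i = Suc k" "k > n - d" using i by (cases i) auto
    have none: "n choose (d + k) = 0" using k(2) d by (intro binomial_eq_0) simp
    have "card (\<Gamma> i) = 0" using count[of k] unfolding none k(1) by simp
    then show ?thesis using fin_\<Gamma> by simp
  qed
  have "K' = aug_ideal"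
  proof -
    \<comment> \<open>For a \<open>d\<close>-set \<open>W\<close> the number of coordinates and the
      number of family members inside \<open>W\<close> add up to 1, so exactly the sets outside the
      family yield a generator.\<close>
    have "w ` \<Gamma> (Suc 0) = {J. card J = d \<and> J \<notin> \<J>}"
    proof (intro equalityI subsetI)
      fix S assume "S \<in> w ` \<Gamma> (Suc 0)"
      then obtain q where q: "q \<in> \<Gamma> (Suc 0)" "S = w q" by blast
      from q(1) obtain W J where W: "W \<subseteq> range \<phi>" "card W = d" "J \<in> Fr W" "vW q = W" "W \<noteq> {}" "finite W"
        by (rule \<Gamma>_Suc_cases) simp
      have "\<phi> ` S = W" using W q by (auto simp: w_def)
      have "card (Fr W) > 0" using W(3) finFr[OF W(1,5)] by (auto simp: card_gt_0_iff)
      then have "card {I \<in> \<I>. I \<subseteq> W} = 0" using card_Fr[OF W(1,5)] W(2) by simp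
      then have "{I \<in> \<I>. I \<subseteq> W} = {}" using W(6) finite_subset[of "{I \<in> \<I>. I \<subseteq> W}" "Pow W"] by auto
      then have "W \<notin> \<I>" by auto
      then have "S \<notin> \<J>" using \<open>\<phi> ` S = W\<close> by (auto simp: \<I>_def)
      then show "S \<in> {J. card J = d \<and> J \<notin> \<J>}" using card_w[OF q(1)] q(2) by simp
    next
      fix S assume S: "S \<in> {J. card J = d \<and> J \<notin> \<J>}"
      let ?W = "\<phi> ` S"
      have W: "?W \<subseteq> range \<phi>" "card ?W = d" "?W \<noteq> {}" using S card_img d by auto
      have "{I \<in> \<I>. I \<subseteq> ?W} = {}"
      proof (rule ccontr)
        assume "{I \<in> \<I>. I \<subseteq> ?W} \<noteq> {}"
        then obtain A where A: "A \<in> \<I>" "A \<subseteq> ?W" by blast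
        then have "A = ?W" using \<I>_sub[OF A(1)] W by (intro card_subset_eq) auto
        then show False using A(1) S by (auto simp: \<I>_def inj_img)
      qed
      then have c0: "card {I \<in> \<I>. I \<subseteq> ?W} = 0" by (simp only: card.empty)
      have "card (Fr ?W) = 1" using card_Fr[OF W(1,3)] unfolding c0 W(2) by simp
      then obtain J where J: "J \<in> Fr ?W" by (metis card_1_singletonE insertI1)
      have "enc ?W J \<in> \<Gamma> (Suc 0)" using W J by (intro \<Gamma>_SucI) auto
      moreover have "w (enc ?W J) = S" using inj by (simp add: w_def vW_enc inj_vimage_image_eq)
      ultimately show "S \<in> w ` \<Gamma> (Suc 0)" by blast
    qed
    then show ?thesis
      unfolding K' sqfree_complement_ideal_def aug_ideal_def \<J>_def[symmetric]
      by (subst squarefree_ideal_gen[symmetric]) simp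
  qed
  have sub: "module.subspace (*) K'"
    unfolding \<open>K' = aug_ideal\<close> aug_ideal_def by (rule subspace_squarefree_ideal)
  have hom: "hpart (\<lambda>m. int (mdeg m)) t a \<in> K'" if "a \<in> K'" for t a
    using that unfolding \<open>K' = aug_ideal\<close> aug_ideal_def by (simp add: keys_hpart)
  have G: "minimal_graded_free_resolution K' res" unfolding \<open>K' = aug_ideal\<close> by (rule minimal_res)
  have gens_res: "gens res = \<Gamma>" and shift_res: "shift res i p = int (card (w p))" for i p
    by (simp_all add: res_def)
  have betti: "betti_table K' i j = card {p \<in> \<Gamma> i. int (card (w p)) = int i + j}" for i j
    unfolding betti_table_def using graded_tor_dim_minimal[OF sub hom G] by (simp add: gens_res shift_res)
  have "int (betti_table K' i j) =
            (if i = 0 \<and> j = 0 then 1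
             else if 1 \<le> i \<and> i \<le> n - d + 1 \<and> j = int d - 1
               then int ((d + i - 2) choose (i - 1)) * int (n choose (d + i - 1))
                    - int r * int ((n - d) choose (i - 1))
             else 0)" for i j
  proof (cases i)
    case 0
    have "{p \<in> \<Gamma> 0. int (card (w p)) = int 0 + j} = (if j = 0 then {enc {} {}} else {})"
      by (auto simp: gens_0)
    then show ?thesis unfolding betti 0 by simp
  next
    case (Suc k)
    \<comment> \<open>Generators in position \<open>k + 1\<close> all have degree
      \<open>d + k\<close>, which places them in row \<open>d - 1\<close>.\<close>
    have deg: "{p \<in> \<Gamma> i. int (card (w p)) = int i + j} = (if j = int d - 1 then \<Gamma> i else {})"
      using card_w unfolding Suc by auto
    show ?thesis
    proof (cases "j = int d - 1 \<and> i \<le> n - d + 1")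
      case True
      have "int (card (\<Gamma> i)) + int r * int ((n - d) choose k) = int ((d + k - 1) choose k) * int (n choose (d + k))"
        using count[of k] unfolding Suc by (metis of_nat_add of_nat_mult)
      then show ?thesis using True Suc unfolding betti deg by simp
    next
      case False
      then have "(if j = int d - 1 then \<Gamma> i else {}) = {}" using gens_empty[of i] by auto
      then show ?thesis using False Suc unfolding betti deg by auto
    qed
  qed
  moreover have "has_linear_resolution d K'"
    unfolding has_linear_resolution_def
  proof (intro exI[of _ res] conjI allI impI ballI G)
    show "card (gens res 0) = 1" by (simp add: gens_res gens_0)
    show "shift res 0 p = 0" if "p \<in> gens res 0" for p
      using that by (simp add: gens_res shift_res gens_0)
    show "shift res i p = int d + int i - 1" if "1 \<le> i" "p \<in> gens res i" for i p
      using that card_w[of p "i - 1"] by (simp add: gens_res shift_res)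
  qed
  moreover have "proj_dim K' = enat (n - d + 1) \<and>
            int (ring_type K') = int ((n - 1) choose (n - d)) - int r"
    if nontrivial: "\<not> (r = 1 \<and> (d = 1 \<or> d = n))"
  proof -
    have top: "card (\<Gamma> (Suc (n - d))) + r = (n - 1) choose (n - d)"
      using count[of "n - d"] unfolding le_add_diff_inverse[OF d(2)] by simp
    have sym: "(n - 1) choose (n - d) = (n - 1) choose (d - 1)"
      using d binomial_symmetric[of "n - d" "n - 1"] by simp
    \<comment> \<open>If the last module were zero, \<open>r\<close> would equal
      \<open>(n - 1) choose (d - 1)\<close>. This is 1 for \<open>d = 1\<close> and
      \<open>d = n\<close>, the excluded cases, and contradicts \<open>far_card_less\<close> for all
      other \<open>d\<close>.\<close>
    have "card (\<Gamma> (Suc (n - d))) \<noteq> 0"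
    proof
      assume "card (\<Gamma> (Suc (n - d))) = 0"
      then have r: "r = (n - 1) choose (d - 1)" using top sym by simp
      show False
      proof (cases "d = 1 \<or> d = n")
        case True
        then have "r = 1" using r by auto
        then show False using nontrivial True by simp
      next
        case False
        then show False using far_card_less[OF far_J] r d n card_J by auto
      qed
    qed
    then have "\<Gamma> (Suc (n - d)) \<noteq> {}" by auto
    then have pd: "proj_dim K' = enat (n - d + 1)"
      using gens_empty by (intro proj_dim_minimal[OF sub G]) (simp_all add: gens_res)
    then have "ring_type K' = card (\<Gamma> (Suc (n - d)))"
      unfolding ring_type_def using tor_dim_minimal[OF sub hom G] by (simp add: gens_res)
    then show ?thesis using pd top by linarith
  qed
  ultimately show ?thesis by blast
qed

end
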